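(* Let $U=\mathbb C^m$ with basis $\mathbf e_1,\dots,\mathbf e_m$, $G=GL(U)$, $\sigma\in\mathbb Z^m$, and let $S\in\mathbb Z$ be such that $\mathsf L_\sigma\supseteq z^S\mathsf L_0$. Let $\mathcal D=\mathsf L_\sigma/z^S\mathsf L_0$, let $\bar z$ be the nilpotent operator induced by $z$ on $\mathcal D$, let $\mathcal N\subset\mathfrak{gl}(\mathcal D)$ be the nilpotent cone, and let $\lambda$ be the partition obtained by reordering $(\sigma_1+S,\dots,\sigma_m+S)$, so that $\bar z\in\mathcal O_\lambda$. Let $T_{\bar z}$ be the "regular" normal slice to $\mathcal O_\lambda$ at $\bar z$, embedded in $T_z=z+\operatorname{Hom}(\mathsf L_\sigma,\mathsf U_\sigma)$. Then: (a) The isomorphism $\Psi_0:T_z\cap\mathcal N_z\to\mathcal U^\sigma$ restricts to an isomorphism of the nilpotent part of $T_{\bar z}$ with a piece of the slice $\mathcal T_\sigma=L^{<0}G\cdot\mathsf L_\sigma$: $$\Psi_0^S:\ T_{\bar z}\cap\mathcal N\ \xrightarrow{\ \cong\ }\ \{L\in\mathcal T_\sigma:\ L\supseteq z^S\mathsf L_0\}.$$ (b) If $\mathcal O_\mu\subset\mathfrak{gl}(\mathcal D)$ is a nilpotent orbit with $\mathcal O_\lambda\subseteq\overline{\mathcal O_\mu}$, then $\Psi_0^S$ restricts to an isomorphism $$T_{\bar z}\cap\overline{\mathcal O_\mu}\ \xrightarrow{\ \cong\ }\ \mathcal T_\sigma\cap\overline{\mathcal G_{\mu-S}},\qquad \m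u-S=(\mu_1-S,\dots,\mu_m-S).$$
   Context: $\mathcal G=G(\mathbb C((z)))/G(\mathbb C[[z]])$ is the (reduced) loop Grassmannian of $\mathbb C[[z]]$-lattices in $U((z))$. For $\eta\in\mathbb Z^m$, $\mathsf L_\eta=\bigoplus_iz^{-\eta_i}\mathbb C[[z]]\mathbf e_i$ and $\mathcal G_\eta=G(\mathbb C[[z]])\cdot\mathsf L_\eta$. $L^{<0}G=\ker(G(\mathbb C[z^{-1}])\to G)$ (evaluation at $z=\infty$). $\mathsf U_\sigma=\bigoplus_i\mathbb C z^{-\sigma_i}\mathbf e_i$, so $\mathsf L_\sigma=\mathsf U_\sigma[[z]]$. $\mathcal U^\sigma\subset\mathcal G$ consists of the lattices $L$ with $L\oplus z^{-1}\mathsf U_\sigma[z^{-1}]=U((z))$. $\operatorname{Hom}(\mathsf L_\sigma,\mathsf U_\sigma)$ denotes continuous $\mathbb C$-linear maps (vanishing on some sublattice). $\mathcal N_z\subset\mathfrak{gl}(\mathsf L_\sigma)$ is the set of operators $A$ for which there is a sublattice $K\subset\mathsf L_\sigma$ with $A=z$ on $K$ and $A$ nilpotent on $\mathsf L_\sigma/K$. The isomorphism $\Psi_0:T_z\cap\mathcal N_z\to\mathcal U^\sigma$ is $\Psi_0(z+\varphi)=\big(1+\sum_{k\ge1}z^{-k}\varphi(z+\varphi)^{k-1}\big)\mathsf L_\sigma$. The regular slice: $\mathcal D$ has the Jordan basis $e_{k,i}$ = class of $z^{S-k}\mathbf e_i$, $1\le k\le l_i:=\sigma_i+S$, with $\bar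 ze_{k,i}=e_{k-1,i}$ ($e_{0,i}=0$). $T_{\bar z}=\bar z+C$, where $C$ is the space of $\gamma\in\operatorname{End}(\mathcal D)$ with image in the span of the vectors $e_{l_i,i}$ ($l_i\ge1$), whose matrix coefficient from $e_{k,j}$ to $e_{l_i,i}$ vanishes whenever $k>l_i$. The span of the $e_{l_i,i}$ with $l_i\geq 1$ is identified with a subspace of $\mathsf U_\sigma$ ($e_{l_i,i}\leftrightarrow z^{-\sigma_i}\mathbf e_i$), and $T_{\bar z}$ is embedded in $T_z$ by $\bar z+\gamma\mapsto z+\varphi$ with $\varphi:\mathsf L_\sigma\to\mathcal D\xrightarrow{\gamma}\mathsf U_\sigma$ (so the resulting operators agree with $z$ on $z^S\mathsf L_0$). $\mathcal O_\mu$ denotes the nilpotent orbit with Jordan block sizes $\mu$ (padded by zeros to $m$ entries), and closures are Zariski closures. *)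

theory Defs
  imports
    "HOL-Analysis.Analysis"
    "HOL-Computational_Algebra.Formal_Laurent_Series"
    "HOL-Library.Multiset"
    "HOL-Library.Set_Algebras"
begin

section \<open>Varieties as spaces with regular functions\<close>

text \<open>
  A (reduced) complex variety or ind-variety is given by its closed points, its Zariski topology
  and, for every subset, the functions on it that are regular for the reduced induced structure.
\<close>

datatype 'a fspace =
  FSpace (ztop: "'a topology") (regfun: "'a set \<Rightarrow> ('a \<Rightarrow> complex) \<Rightarrow> bool")

definition fspace_morphism ::
    "'a fspace \<Rightarrow> 'a set \<Rightarrow> 'b fspace \<Rightarrow> 'b set \<Rightarrow> ('a \<Rightarrow> 'b) \<Rightarrow> bool" where
  "fspace_morphism M X N Y \<phi> \<longleftrightarrow>
     \<phi> ` X \<subseteq> Y \<and>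
     (\<forall>V f. openin (subtopology (ztop N) Y) V \<and> regfun N V f \<longrightarrow>
        openin (subtopology (ztop M) X) {x \<in> X. \<phi> x \<in> V} \<and>
        regfun M {x \<in> X. \<phi> x \<in> V} (f \<circ> \<phi>))"

definition fspace_isomorphism ::
    "'a fspace \<Rightarrow> 'a set \<Rightarrow> 'b fspace \<Rightarrow> 'b set \<Rightarrow> ('a \<Rightarrow> 'b) \<Rightarrow> bool" where
  "fspace_isomorphism M X N Y \<phi> \<longleftrightarrow>
     bij_betw \<phi> X Y \<and> fspace_morphism M X N Y \<phi> \<and> fspace_morphism N Y M X (inv_into X \<phi>)"

text \<open>Polynomials in a given family of coordinate functions.\<close>

inductive_set polyfun :: "('a \<Rightarrow> complex) set \<Rightarrow> ('a \<Rightarrow> complex) set"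
  for C :: "('a \<Rightarrow> complex) set" where
  const: "(\<lambda>_. c) \<in> polyfun C"
| coord: "f \<in> C \<Longrightarrow> f \<in> polyfun C"
| add: "f \<in> polyfun C \<Longrightarrow> g \<in> polyfun C \<Longrightarrow> (\<lambda>x. f x + g x) \<in> polyfun C"
| mult: "f \<in> polyfun C \<Longrightarrow> g \<in> polyfun C \<Longrightarrow> (\<lambda>x. f x * g x) \<in> polyfun C"

definition zariski :: "('a \<Rightarrow> complex) set \<Rightarrow> 'a set \<Rightarrow> 'a topology" where
  "zariski C M = topology_generated_by {{x \<in> M. p x \<noteq> 0} |p. p \<in> polyfun C}"

definition regular_on :: "('a \<Rightarrow> complex) set \<Rightarrow> 'a set \<Rightarrow> ('a \<Rightarrow> complex) \<Rightarrow> bool" where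
  "regular_on C Z f \<longleftrightarrow>
     (\<forall>x\<in>Z. \<exists>p\<in>polyfun C. \<exists>q\<in>polyfun C.
        q x \<noteq> 0 \<and> (\<forall>y\<in>Z. q y \<noteq> 0 \<longrightarrow> f y = p y / q y))"

definition affine_fspace :: "('a \<Rightarrow> complex) set \<Rightarrow> 'a set \<Rightarrow> 'a fspace" where
  "affine_fspace C M = FSpace (zariski C M) (regular_on C)"


section \<open>Lattices\<close>

text \<open>
  \<open>U((z))\<close> is modelled by \<open>complex fls ^ 'm\<close>, where \<open>CARD('m)\<close> is the dimension of \<open>U\<close>;
  the variable \<open>z\<close> is \<^const>\<open>fls_X\<close>.
\<close>

type_synonym 'm lvec = "complex fls ^ 'm"

definition cmul :: "complex \<Rightarrow> ('m::finite) lvec \<Rightarrow> 'm lvec" where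
  "cmul c v = fls_const c *s v"

definition zmul :: "int \<Rightarrow> ('m::finite) lvec \<Rightarrow> 'm lvec" where
  "zmul k v = fls_X_intpow k *s v"

definition power_series :: "complex fls set" where
  "power_series = range fps_to_fls"

text \<open>A Laurent series without positive powers of \<open>z\<close> is a polynomial in \<open>z\<^sup>-\<^sup>1\<close>.\<close>

definition inv_polys :: "complex fls set" where
  "inv_polys = {f. \<forall>n>0. fls_nth f n = 0}"

definition GL_over :: "complex fls set \<Rightarrow> (complex fls ^ 'm::finite ^ 'm) set" where
  "GL_over R = {A. (\<forall>i j. A $ i $ j \<in> R) \<and>
                   (\<exists>B. (\<forall>i j. B $ i $ j \<in> R) \<and> A ** B = mat 1 \<and> B ** A = mat 1)}"

definition neg_loop_group :: "(complex fls ^ 'm::finite ^ 'm) set" where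
  "neg_loop_group =
     {A \<in> GL_over inv_polys. \<forall>i j. fls_nth (A $ i $ j) 0 = (if i = j then 1 else 0)}"

definition std_lattice :: "('m::finite \<Rightarrow> int) \<Rightarrow> 'm lvec set" where
  "std_lattice \<eta> = {v. \<forall>i. \<exists>f\<in>power_series. v $ i = fls_X_intpow (- \<eta> i) * f}"

definition z_lattice :: "int \<Rightarrow> ('m::finite) lvec set" where
  "z_lattice k = zmul k ` std_lattice (\<lambda>_. 0)"

definition loop_Gr :: "('m::finite) lvec set set" where
  "loop_Gr = {(\<lambda>v. A *v v) ` std_lattice (\<lambda>_. 0) |A. A \<in> GL_over UNIV}"

definition Gr_orbit :: "('m::finite \<Rightarrow> int) \<Rightarrow> 'm lvec set set" where
  "Gr_orbit \<eta> = {(\<lambda>v. A *v v) ` std_lattice \<eta> |A. A \<in> GL_over power_series}"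

definition slice :: "('m::finite \<Rightarrow> int) \<Rightarrow> 'm lvec set set" where
  "slice \<sigma> = {(\<lambda>v. A *v v) ` std_lattice \<sigma> |A. A \<in> neg_loop_group}"

definition U_space :: "('m::finite \<Rightarrow> int) \<Rightarrow> 'm lvec set" where
  "U_space \<sigma> = {v. \<forall>i. \<exists>c. v $ i = fls_const c * fls_X_intpow (- \<sigma> i)}"

text \<open>\<open>z\<^sup>-\<^sup>1 U\<^sub>\<sigma>[z\<^sup>-\<^sup>1]\<close>\<close>

definition U_neg :: "('m::finite \<Rightarrow> int) \<Rightarrow> 'm lvec set" where
  "U_neg \<sigma> = {v. \<forall>i. \<exists>p\<in>inv_polys. v $ i = fls_X_intpow (- \<sigma> i - 1) * p}"

definition Gr_chart :: "('m::finite \<Rightarrow> int) \<Rightarrow> 'm lvec set set" where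
  "Gr_chart \<sigma> = {L \<in> loop_Gr. L \<inter> U_neg \<sigma> = {0} \<and> L + U_neg \<sigma> = UNIV}"


section \<open>The ind-variety structure of the loop Grassmannian\<close>

text \<open>The classes of the family \<open>b\<close> form a \<open>\<complex>\<close>-basis of \<open>L / W\<close>.\<close>

definition basis_mod :: "'i set \<Rightarrow> ('i \<Rightarrow> ('m::finite) lvec) \<Rightarrow> 'm lvec set \<Rightarrow> 'm lvec set \<Rightarrow> bool" where
  "basis_mod I b W L \<longleftrightarrow>
     b ` I \<subseteq> L \<and>
     (\<forall>v\<in>L. \<exists>!c. c \<in> I \<rightarrow>\<^sub>E UNIV \<and> v - (\<Sum>i\<in>I. cmul (c i) (b i)) \<in> W)"

text \<open>
  The loop Grassmannian is the union of the projective varieties of lattices \<open>L\<close> with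
  \<open>z\<^sup>N L\<^sub>0 \<subseteq> L \<subseteq> z\<^sup>-\<^sup>N L\<^sub>0\<close>, which lie in the Grassmannians of \<open>d\<close>-dimensional subspaces
  of \<open>z\<^sup>-\<^sup>N L\<^sub>0 / z\<^sup>N L\<^sub>0\<close>. A Grassmannian carries its structure as quotient of the space of
  \<open>d\<close>-frames (an open subset of an affine space) by \<open>GL\<^sub>d\<close>. This quotient map is a
  Zariski-locally trivial bundle, so openness of subsets and regularity of functions are tested on
  frames. A subset of the ind-variety is open, and a function on a subset is regular,
  when this holds on each piece.
\<close>

definition Gr_piece :: "nat \<Rightarrow> ('m::finite) lvec set set" where
  "Gr_piece N = {L \<in> loop_Gr. z_lattice (int N) \<subseteq> L \<and> L \<subseteq> z_lattice (- int N)}"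

definition Gr_frames :: "nat \<Rightarrow> nat \<Rightarrow> (nat \<Rightarrow> ('m::finite) lvec) set" where
  "Gr_frames N d = {b. \<exists>L\<in>Gr_piece N. basis_mod {..<d} b (z_lattice (int N)) L}"

definition frame_lattice :: "nat \<Rightarrow> nat \<Rightarrow> (nat \<Rightarrow> ('m::finite) lvec) \<Rightarrow> 'm lvec set" where
  "frame_lattice N d b = {v. \<exists>c. v - (\<Sum>a<d. cmul (c a) (b a)) \<in> z_lattice (int N)}"

definition frame_coords :: "nat \<Rightarrow> nat \<Rightarrow> ((nat \<Rightarrow> ('m::finite) lvec) \<Rightarrow> complex) set" where
  "frame_coords N d =
     {(\<lambda>b. fls_nth (b a $ i) n) |a i n. a < d \<and> - int N \<le> n \<and> n < int N}"

definition frames_over :: "nat \<Rightarrow> nat \<Rightarrow> ('m::finite) lvec set set \<Rightarrow> (nat \<Rightarrow> 'm lvec) set" where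
  "frames_over N d Z = {b \<in> Gr_frames N d. frame_lattice N d b \<in> Z}"

definition Gr_open :: "('m::finite) lvec set set \<Rightarrow> bool" where
  "Gr_open V \<longleftrightarrow> V \<subseteq> loop_Gr \<and>
     (\<forall>N d. openin (zariski (frame_coords N d) (Gr_frames N d)) (frames_over N d V))"

definition loop_Gr_fspace :: "('m::finite) lvec set fspace" where
  "loop_Gr_fspace = FSpace (topology Gr_open)
     (\<lambda>Z f. \<forall>N d. regular_on (frame_coords N d) (frames_over N d Z) (f \<circ> frame_lattice N d))"

lemma topspace_zariski [simp]: "topspace (zariski C M) = M"
proof -
  have "M \<in> {{x \<in> M. p x \<noteq> 0} |p. p \<in> polyfun C}"
    by (rule CollectI, rule exI[of _ "\<lambda>_. 1"]) (simp add: polyfun.const)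
  then show ?thesis unfolding zariski_def topology_generated_by_topspace by blast
qed

lemma openin_loop_Gr: "openin (topology Gr_open) = Gr_open"
proof (rule topology_inverse')
  show "istopology Gr_open"
    unfolding istopology_def
  proof (intro conjI allI impI)
    fix V W :: "('m::finite) lvec set set"
    assume "Gr_open V" "Gr_open W"
    moreover have "frames_over N d (V \<inter> W) = frames_over N d V \<inter> frames_over N d W" for N d
      by (auto simp: frames_over_def)
    ultimately show "Gr_open (V \<inter> W)" by (auto simp: Gr_open_def)
  next
    fix \<K> :: "('m::finite) lvec set set set"
    assume "\<forall>V\<in>\<K>. Gr_open V"
    moreover have "frames_over N d (\<Union>\<K>) = (\<Union>V\<in>\<K>. frames_over N d V)" for N d
      by (auto simp: frames_over_def)
    ultimately show "Gr_open (\<Union>\<K>)" by (auto simp: Gr_open_def)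
  qed
qed


section \<open>The slice of operators on a lattice and the map to the chart\<close>

definition clinear_maps :: "('m::finite) lvec set \<Rightarrow> 'm lvec set \<Rightarrow> ('m lvec \<Rightarrow> 'm lvec) set" where
  "clinear_maps L M = {A \<in> L \<rightarrow>\<^sub>E M.
     (\<forall>v\<in>L. \<forall>w\<in>L. A (v + w) = A v + A w) \<and> (\<forall>c. \<forall>v\<in>L. A (cmul c v) = cmul c (A v))}"

definition Hom_LU :: "('m::finite \<Rightarrow> int) \<Rightarrow> ('m lvec \<Rightarrow> 'm lvec) set" where
  "Hom_LU \<sigma> = {\<phi> \<in> clinear_maps (std_lattice \<sigma>) (U_space \<sigma>).
     \<exists>K\<in>loop_Gr. K \<subseteq> std_lattice \<sigma> \<and> (\<forall>v\<in>K. \<phi> v = 0)}"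

definition z_plus :: "('m::finite \<Rightarrow> int) \<Rightarrow> ('m lvec \<Rightarrow> 'm lvec) \<Rightarrow> ('m lvec \<Rightarrow> 'm lvec)" where
  "z_plus \<sigma> \<phi> = (\<lambda>v\<in>std_lattice \<sigma>. zmul 1 v + \<phi> v)"

definition T_z :: "('m::finite \<Rightarrow> int) \<Rightarrow> ('m lvec \<Rightarrow> 'm lvec) set" where
  "T_z \<sigma> = z_plus \<sigma> ` Hom_LU \<sigma>"

definition N_z :: "('m::finite \<Rightarrow> int) \<Rightarrow> ('m lvec \<Rightarrow> 'm lvec) set" where
  "N_z \<sigma> = {A \<in> clinear_maps (std_lattice \<sigma>) (std_lattice \<sigma>).
     \<exists>K\<in>loop_Gr. K \<subseteq> std_lattice \<sigma> \<and> (\<forall>v\<in>K. A v = zmul 1 v) \<and>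
       (\<exists>n. \<forall>v\<in>std_lattice \<sigma>. (A ^^ n) v \<in> K)}"

text \<open>
  \<open>\<Psi>\<^sub>0(z + \<phi>) = (1 + \<Sum>\<^sub>k\<^sub>\<ge>\<^sub>1 z\<^sup>-\<^sup>k \<phi> (z + \<phi>)\<^sup>k\<^sup>-\<^sup>1) L\<^sub>\<sigma>\<close>. For an operator in \<open>T\<^sub>z \<inter> N\<^sub>z\<close> only finitely many
  terms of the series are nonzero on any given vector.
\<close>

definition Psi0 :: "('m::finite \<Rightarrow> int) \<Rightarrow> ('m lvec \<Rightarrow> 'm lvec) \<Rightarrow> 'm lvec set" where
  "Psi0 \<sigma> A = (let \<phi> = (\<lambda>v. A v - zmul 1 v) in
     (\<lambda>v. v + (\<Sum>k | 1 \<le> k \<and> \<phi> ((A ^^ (k - 1)) v) \<noteq> 0. zmul (- int k) (\<phi> ((A ^^ (k - 1)) v))))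
       ` std_lattice \<sigma>)"


section \<open>Operators on the finite-dimensional quotient\<close>

text \<open>
  \<open>\<D> = L\<^sub>\<sigma> / z\<^sup>S L\<^sub>0\<close> as a set of cosets. Sums of cosets are the pointwise sums of sets; the scalar
  multiple has to be defined separately because \<open>0\<close> would otherwise give \<open>{0}\<close>.
\<close>

definition cls :: "int \<Rightarrow> ('m::finite) lvec \<Rightarrow> 'm lvec set" where
  "cls S v = {v} + z_lattice S"

definition D_space :: "('m::finite \<Rightarrow> int) \<Rightarrow> int \<Rightarrow> 'm lvec set set" where
  "D_space \<sigma> S = cls S ` std_lattice \<sigma>"

definition D_scale :: "int \<Rightarrow> complex \<Rightarrow> ('m::finite) lvec set \<Rightarrow> 'm lvec set" where
  "D_scale S c X = cmul c ` X + z_lattice S"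

definition End_D :: "('m::finite \<Rightarrow> int) \<Rightarrow> int \<Rightarrow> ('m lvec set \<Rightarrow> 'm lvec set) set" where
  "End_D \<sigma> S = {A \<in> D_space \<sigma> S \<rightarrow>\<^sub>E D_space \<sigma> S.
     (\<forall>X\<in>D_space \<sigma> S. \<forall>Y\<in>D_space \<sigma> S. A (X + Y) = A X + A Y) \<and>
     (\<forall>c. \<forall>X\<in>D_space \<sigma> S. A (D_scale S c X) = D_scale S c (A X))}"

definition z_bar :: "('m::finite \<Rightarrow> int) \<Rightarrow> int \<Rightarrow> 'm lvec set \<Rightarrow> 'm lvec set" where
  "z_bar \<sigma> S = (\<lambda>X\<in>D_space \<sigma> S. zmul 1 ` X + z_lattice S)"

definition block :: "('m::finite \<Rightarrow> int) \<Rightarrow> int \<Rightarrow> 'm \<Rightarrow> nat" where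
  "block \<sigma> S i = nat (\<sigma> i + S)"

definition e_D :: "int \<Rightarrow> nat \<Rightarrow> 'm::finite \<Rightarrow> 'm lvec set" where
  "e_D S k i = cls S (axis i (fls_X_intpow (S - int k)))"

text \<open>The coefficient of the basis vector \<open>e\<^sub>k\<^sub>,\<^sub>i\<close> (with \<open>k \<ge> 1\<close>) does not depend on the representative.\<close>

definition D_coeff :: "int \<Rightarrow> nat \<Rightarrow> 'm::finite \<Rightarrow> 'm lvec set \<Rightarrow> complex" where
  "D_coeff S k i X = fls_nth ((SOME v. v \<in> X) $ i) (S - int k)"

definition End_coords :: "('m::finite \<Rightarrow> int) \<Rightarrow> int \<Rightarrow> (('m lvec set \<Rightarrow> 'm lvec set) \<Rightarrow> complex) set" where
  "End_coords \<sigma> S = {(\<lambda>A. D_coeff S r i (A (e_D S k j))) |r i k j.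
     1 \<le> r \<and> r \<le> block \<sigma> S i \<and> 1 \<le> k \<and> k \<le> block \<sigma> S j}"

definition End_D_fspace :: "('m::finite \<Rightarrow> int) \<Rightarrow> int \<Rightarrow> ('m lvec set \<Rightarrow> 'm lvec set) fspace" where
  "End_D_fspace \<sigma> S = affine_fspace (End_coords \<sigma> S) (End_D \<sigma> S)"

definition nilp_cone :: "('m::finite \<Rightarrow> int) \<Rightarrow> int \<Rightarrow> ('m lvec set \<Rightarrow> 'm lvec set) set" where
  "nilp_cone \<sigma> S = {A \<in> End_D \<sigma> S. \<exists>n. \<forall>X\<in>D_space \<sigma> S. (A ^^ n) X = cls S 0}"

text \<open>Operators on \<open>\<D>\<close> with a Jordan basis of block sizes \<open>\<mu>\<close>; zero entries of \<open>\<mu>\<close> have no effect.\<close>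

definition nilp_orbit ::
    "('m::finite \<Rightarrow> int) \<Rightarrow> int \<Rightarrow> nat list \<Rightarrow> ('m lvec set \<Rightarrow> 'm lvec set) set" where
  "nilp_orbit \<sigma> S \<mu> = {A \<in> End_D \<sigma> S. \<exists>b :: nat \<times> nat \<Rightarrow> 'm lvec.
     basis_mod {(k, i). i < length \<mu> \<and> 1 \<le> k \<and> k \<le> \<mu> ! i} b (z_lattice S) (std_lattice \<sigma>) \<and>
     (\<forall>i<length \<mu>. \<forall>k. 1 \<le> k \<and> k \<le> \<mu> ! i \<longrightarrow>
        A (cls S (b (k, i))) = (if k = 1 then cls S 0 else cls S (b (k - 1, i))))}"

definition is_partition :: "nat list \<Rightarrow> bool" where
  "is_partition \<mu> \<longleftrightarrow> sorted_wrt (\<ge>) \<mu> \<and> 0 \<notin> set \<mu>"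

definition pad :: "nat \<Rightarrow> nat list \<Rightarrow> nat list" where
  "pad m \<mu> = \<mu> @ replicate (m - length \<mu>) 0"

text \<open>\<open>\<lambda>\<close>: the numbers \<open>\<sigma>\<^sub>i + S\<close> in non-increasing order.\<close>

definition lambda_partition :: "('m::finite \<Rightarrow> int) \<Rightarrow> int \<Rightarrow> nat list" where
  "lambda_partition \<sigma> S =
     rev (sorted_list_of_multiset (image_mset (block \<sigma> S) (mset_set UNIV)))"

text \<open>The span of the \<open>e\<^sub>l\<^sub>i\<^sub>,\<^sub>i\<close> with \<open>l\<^sub>i \<ge> 1\<close>, as a subspace of \<open>U\<^sub>\<sigma>\<close>.\<close>

definition U_top :: "('m::finite \<Rightarrow> int) \<Rightarrow> int \<Rightarrow> 'm lvec set" where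
  "U_top \<sigma> S = {u \<in> U_space \<sigma>. \<forall>i. block \<sigma> S i = 0 \<longrightarrow> u $ i = 0}"

definition slice_directions :: "('m::finite \<Rightarrow> int) \<Rightarrow> int \<Rightarrow> ('m lvec set \<Rightarrow> 'm lvec set) set" where
  "slice_directions \<sigma> S = {\<gamma> \<in> End_D \<sigma> S.
     \<gamma> ` D_space \<sigma> S \<subseteq> cls S ` U_top \<sigma> S \<and>
     (\<forall>i j k. 1 \<le> block \<sigma> S i \<and> 1 \<le> k \<and> k \<le> block \<sigma> S j \<and> k > block \<sigma> S i \<longrightarrow>
        D_coeff S (block \<sigma> S i) i (\<gamma> (e_D S k j)) = 0)}"

definition T_zbar :: "('m::finite \<Rightarrow> int) \<Rightarrow> int \<Rightarrow> ('m lvec set \<Rightarrow> 'm lvec set) set" where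
  "T_zbar \<sigma> S =
     (\<lambda>\<gamma>. \<lambda>X\<in>D_space \<sigma> S. z_bar \<sigma> S X + \<gamma> X) ` slice_directions \<sigma> S"

text \<open>
  The embedding \<open>\<bar>z + \<gamma> \<mapsto> z + \<phi>\<close> of \<open>T\<^sub>z\<^sub>b\<^sub>a\<^sub>r\<close> in \<open>T\<^sub>z\<close>: \<open>\<phi> v\<close> is the vector of \<^term>\<open>U_top \<sigma> S\<close>
  representing \<open>\<gamma> [v]\<close>, and \<open>\<gamma>\<close> is recovered from \<open>A = \<bar>z + \<gamma>\<close> as \<open>A + (-1) \<bar>z\<close>.
\<close>

definition slice_embed ::
    "('m::finite \<Rightarrow> int) \<Rightarrow> int \<Rightarrow> ('m lvec set \<Rightarrow> 'm lvec set) \<Rightarrow> ('m lvec \<Rightarrow> 'm lvec)" where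
  "slice_embed \<sigma> S A =
     (let \<gamma> = (\<lambda>X. A X + D_scale S (- 1) (z_bar \<sigma> S X))
      in z_plus \<sigma> (\<lambda>v. THE u. u \<in> U_top \<sigma> S \<and> cls S u = \<gamma> (cls S v)))"

definition Psi0_S ::
    "('m::finite \<Rightarrow> int) \<Rightarrow> int \<Rightarrow> ('m lvec set \<Rightarrow> 'm lvec set) \<Rightarrow> 'm lvec set" where
  "Psi0_S \<sigma> S A = Psi0 \<sigma> (slice_embed \<sigma> S A)"

end

theory Submission
  imports Defs "Jordan_Normal_Form.Determinant"
begin

text \<open>
  Telescoping identifies \<open>\<Psi>\<^sub>0(A)\<close> with \<open>g L\<^sub>\<sigma>\<close> for \<open>g = z\<^sup>-\<^sup>p A\<^sup>p\<close> and large \<open>p\<close>; this \<open>g\<close> satisfies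
  \<open>g A = z g\<close> and \<open>g v - v \<in> z\<^sup>-\<^sup>1 U\<^sub>\<sigma>[z\<^sup>-\<^sup>1]\<close>, so \<open>A\<close> is recovered from the lattice \<open>L\<close> as \<open>h\<^sup>-\<^sup>1 z h\<close>, where
  \<open>h\<close> is the inverse of the projection \<open>L \<rightarrow> L\<^sub>\<sigma>\<close> along \<open>z\<^sup>-\<^sup>1 U\<^sub>\<sigma>[z\<^sup>-\<^sup>1]\<close>. The vanishing conditions of the regular
  slice say that \<open>A - z\<close> does not raise the total degree. Then \<open>g\<close> preserves leading terms, and this
  characterises the lattices in the orbit of \<open>L\<^sup>-G = ker (G(\<complex>[z\<^sup>-\<^sup>1]) \<rightarrow> G)\<close>. By Cramer's rule, \<open>h\<close> is
  locally a rational function of a frame of \<open>L\<close>.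

  The orbit closures are compared without knowing the closure order. If \<open>L\<close> lies in the closure of an
  orbit \<open>\<G>\<^sub>\<eta>\<close>, nearby lattices of \<open>\<G>\<^sub>\<eta>\<close> lie in the chart, where \<open>L \<mapsto> h\<^sup>-\<^sup>1 z h\<close> is regular and
  takes values in the nilpotent orbit. Conversely, a nilpotent operator \<open>A\<close> near the slice, in the slice or not,
  yields the lattice of all \<open>\<Sum>\<^sub>n z\<^sup>S\<^sup>-\<^sup>1\<^sup>-\<^sup>n \<tau>(A\<^sup>n v)\<close> modulo \<open>z\<^sup>S U[[z]]\<close>, where \<open>\<tau>\<close> takes the coefficient of \<open>z\<^sup>S\<^sup>-\<^sup>1\<close>.
  It depends polynomially on \<open>A\<close>, has the Jordan type of \<open>A\<close> and is \<open>\<Psi>\<^sub>0(A)\<close> on the slice.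
\<close>

text \<open>The formula with \<open>\<tau>\<close> is read off from \<open>g\<close>. A correction
  term of \<open>g v\<close> is \<open>z^(-k) \<phi>(..)\<close> with \<open>k \<ge> 1\<close>, and
  \<open>\<phi>\<close> takes values at exponents \<open>- \<sigma> i < S\<close>; so
  \<open>g\<close> leaves the coefficient at \<open>S - 1\<close> alone. With
  \<open>g A^n = z^n g\<close> this gives every lower coefficient: the one of \<open>g v\<close> at
  \<open>S - 1 - n\<close> is that of \<open>A^n v\<close> at \<open>S - 1\<close>. Neither
  \<open>\<phi>\<close> nor \<open>g\<close> is left in this description, so it makes sense for
  operators outside the slice. Such an extension is the price of comparing closures directly. A
  point of the slice in an orbit closure is approximated by operators of the orbit, which need not
  lie in the slice; likewise the lattices of \<open>\<G>_\<eta>\<close> near a slice lattice lie in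
  the chart, but not always in the slice. Both maps are therefore studied on larger domains than the
  bijection uses. One exponent of nilpotency has to serve all nilpotent operators, since otherwise
  the sums would not be polynomial in \<open>A\<close>. It comes from the dimension of
  \<open>\<D>\<close>.\<close>

no_notation Matrix.vec_index (infixl "$" 100)
no_notation fps_nth (infixl "$" 75)

section \<open>Coefficients of Laurent vectors\<close>

lemmas lvec_eq_iff = Finite_Cartesian_Product.vec_eq_iff

lemma fls_shift_1_mult: "fls_shift k 1 * f = fls_shift k f" for f :: "complex fls"
  by (simp add: fls_shifted_times_simps)

definition coef :: "('m::finite) lvec \<Rightarrow> 'm \<Rightarrow> int \<Rightarrow> complex" where
  "coef v i n = fls_nth (v $ i) n"

lemma lvec_eqI: "(\<And>i n. coef v i n = coef w i n) \<Longrightarrow> v = w"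
proof -
  assume *: "\<And>i n. coef v i n = coef w i n"
  have "v $ i = w $ i" for i using * by (intro fls_eqI) (simp add: coef_def)
  then show ?thesis by (simp add: lvec_eq_iff)
qed

lemma fls_const_nth_mult: "fls_nth (fls_const c * f) n = c * fls_nth f n"
  for f :: "complex fls"
proof -
  have "fls_nth (fls_const c * f) n
      = (\<Sum>i=fls_subdegree f..n. if i = fls_subdegree f then c * fls_nth f n else 0)"
    unfolding fls_times_nth(1) by (rule sum.cong) auto
  then show ?thesis by simp
qed

lemma coef_add [simp]: "coef (v + w) i n = coef v i n + coef w i n"
  and coef_diff [simp]: "coef (v - w) i n = coef v i n - coef w i n"
  and coef_minus [simp]: "coef (- v) i n = - coef v i n"
  and coef_zero [simp]: "coef 0 i n = 0"
  and coef_sum [simp]: "coef (sum f A) i n = (\<Sum>a\<in>A. coef (f a) i n)"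
  and coef_cmul [simp]: "coef (cmul c v) i n = c * coef v i n"
  and coef_zmul [simp]: "coef (zmul k v) i n = coef v i (n - k)"
  by (simp_all add: coef_def cmul_def zmul_def fls_nth_sum fls_const_nth_mult fls_shift_1_mult)

text \<open>Scalars here are complex numbers: independence and dimension counts concern this
  structure, whereas matrices act linearly over Laurent series.\<close>

global_interpretation cv: vector_space "cmul :: complex \<Rightarrow> ('m::finite) lvec \<Rightarrow> 'm lvec"
  by unfold_locales (rule lvec_eqI; simp add: algebra_simps)+

lemma zmul_zmul [simp]: "zmul a (zmul b v) = zmul (a + b) v"
  by (rule lvec_eqI) (simp add: algebra_simps)

lemma zmul_0 [simp]: "zmul 0 v = v"
  by (rule lvec_eqI) simp

lemma zmul_add: "zmul a (v + w) = zmul a v + zmul a w"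
  and zmul_diff: "zmul a (v - w) = zmul a v - zmul a w"
  and zmul_cmul: "zmul a (cmul c v) = cmul c (zmul a v)"
  and zmul_zero [simp]: "zmul a 0 = 0"
  by (rule lvec_eqI, simp)+

lemma power_series_iff: "f \<in> power_series \<longleftrightarrow> (\<forall>n<0. fls_nth f n = 0)"
proof
  assume "\<forall>n<0. fls_nth f n = 0"
  then have "f = fps_to_fls (Abs_fps (\<lambda>n. fls_nth f (int n)))"
    by (intro fls_eqI) (auto simp: fps_to_fls_nth)
  then show "f \<in> power_series" unfolding power_series_def by blast
qed (auto simp: power_series_def)

lemma std_lattice_iff: "v \<in> std_lattice \<eta> \<longleftrightarrow> (\<forall>i n. n < - \<eta> i \<longrightarrow> coef v i n = 0)"
proof
  assume v: "v \<in> std_lattice \<eta>"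
  show "\<forall>i n. n < - \<eta> i \<longrightarrow> coef v i n = 0"
  proof (intro allI impI)
    fix i n
    assume n: "n < - \<eta> i"
    obtain f where "f \<in> power_series" "v $ i = fls_X_intpow (- \<eta> i) * f"
      using v by (auto simp: std_lattice_def)
    with n show "coef v i n = 0"
      by (simp add: power_series_iff coef_def fls_shift_1_mult)
  qed
next
  assume *: "\<forall>i n. n < - \<eta> i \<longrightarrow> coef v i n = 0"
  show "v \<in> std_lattice \<eta>"
    unfolding std_lattice_def
  proof (intro CollectI allI bexI)
    fix i
    show "v $ i = fls_X_intpow (- \<eta> i) * fls_shift (- \<eta> i) (v $ i)"
      by (simp add: fls_shifted_times_simps)
    show "fls_shift (- \<eta> i) (v $ i) \<in> power_series"
      using * by (simp add: power_series_iff coef_def)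
  qed
qed

lemma z_lattice_iff: "v \<in> z_lattice k \<longleftrightarrow> (\<forall>i n. n < k \<longrightarrow> coef v i n = 0)"
proof
  assume "v \<in> z_lattice k"
  then show "\<forall>i n. n < k \<longrightarrow> coef v i n = 0"
    by (auto simp: z_lattice_def std_lattice_iff)
next
  assume *: "\<forall>i n. n < k \<longrightarrow> coef v i n = 0"
  have "v = zmul k (zmul (- k) v)" by simp
  moreover have "zmul (- k) v \<in> std_lattice (\<lambda>_. 0)"
    using * by (simp add: std_lattice_iff)
  ultimately show "v \<in> z_lattice k" unfolding z_lattice_def by blast
qed

lemma U_space_iff: "v \<in> U_space \<sigma> \<longleftrightarrow> (\<forall>i n. n \<noteq> - \<sigma> i \<longrightarrow> coef v i n = 0)"
proof
  assume "\<forall>i n. n \<noteq> - \<sigma> i \<longrightarrow> coef v i n = 0"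
  then have "fls_nth (v $ i) n = fls_nth (fls_const (coef v i (- \<sigma> i)) * fls_X_intpow (- \<sigma> i)) n"
    for i n
    by (cases "n = - \<sigma> i") (simp_all add: coef_def fls_const_nth_mult add_eq_0_iff2)
  then have "v $ i = fls_const (coef v i (- \<sigma> i)) * fls_X_intpow (- \<sigma> i)" for i
    by (intro fls_eqI)
  then show "v \<in> U_space \<sigma>" unfolding U_space_def by blast
next
  assume v: "v \<in> U_space \<sigma>"
  show "\<forall>i n. n \<noteq> - \<sigma> i \<longrightarrow> coef v i n = 0"
  proof (intro allI impI)
    fix i n
    assume n: "n \<noteq> - \<sigma> i"
    obtain c where "v $ i = fls_const c * fls_X_intpow (- \<sigma> i)"
      using v unfolding U_space_def by blast
    with n show "coef v i n = 0"
      by (simp add: coef_def fls_const_nth_mult)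
  qed
qed

lemma U_neg_iff: "v \<in> U_neg \<sigma> \<longleftrightarrow> (\<forall>i n. - \<sigma> i \<le> n \<longrightarrow> coef v i n = 0)"
proof
  assume v: "v \<in> U_neg \<sigma>"
  show "\<forall>i n. - \<sigma> i \<le> n \<longrightarrow> coef v i n = 0"
  proof (intro allI impI)
    fix i n
    assume n: "- \<sigma> i \<le> n"
    obtain f where "f \<in> inv_polys" "v $ i = fls_X_intpow (- \<sigma> i - 1) * f"
      using v by (auto simp: U_neg_def)
    with n show "coef v i n = 0"
      by (simp add: inv_polys_def coef_def fls_shift_1_mult)
  qed
next
  assume *: "\<forall>i n. - \<sigma> i \<le> n \<longrightarrow> coef v i n = 0"
  show "v \<in> U_neg \<sigma>"
    unfolding U_neg_def
  proof (intro CollectI allI bexI)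
    fix i
    show "v $ i = fls_X_intpow (- \<sigma> i - 1) * fls_shift (- \<sigma> i - 1) (v $ i)"
      by (simp add: fls_shifted_times_simps)
    show "fls_shift (- \<sigma> i - 1) (v $ i) \<in> inv_polys"
      using * by (simp add: inv_polys_def coef_def)
  qed
qed

lemma lvec_lower_bound: "\<exists>N. \<forall>i n. n < N \<longrightarrow> coef v i n = 0"
proof -
  define N where "N = Min (range (\<lambda>i. fls_subdegree (v $ i)))"
  have "coef v i n = 0" if "n < N" for i n
  proof -
    have "N \<le> fls_subdegree (v $ i)" unfolding N_def by (intro Min_le) auto
    then show ?thesis using that by (simp add: coef_def)
  qed
  then show ?thesis by blast
qed

text \<open>Deleting any set of monomials from a Laurent vector leaves a Laurent vector. One
  operator thus serves for truncation below \<open>z^S\<close>, for the projection onto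
  \<open>L_\<sigma>\<close> and for the part of a single degree.\<close>

definition filt :: "(('m::finite) \<Rightarrow> int \<Rightarrow> bool) \<Rightarrow> 'm lvec \<Rightarrow> 'm lvec" where
  "filt Q v = (\<chi> i. Abs_fls (\<lambda>n. if Q i n then coef v i n else 0))"

lemma coef_filt [simp]: "coef (filt Q v) i n = (if Q i n then coef v i n else 0)"
proof -
  obtain N where "\<forall>i n. n < N \<longrightarrow> coef v i n = 0" using lvec_lower_bound by blast
  then have "\<forall>n<N. (if Q i n then coef v i n else 0) = 0" by auto
  from nth_Abs_fls_lower_bound[OF this] show ?thesis
    by (simp add: filt_def coef_def)
qed

lemma filt_add: "filt Q (v + w) = filt Q v + filt Q w"
  and filt_cmul: "filt Q (cmul c v) = cmul c (filt Q v)"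
  and filt_zero [simp]: "filt Q 0 = 0"
  by (rule lvec_eqI, simp)+

definition mon :: "'m::finite \<Rightarrow> int \<Rightarrow> 'm lvec" where
  "mon i n = axis i (fls_X_intpow n)"

lemma coef_mon: "coef (mon i n) j k = (if j = i \<and> k = n then 1 else 0)"
  by (auto simp: coef_def mon_def axis_def)

lemma zmul_mon [simp]: "zmul k (mon i n) = mon i (n + k)"
  by (rule lvec_eqI) (auto simp: coef_mon)

lemma finite_expansion:
  assumes "finite F" "\<And>i n. coef v i n \<noteq> 0 \<Longrightarrow> (i, n) \<in> F"
  shows "v = (\<Sum>(i, n)\<in>F. cmul (coef v i n) (mon i n))"
proof (rule lvec_eqI)
  fix j k
  have "coef (\<Sum>(i, n)\<in>F. cmul (coef v i n) (mon i n)) j k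
      = (\<Sum>p\<in>F. if p = (j, k) then coef v j k else 0)"
    by (auto simp: case_prod_unfold coef_mon intro!: sum.cong)
  then show "coef v j k = coef (\<Sum>(i, n)\<in>F. cmul (coef v i n) (mon i n)) j k"
    using assms by auto
qed

text \<open>A lattice is used through these closure properties; that it is free over power series is
  only ever known from an explicit basis.\<close>

definition zsub :: "('m::finite) lvec set \<Rightarrow> bool" where
  "zsub L \<longleftrightarrow> cv.subspace L \<and> (\<forall>v\<in>L. zmul 1 v \<in> L)"

lemma subspace_z_lattice [simp]: "cv.subspace (z_lattice k)"
  and subspace_std_lattice [simp]: "cv.subspace (std_lattice \<eta>)"
  and subspace_U_neg [simp]: "cv.subspace (U_neg \<sigma>)"
  by (auto simp: cv.subspace_def z_lattice_iff std_lattice_iff U_neg_iff)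

lemma zmul_in_z_lattice: "v \<in> z_lattice k \<Longrightarrow> l \<le> k + a \<Longrightarrow> zmul a v \<in> z_lattice l"
  by (simp add: z_lattice_iff)

lemma zsub_std_lattice [simp]: "zsub (std_lattice \<eta>)"
  by (simp add: zsub_def) (simp add: std_lattice_iff)

lemma zsub_zmul_nat: "zsub L \<Longrightarrow> v \<in> L \<Longrightarrow> zmul (int n) v \<in> L"
proof (induction n)
  case (Suc n)
  then have "zmul 1 (zmul (int n) v) \<in> L" unfolding zsub_def by blast
  then show ?case by (simp add: add.commute)
qed simp

lemma z_lattice_mono: "k \<le> l \<Longrightarrow> z_lattice l \<subseteq> z_lattice k"
  by (auto simp: z_lattice_iff)

section \<open>Power series as scalars\<close>

lemma power_series_mult: "f \<in> power_series \<Longrightarrow> g \<in> power_series \<Longrightarrow> f * g \<in> power_series"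
  unfolding power_series_def by (metis (no_types, lifting) fls_times_fps_to_fls image_iff range_eqI)

lemma power_series_minus: "f \<in> power_series \<Longrightarrow> - f \<in> power_series"
  and power_series_const [simp]: "fls_const c \<in> power_series"
  and power_series_0 [simp]: "0 \<in> power_series"
  and power_series_1 [simp]: "1 \<in> power_series"
  by (auto simp: power_series_iff)

lemma power_series_sum: "(\<And>a. a \<in> A \<Longrightarrow> f a \<in> power_series) \<Longrightarrow> sum f A \<in> power_series"
  by (simp add: power_series_iff fls_nth_sum)

lemma power_series_smult_z_lattice:
  assumes "f \<in> power_series" "v \<in> z_lattice k"
  shows "f *s v \<in> z_lattice k"
proof -
  have "zmul (- k) v \<in> std_lattice (\<lambda>_. 0)"
    using assms(2) by (simp add: std_lattice_iff z_lattice_iff)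
  then have ps: "zmul (- k) v $ i \<in> power_series" for i
    by (simp add: std_lattice_iff power_series_iff coef_def)
  have "f *s v = zmul k (f *s zmul (- k) v)"
    by (simp add: lvec_eq_iff zmul_def fls_shifted_times_simps)
  moreover have "f *s zmul (- k) v \<in> std_lattice (\<lambda>_. 0)"
    using power_series_mult[OF assms(1) ps] by (simp add: std_lattice_iff power_series_iff coef_def)
  ultimately show ?thesis unfolding z_lattice_def by blast
qed

text \<open>Stability under \<open>z\<close> directly gives polynomial multiples only. So many
  initial terms of \<open>f\<close> are split off that the rest of \<open>f *s v\<close> lies in
  \<open>z_lattice N\<close>.\<close>

lemma zsub_power_series_smult:
  assumes L: "zsub L" and N: "z_lattice N \<subseteq> L" and f: "f \<in> power_series" and v: "v \<in> L"
  shows "f *s v \<in> L"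
proof -
  have sub: "cv.subspace L" using L by (simp add: zsub_def)
  have step: "\<exists>w\<in>L. \<exists>h\<in>power_series. f *s v = w + zmul (int M) (h *s v)" for M
  proof (induction M)
    case 0
    show ?case using f cv.subspace_0[OF sub] by (intro bexI[of _ 0] bexI[of _ f]) auto
  next
    case (Suc M)
    then obtain w h where w: "w \<in> L" and h: "h \<in> power_series"
      and eq: "f *s v = w + zmul (int M) (h *s v)" by blast
    \<comment> \<open>\<open>h'\<close> is \<open>(h - h(0)) / z\<close>: one more constant term
      moves into \<open>w\<close>.\<close>
    define h' where "h' = fls_shift 1 (h - fls_const (fls_nth h 0))"
    have hh: "h = fls_const (fls_nth h 0) + fls_X_intpow 1 * h'"
      by (simp add: h'_def fls_shifted_times_simps)
    have "h *s v = (fls_const (fls_nth h 0) + fls_X_intpow 1 * h') *s v"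
      using hh by simp
    also have "\<dots> = cmul (fls_nth h 0) v + zmul 1 (h' *s v)"
      by (simp add: cmul_def zmul_def lvec_eq_iff algebra_simps)
    finally have "f *s v = (w + cmul (fls_nth h 0) (zmul (int M) v)) + zmul (int (Suc M)) (h' *s v)"
      unfolding eq by (simp add: zmul_add zmul_cmul algebra_simps)
    moreover have "w + cmul (fls_nth h 0) (zmul (int M) v) \<in> L"
      using w zsub_zmul_nat[OF L v] sub by (simp add: cv.subspace_def)
    moreover have "h' \<in> power_series"
      using h by (auto simp: h'_def power_series_iff)
    ultimately show ?case by blast
  qed
  obtain k where "v \<in> z_lattice k" using lvec_lower_bound[of v] by (auto simp: z_lattice_iff)
  \<comment> \<open>For \<open>v\<close> in \<open>z_lattice k\<close>, a factor
    \<open>z^(N-k)\<close> suffices; \<open>nat\<close> covers \<open>k > N\<close>.\<close>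
  obtain w h where w: "w \<in> L" "h \<in> power_series" "f *s v = w + zmul (int (nat (N - k))) (h *s v)"
    using step by blast
  have "zmul (int (nat (N - k))) (h *s v) \<in> z_lattice N"
    using power_series_smult_z_lattice[OF w(2) \<open>v \<in> z_lattice k\<close>]
    by (rule zmul_in_z_lattice) auto
  then show ?thesis using w N sub by (auto intro: cv.subspace_add)
qed

section \<open>Matrices over Laurent series\<close>

lemma matrix_vector_mul_add: "A *v (v + w) = A *v v + A *v w"
  for A :: "complex fls ^ 'm::finite ^ 'm"
  by (simp add: matrix_vector_right_distrib)

lemma matrix_vector_mul_cmul: "A *v cmul c v = cmul c (A *v v)"
  and matrix_vector_mul_zmul: "A *v zmul k v = zmul k (A *v v)"
  for A :: "complex fls ^ 'm::finite ^ 'm"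
  by (simp_all add: cmul_def zmul_def vector_scalar_commute)

lemma matrix_vector_sum_columns:
  "A *v v = (\<Sum>j\<in>UNIV. v $ j *s (A *v axis j 1))"
  for A :: "complex fls ^ 'm::finite ^ 'm"
  by (simp only: lvec_eq_iff sum_component vector_smult_component)
     (simp add: matrix_vector_mult_def axis_def if_distrib mult.commute cong: if_cong)

section \<open>The slice inside the chart\<close>

definition deg_le :: "int \<Rightarrow> ('m::finite) lvec \<Rightarrow> bool" where
  "deg_le d v \<longleftrightarrow> (\<forall>i n. d < n \<longrightarrow> coef v i n = 0)"

lemma deg_le_add: "deg_le d v \<Longrightarrow> deg_le d w \<Longrightarrow> deg_le d (v + w)"
  and deg_le_diff: "deg_le d v \<Longrightarrow> deg_le d w \<Longrightarrow> deg_le d (v - w)"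
  and deg_le_mono: "deg_le d v \<Longrightarrow> d \<le> d' \<Longrightarrow> deg_le d' v"
  and deg_le_mon [simp]: "deg_le n (mon i n)"
  by (auto simp: deg_le_def coef_mon)

lemma deg_le_decrease: "deg_le d v \<Longrightarrow> (\<And>i. coef v i d = 0) \<Longrightarrow> deg_le (d - 1) v"
  by (metis deg_le_def int_le_real_less linorder_neqE_linordered_idom zle_diff1_eq verit_comp_simplify1(3))

lemma leading_degree:
  assumes "deg_le d v" "v \<noteq> 0"
  obtains e i where "deg_le e v" "coef v i e \<noteq> 0" "e \<le> d"
proof -
  define D where "D = {n. \<exists>i. coef v i n \<noteq> 0}"
  obtain N where N: "\<forall>i n. n < N \<longrightarrow> coef v i n = 0" using lvec_lower_bound by blast
  have sub: "D \<subseteq> {N..d}"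
    unfolding D_def using N assms(1) unfolding deg_le_def by force
  then have fin: "finite D" by (rule finite_subset) simp
  have "D \<noteq> {}" using assms(2) by (auto simp: D_def intro: lvec_eqI)
  with fin have "Max D \<in> D" by simp
  moreover have "deg_le (Max D) v"
    unfolding deg_le_def
  proof (intro allI impI)
    fix i n assume "Max D < n"
    then have "n \<notin> D" using Max_ge[OF fin] by force
    then show "coef v i n = 0" by (simp add: D_def)
  qed
  ultimately show ?thesis using that sub by (auto simp: D_def)
qed

text \<open>Multiplication by a polynomial in \<open>1/z\<close> raises no exponent, so only its
  constant term reaches the top degree.\<close>

lemma inv_polys_times_nth:
  assumes f: "f \<in> inv_polys" and g: "\<And>n. d < n \<Longrightarrow> fls_nth g n = 0" and n: "d \<le> n"
  shows "fls_nth (f * g) n = (if n = d then fls_nth f 0 * fls_nth g d else 0)"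
proof -
  let ?I = "{fls_subdegree f..n - fls_subdegree g}"
  have "fls_nth (f * g) n = (\<Sum>i\<in>?I. if i = 0 then fls_nth f 0 * fls_nth g n else 0)"
    unfolding fls_times_nth(2)
  proof (rule sum.cong)
    fix i
    show "fls_nth f i * fls_nth g (n - i) = (if i = 0 then fls_nth f 0 * fls_nth g n else 0)"
    proof (cases "i > 0")
      case True
      then show ?thesis using f by (simp add: inv_polys_def)
    next
      case False
      then show ?thesis using g[of "n - i"] n by (cases "i = 0") auto
    qed
  qed simp
  also have "\<dots> = (if 0 \<in> ?I then fls_nth f 0 * fls_nth g n else 0)" by simp
  also have "\<dots> = fls_nth f 0 * fls_nth g n" by auto
  also have "\<dots> = (if n = d then fls_nth f 0 * fls_nth g d else 0)" using g n by auto
  finally show ?thesis .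
qed

text \<open>The condition of \<open>neg_loop_group\<close> without the inverse. It already forces
  preservation of leading terms, and the matrix built from \<open>psi\<close> has it before its
  invertibility is known.\<close>

definition neg_unip :: "complex fls ^ 'm::finite ^ 'm \<Rightarrow> bool" where
  "neg_unip A \<longleftrightarrow>
     (\<forall>i j. A $ i $ j \<in> inv_polys \<and> fls_nth (A $ i $ j) 0 = (if i = j then 1 else 0))"

lemma neg_loop_group_unip: "A \<in> neg_loop_group \<Longrightarrow> neg_unip A"
  by (auto simp: neg_loop_group_def GL_over_def neg_unip_def)

lemma neg_unip_lead:
  assumes A: "neg_unip A" and v: "deg_le d v"
  shows "deg_le d (A *v v)" and "coef (A *v v) i d = coef v i d"
proof -
  have ip: "A $ i $ j \<in> inv_polys" for i j
    using A by (simp add: neg_unip_def)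
  have *: "coef (A *v v) i n = (\<Sum>j\<in>UNIV. if n = d then fls_nth (A $ i $ j) 0 * coef v j d else 0)"
    if "d \<le> n" for i n
    unfolding coef_def matrix_vector_mult_def vec_lambda_beta fls_nth_sum
    using inv_polys_times_nth[OF ip _ that] v by (intro sum.cong) (auto simp: deg_le_def coef_def)
  then show "deg_le d (A *v v)" by (simp add: deg_le_def)
  have "fls_nth (A $ i $ j) 0 * coef v j d = (if j = i then coef v i d else 0)" for j
    using A by (simp add: neg_unip_def)
  then show "coef (A *v v) i d = coef v i d" using *[of d i] by simp
qed

lemmas neg_loop_group_lead = neg_unip_lead[OF neg_loop_group_unip]

text \<open>\<open>GL_over\<close> yields an inverse over polynomials in \<open>1/z\<close>; that it
  is again the identity at infinity follows by comparing leading terms.\<close>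

lemma neg_loop_group_inverse:
  assumes A: "A \<in> neg_loop_group"
  obtains B where "B \<in> neg_loop_group" "\<And>v. A *v (B *v v) = v" "\<And>v. B *v (A *v v) = v"
proof -
  obtain B where B: "\<And>i j. B $ i $ j \<in> inv_polys"
    and AB: "A ** B = Finite_Cartesian_Product.mat 1" "B ** A = Finite_Cartesian_Product.mat 1"
    using A by (auto simp: neg_loop_group_def GL_over_def)
  have "fls_nth (B $ i $ j) 0 = (if i = j then 1 else 0)" for i j
  proof -
    \<comment> \<open>Column \<open>j\<close> of \<open>B\<close> is sent to the \<open>j\<close>-th
      unit vector, and \<open>A\<close> keeps its coefficients at exponent 0.\<close>
    let ?b = "\<chi> k. B $ k $ j"
    have b: "deg_le 0 ?b" using B by (auto simp: deg_le_def coef_def inv_polys_def)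
    have "(A *v ?b) $ i = (A ** B) $ i $ j"
      by (simp add: matrix_vector_mult_def matrix_matrix_mult_def)
    then have "coef (A *v ?b) i 0 = fls_nth (Finite_Cartesian_Product.mat 1 $ i $ j) 0"
      by (simp add: coef_def AB)
    then have "coef ?b i 0 = fls_nth (Finite_Cartesian_Product.mat 1 $ i $ j) 0"
      using neg_loop_group_lead(2)[OF A b] by simp
    then show ?thesis by (simp add: coef_def Finite_Cartesian_Product.mat_def)
  qed
  with A B AB have "B \<in> neg_loop_group" by (auto simp: neg_loop_group_def GL_over_def)
  moreover have "A *v (B *v v) = v" "B *v (A *v v) = v" for v
    by (simp_all add: matrix_vector_mul_assoc AB)
  ultimately show ?thesis using that by blast
qed

lemma matrix_z_lattice:
  fixes A :: "complex fls ^ 'm::finite ^ 'm"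
  assumes A: "\<And>j. A *v axis j 1 \<in> z_lattice (- M)" and v: "v \<in> z_lattice k"
  shows "A *v v \<in> z_lattice (k - M)"
proof -
  have "v $ j *s (A *v axis j 1) \<in> z_lattice (k - M)" for j
  proof -
    have "fls_shift k (v $ j) \<in> power_series"
      using v by (simp add: power_series_iff z_lattice_iff coef_def)
    then have "fls_shift k (v $ j) *s (A *v axis j 1) \<in> z_lattice (- M)"
      using A by (rule power_series_smult_z_lattice)
    then have "zmul k (fls_shift k (v $ j) *s (A *v axis j 1)) \<in> z_lattice (k - M)"
      by (rule zmul_in_z_lattice) simp
    moreover have "zmul k (fls_shift k (v $ j) *s (A *v axis j 1)) = v $ j *s (A *v axis j 1)"
      by (simp add: zmul_def fls_shifted_times_simps)
    ultimately show ?thesis by simp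
  qed
  then show ?thesis
    unfolding matrix_vector_sum_columns[of A v]
    by (intro cv.subspace_sum) auto
qed

lemma matrix_z_lattice_bound:
  fixes A :: "complex fls ^ 'm::finite ^ 'm"
  obtains M where "\<And>k v. v \<in> z_lattice k \<Longrightarrow> A *v v \<in> z_lattice (k - M)"
proof -
  have "\<forall>j. \<exists>N. A *v axis j 1 \<in> z_lattice N"
    using lvec_lower_bound by (auto simp: z_lattice_iff)
  then obtain N where N: "A *v axis j 1 \<in> z_lattice (N j)" for j by metis
  define M where "M = - Min (range N)"
  have "A *v axis j 1 \<in> z_lattice (- M)" for j
  proof -
    have "- M \<le> N j" unfolding M_def minus_minus by simp
    then show ?thesis using N[of j] z_lattice_mono by blast
  qed
  then show ?thesis using matrix_z_lattice that by blast
qed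

lemma zsub_image:
  fixes A :: "complex fls ^ 'm::finite ^ 'm"
  assumes "zsub L" shows "zsub ((\<lambda>v. A *v v) ` L)"
proof -
  have L: "cv.subspace L" "\<And>v. v \<in> L \<Longrightarrow> zmul 1 v \<in> L" using assms by (auto simp: zsub_def)
  show ?thesis
    unfolding zsub_def cv.subspace_def
  proof (intro conjI ballI allI)
    show "0 \<in> (\<lambda>v. A *v v) ` L" using cv.subspace_0[OF L(1)] by force
    fix x y c
    assume x: "x \<in> (\<lambda>v. A *v v) ` L"
    then obtain u where u: "u \<in> L" "x = A *v u" by blast
    have "cmul c x = A *v cmul c u" "zmul 1 x = A *v zmul 1 u"
      by (simp_all only: u matrix_vector_mul_cmul matrix_vector_mul_zmul)
    then show "cmul c x \<in> (\<lambda>v. A *v v) ` L" "zmul 1 x \<in> (\<lambda>v. A *v v) ` L"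
      using L(2)[OF u(1)] cv.subspace_scale[OF L(1) u(1)] by (simp_all only: imageI)
    assume "y \<in> (\<lambda>v. A *v v) ` L"
    then obtain w where w: "w \<in> L" "y = A *v w" by blast
    have "x + y = A *v (u + w)" by (simp only: u w matrix_vector_mul_add)
    then show "x + y \<in> (\<lambda>v. A *v v) ` L"
      using cv.subspace_add[OF L(1) u(1) w(1)] by (simp only: imageI)
  qed
qed

section \<open>Diagonal matrices and points of the loop Grassmannian\<close>

definition zdiag :: "('m::finite \<Rightarrow> int) \<Rightarrow> complex fls ^ 'm ^ 'm" where
  "zdiag \<eta> = (\<chi> i j. if i = j then fls_X_intpow (- \<eta> i) else 0)"

lemma zdiag_mult_vec: "(zdiag \<eta> *v v) $ i = fls_X_intpow (- \<eta> i) * v $ i"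
  by (simp add: zdiag_def matrix_vector_mult_def if_distrib[of "\<lambda>x. x * _"] cong: if_cong)

lemma coef_zdiag: "coef (zdiag \<eta> *v v) i n = coef v i (n + \<eta> i)"
  by (simp add: coef_def zdiag_mult_vec fls_shift_1_mult)

lemma zdiag_mult: "zdiag \<eta> ** zdiag (\<lambda>i. - \<eta> i) = Finite_Cartesian_Product.mat 1"
  by (auto simp: zdiag_def matrix_matrix_mult_def Finite_Cartesian_Product.mat_def lvec_eq_iff
        if_distrib[of "\<lambda>x. x * _"] fls_shift_1_mult cong: if_cong)

lemma zdiag_std_lattice:
  "(\<lambda>v. zdiag \<eta> *v v) ` std_lattice \<theta> = std_lattice (\<lambda>i. \<eta> i + \<theta> i)"
proof (intro equalityI subsetI)
  fix v assume "v \<in> std_lattice (\<lambda>i. \<eta> i + \<theta> i)"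
  then have "zdiag (\<lambda>i. - \<eta> i) *v v \<in> std_lattice \<theta>"
    by (auto simp: std_lattice_iff coef_zdiag)
  moreover have "v = zdiag \<eta> *v (zdiag (\<lambda>i. - \<eta> i) *v v)"
    by (simp add: matrix_vector_mul_assoc zdiag_mult)
  ultimately show "v \<in> (\<lambda>v. zdiag \<eta> *v v) ` std_lattice \<theta>" by blast
qed (auto simp: std_lattice_iff coef_zdiag)

lemma zdiag_GL: "zdiag \<eta> \<in> GL_over UNIV"
  unfolding GL_over_def
  using zdiag_mult[of \<eta>] zdiag_mult[of "\<lambda>i. - \<eta> i"]
  by (auto intro: exI[of _ "zdiag (\<lambda>i. - \<eta> i)"])

lemma GL_over_UNIV_mult: "A \<in> GL_over UNIV \<Longrightarrow> B \<in> GL_over UNIV \<Longrightarrow> A ** B \<in> GL_over UNIV"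
proof -
  assume "A \<in> GL_over UNIV" "B \<in> GL_over UNIV"
  then obtain A' B' where *: "A ** A' = Finite_Cartesian_Product.mat 1" "A' ** A = Finite_Cartesian_Product.mat 1"
    "B ** B' = Finite_Cartesian_Product.mat 1" "B' ** B = Finite_Cartesian_Product.mat 1"
    unfolding GL_over_def by auto
  have "A ** B ** (B' ** A') = A ** (B ** B') ** A'" "B' ** A' ** (A ** B) = B' ** (A' ** A) ** B"
    by (simp_all add: matrix_mul_assoc)
  then show ?thesis
    unfolding GL_over_def using * by (auto intro!: exI[of _ "B' ** A'"])
qed

lemma GL_image_std_lattice_in_loop_Gr:
  assumes "A \<in> GL_over UNIV"
  shows "(\<lambda>v. A *v v) ` std_lattice \<eta> \<in> loop_Gr"
proof -
  have "(\<lambda>v. A *v v) ` std_lattice \<eta> = (\<lambda>v. A ** zdiag \<eta> *v v) ` std_lattice (\<lambda>_. 0)"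
    using zdiag_std_lattice[of \<eta> "\<lambda>_. 0"]
    by (simp add: image_image matrix_vector_mul_assoc[symmetric] flip: image_image[of _ "\<lambda>v. zdiag \<eta> *v v"])
  then show ?thesis
    unfolding loop_Gr_def using GL_over_UNIV_mult[OF assms zdiag_GL] by blast
qed

lemma GL_over_subset_UNIV: "A \<in> GL_over R \<Longrightarrow> A \<in> GL_over UNIV"
  by (auto simp: GL_over_def)

lemma z_lattice_eq_std: "z_lattice k = std_lattice (\<lambda>_. - k)"
  by (auto simp: z_lattice_iff std_lattice_iff)

lemma GL_over_UNIV_1: "Finite_Cartesian_Product.mat 1 \<in> GL_over UNIV"
  by (auto simp: GL_over_def intro: exI[of _ "Finite_Cartesian_Product.mat 1"])

lemma std_lattice_in_loop_Gr: "std_lattice \<eta> \<in> loop_Gr"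
  using GL_image_std_lattice_in_loop_Gr[OF GL_over_UNIV_1, of \<eta>] by simp

lemma z_lattice_in_loop_Gr: "z_lattice k \<in> loop_Gr"
  unfolding z_lattice_eq_std by (rule std_lattice_in_loop_Gr)

lemma slice_subset_loop_Gr: "slice \<sigma> \<subseteq> loop_Gr"
  by (auto simp: slice_def neg_loop_group_def intro!: GL_image_std_lattice_in_loop_Gr GL_over_subset_UNIV)

lemma Gr_orbit_subset_loop_Gr: "Gr_orbit \<eta> \<subseteq> loop_Gr"
  by (auto simp: Gr_orbit_def intro!: GL_image_std_lattice_in_loop_Gr GL_over_subset_UNIV)

lemma loop_Gr_zsub: "L \<in> loop_Gr \<Longrightarrow> zsub L"
  by (auto simp: loop_Gr_def intro: zsub_image)

text \<open>Elements of the negative loop group preserve leading terms with respect to the total degree, and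
  every monomial lies in \<^term>\<open>std_lattice \<sigma>\<close> or in \<^term>\<open>U_neg \<sigma>\<close>.\<close>

lemma slice_leading:
  assumes A: "A \<in> neg_loop_group" and v: "v \<in> std_lattice \<sigma>" and u: "u \<in> std_lattice \<sigma>"
    and diff: "A *v u - v \<in> U_neg \<sigma>" and d: "deg_le d v"
  shows "deg_le d (A *v u)" and "coef (A *v u) i d = coef v i d"
proof -
  let ?w = "A *v u"
  obtain B where B: "B \<in> neg_loop_group" "B *v ?w = u"
    using neg_loop_group_inverse[OF A] by metis
  have dw: "coef ?w i n = coef v i n" if "- \<sigma> i \<le> n" for i n
    using diff that by (simp add: U_neg_iff)
  \<comment> \<open>The leading term of \<open>?w\<close> equals that of \<open>u\<close>, an
    element of \<open>L_\<sigma>\<close>, so it sits at exponents where \<open>?w\<close> and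
    \<open>v\<close> agree.\<close>
  have key: "- \<sigma> i \<le> e" if "deg_le e ?w" "coef ?w i e \<noteq> 0" for e i
  proof (rule ccontr)
    assume "\<not> - \<sigma> i \<le> e"
    moreover have "coef u i e = coef ?w i e"
      using neg_loop_group_lead(2)[OF B(1) that(1)] B(2) by simp
    ultimately show False using u that(2) by (auto simp: std_lattice_iff)
  qed
  show deg_le: "deg_le d ?w"
  proof (cases "?w = 0")
    case False
    \<comment> \<open>A crude first bound, so that a leading degree exists: from
      \<open>Max (range (\<lambda>i. - \<sigma> i))\<close> on, \<open>?w\<close> has the
      coefficients of \<open>v\<close>.\<close>
    have "deg_le (max d (Max (range (\<lambda>i. - \<sigma> i)))) ?w"
      unfolding deg_le_def
    proof (intro allI impI)
      fix i n assume n: "max d (Max (range (\<lambda>i. - \<sigma> i))) < n"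
      then have "- \<sigma> i \<le> n" by (smt (verit) Max_ge finite_class.finite_UNIV finite_imageI rangeI)
      with n dw d show "coef ?w i n = 0" by (simp add: deg_le_def)
    qed
    then obtain e i where e: "deg_le e ?w" "coef ?w i e \<noteq> 0" using False by (rule leading_degree)
    then have "coef v i e \<noteq> 0" using key dw by force
    then have "e \<le> d" using d unfolding deg_le_def by force
    with e(1) show ?thesis by (rule deg_le_mono)
  qed (simp add: deg_le_def)
  show "coef ?w i d = coef v i d"
  proof (cases "- \<sigma> i \<le> d")
    case False
    then have "coef ?w i d = 0" using key[OF deg_le] by blast
    moreover have "coef v i d = 0" using v False by (simp add: std_lattice_iff)
    ultimately show ?thesis by simp
  qed (rule dw)
qed

text \<open>Vectors of bounded degree are treated by cancelling one leading term after another. A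
  tail of high order lies in the image of \<open>L_\<sigma>\<close> anyway, because the inverse
  matrix lowers orders by a bounded amount.\<close>

lemma slice_complement:
  assumes A: "A \<in> neg_loop_group"
  shows "\<exists>u\<in>std_lattice \<sigma>. A *v u - w \<in> U_neg \<sigma>"
proof -
  let ?P = "\<lambda>w. \<exists>u\<in>std_lattice \<sigma>. A *v u - w \<in> U_neg \<sigma>"
  have sum: "?P (w + w')" if "?P w" "?P w'" for w w'
  proof -
    obtain u u' where "u \<in> std_lattice \<sigma>" "u' \<in> std_lattice \<sigma>"
      "A *v u - w \<in> U_neg \<sigma>" "A *v u' - w' \<in> U_neg \<sigma>"
      using \<open>?P w\<close> \<open>?P w'\<close> by blast
    then show ?thesis
      by (intro bexI[of _ "u + u'"]) (auto simp: U_neg_iff matrix_vector_mul_add std_lattice_iff)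
  qed
  \<comment> \<open>Vectors of degree at most \<open>c\<close>, which is below every
    \<open>- \<sigma> i\<close>, lie in \<open>U_neg \<sigma>\<close>; the induction starts
    there.\<close>
  define c where "c = Min (range (\<lambda>i. - \<sigma> i)) - 1"
  have c: "c < - \<sigma> i" for i
    unfolding c_def by (smt (verit) Min_le finite_class.finite_UNIV finite_imageI rangeI)
  have bounded: "deg_le (c + int k) w \<Longrightarrow> ?P w" for k w
  proof (induction k arbitrary: w)
    case 0
    then have "w \<in> U_neg \<sigma>" using c by (auto simp: U_neg_iff deg_le_def intro: less_le_trans)
    then show ?case by (intro bexI[of _ 0]) (auto simp: U_neg_iff std_lattice_iff)
  next
    case (Suc k)
    let ?d = "c + int (Suc k)"
    \<comment> \<open>Each monomial of degree \<open>?d\<close> belongs either to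
      \<open>L_\<sigma>\<close>, where \<open>A\<close> reproduces it to leading order, or to
      \<open>U_neg \<sigma>\<close>.\<close>
    define u where "u = filt (\<lambda>i n. n = ?d \<and> - \<sigma> i \<le> n) w"
    define x where "x = filt (\<lambda>i n. n = ?d \<and> n < - \<sigma> i) w"
    have u: "u \<in> std_lattice \<sigma>" "deg_le ?d u" by (auto simp: u_def std_lattice_iff deg_le_def)
    have x: "x \<in> U_neg \<sigma>" "deg_le ?d x" by (auto simp: x_def U_neg_iff deg_le_def)
    note lead = neg_loop_group_lead[OF A u(2)]
    have "deg_le ?d (w - A *v u - x)" using Suc.prems lead(1) x(2) by (intro deg_le_diff)
    moreover have "coef (w - A *v u - x) i ?d = 0" for i
      using lead(2)[of i] by (auto simp: u_def x_def)
    ultimately have "deg_le (?d - 1) (w - A *v u - x)" by (rule deg_le_decrease)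
    then have "?P (w - A *v u - x)" by (intro Suc.IH) (simp add: algebra_simps)
    moreover have "?P (A *v u)" using u by (intro bexI[of _ u]) (auto simp: U_neg_iff)
    moreover have "?P x" using x by (intro bexI[of _ 0]) (auto simp: U_neg_iff std_lattice_iff)
    ultimately have "?P ((w - A *v u - x) + A *v u + x)" by (intro sum)
    then show ?case by simp
  qed
  obtain B where B: "\<And>v. A *v (B *v v) = v"
    using neg_loop_group_inverse[OF A] by metis
  obtain M where M: "\<And>k v. v \<in> z_lattice k \<Longrightarrow> B *v v \<in> z_lattice (k - M)"
    using matrix_z_lattice_bound by blast
  \<comment> \<open>\<open>K\<close> is chosen so that \<open>B\<close> maps
    \<open>z_lattice K\<close> into \<open>L_\<sigma>\<close>.\<close>
  define K where "K = Max (range (\<lambda>i. - \<sigma> i)) + M"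
  have K: "- \<sigma> i \<le> K - M" for i
    unfolding K_def by simp
  define r where "r = filt (\<lambda>i n. K \<le> n) w"
  have "r \<in> z_lattice K" by (simp add: r_def z_lattice_iff)
  then have "B *v r \<in> std_lattice \<sigma>"
    using M K by (fastforce simp: std_lattice_iff z_lattice_iff intro: less_le_trans)
  then have "?P r" by (intro bexI[of _ "B *v r"]) (auto simp: B U_neg_iff)
  moreover have "?P (w - r)"
  proof (rule bounded)
    show "deg_le (c + int (nat (K - c))) (w - r)" by (auto simp: deg_le_def r_def)
  qed
  ultimately have "?P (r + (w - r))" by (rule sum)
  then show ?thesis by simp
qed

lemma slice_subset_Gr_chart: "slice \<sigma> \<subseteq> Gr_chart \<sigma>"
proof
  fix L assume "L \<in> slice \<sigma>"
  then obtain A where A: "A \<in> neg_loop_group" and L: "L = (\<lambda>v. A *v v) ` std_lattice \<sigma>"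
    by (auto simp: slice_def)
  have "L \<inter> U_neg \<sigma> = {0}"
  proof (intro equalityI subsetI)
    fix w assume "w \<in> L \<inter> U_neg \<sigma>"
    then obtain u where u: "u \<in> std_lattice \<sigma>" "w = A *v u" "A *v u - 0 \<in> U_neg \<sigma>"
      using L by auto
    \<comment> \<open>This is \<open>slice_leading\<close> for \<open>v = 0\<close>, of which every
      \<open>n\<close> is a degree bound.\<close>
    have "coef w i n = 0" for i n
      using slice_leading(2)[OF A _ u(1) u(3), of n i] by (auto simp: u(2) std_lattice_iff deg_le_def)
    then show "w \<in> {0}" by (auto intro: lvec_eqI)
  next
    fix w :: "'a lvec" assume "w \<in> {0}"
    then show "w \<in> L \<inter> U_neg \<sigma>"
      using L by (auto simp: U_neg_iff std_lattice_iff intro!: image_eqI[of _ _ 0])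
  qed
  moreover have "w \<in> L + U_neg \<sigma>" for w
  proof -
    obtain u where "u \<in> std_lattice \<sigma>" and u: "A *v u - w \<in> U_neg \<sigma>"
      using slice_complement[OF A] by blast
    moreover have "w - A *v u \<in> U_neg \<sigma>"
      using u by (auto simp: U_neg_iff)
    ultimately have "A *v u + (w - A *v u) \<in> L + U_neg \<sigma>"
      using L by (intro set_plus_intro) auto
    then show ?thesis by simp
  qed
  moreover have "L \<in> loop_Gr" using \<open>L \<in> slice \<sigma>\<close> slice_subset_loop_Gr by blast
  ultimately show "L \<in> Gr_chart \<sigma>" by (auto simp: Gr_chart_def)
qed

text \<open>For \<open>L\<close> in the chart this is the section into \<open>L\<close> of the
  projection along \<open>U_neg \<sigma>\<close>, extended by 0 on \<open>U_neg \<sigma>\<close>.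
  Being defined on all vectors, it is linear without side conditions.\<close>

definition hlift :: "('m::finite \<Rightarrow> int) \<Rightarrow> 'm lvec set \<Rightarrow> 'm lvec \<Rightarrow> 'm lvec" where
  "hlift \<sigma> L v = (THE w. w \<in> L \<and> w - v \<in> U_neg \<sigma>)"

context
  fixes \<sigma> :: "'m::finite \<Rightarrow> int" and L :: "'m lvec set"
  assumes L: "L \<in> Gr_chart \<sigma>"
begin

lemma chart_zsub: "zsub L"
  using L loop_Gr_zsub by (auto simp: Gr_chart_def)

lemma chart_subspace: "cv.subspace L"
  using chart_zsub by (simp add: zsub_def)

lemma chart_unique: "w \<in> L \<Longrightarrow> w' \<in> L \<Longrightarrow> w - w' \<in> U_neg \<sigma> \<Longrightarrow> w = w'"
proof -
  assume "w \<in> L" "w' \<in> L" "w - w' \<in> U_neg \<sigma>"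
  then have "w - w' \<in> L \<inter> U_neg \<sigma>" using cv.subspace_diff[OF chart_subspace] by blast
  also have "\<dots> = {0}" using L by (simp add: Gr_chart_def)
  finally show ?thesis by simp
qed

lemma hlift_props: "hlift \<sigma> L v \<in> L \<and> hlift \<sigma> L v - v \<in> U_neg \<sigma>"
proof -
  have "v \<in> L + U_neg \<sigma>" using L by (simp add: Gr_chart_def)
  then obtain w u where w: "w \<in> L" "u \<in> U_neg \<sigma>" "v = w + u" by (rule set_plus_elim)
  then have "w \<in> L \<and> w - v \<in> U_neg \<sigma>" by (auto simp: U_neg_iff)
  then show ?thesis
    unfolding hlift_def
  proof (rule theI)
    fix x assume "x \<in> L \<and> x - v \<in> U_neg \<sigma>"
    moreover have "x - w = (x - v) + u" using w by simp
    ultimately show "x = w"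
      using w cv.subspace_add[OF subspace_U_neg] by (metis chart_unique)
  qed
qed

lemma hlift_in: "hlift \<sigma> L v \<in> L"
  and hlift_diff: "hlift \<sigma> L v - v \<in> U_neg \<sigma>"
  using hlift_props by auto

lemma hlift_eqI: "w \<in> L \<Longrightarrow> w - v \<in> U_neg \<sigma> \<Longrightarrow> hlift \<sigma> L v = w"
proof -
  assume w: "w \<in> L" "w - v \<in> U_neg \<sigma>"
  have "hlift \<sigma> L v - w = (hlift \<sigma> L v - v) - (w - v)" by simp
  also have "\<dots> \<in> U_neg \<sigma>" using hlift_diff w(2) by (rule cv.subspace_diff[OF subspace_U_neg])
  finally show ?thesis using w hlift_in chart_unique by blast
qed

lemma hlift_id: "v \<in> L \<Longrightarrow> hlift \<sigma> L v = v"
  by (rule hlift_eqI) (auto simp: U_neg_iff)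

lemma hlift_add: "hlift \<sigma> L (v + w) = hlift \<sigma> L v + hlift \<sigma> L w"
  using hlift_diff[of v] hlift_diff[of w] hlift_in[of v] hlift_in[of w]
  by (intro hlift_eqI) (auto simp: U_neg_iff intro: cv.subspace_add[OF chart_subspace])

lemma hlift_cmul: "hlift \<sigma> L (cmul c v) = cmul c (hlift \<sigma> L v)"
  using hlift_diff[of v] hlift_in[of v]
  by (intro hlift_eqI) (auto simp: U_neg_iff intro: cv.subspace_scale[OF chart_subspace])

lemma coef_hlift: "- \<sigma> i \<le> n \<Longrightarrow> coef (hlift \<sigma> L v) i n = coef v i n"
  using hlift_diff[of v] by (simp add: U_neg_iff)

lemma hlift_cong: "(\<And>i n. - \<sigma> i \<le> n \<Longrightarrow> coef v i n = coef w i n) \<Longrightarrow> hlift \<sigma> L v = hlift \<sigma> L w"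
  using hlift_in[of w] coef_hlift[of _ _ w] by (intro hlift_eqI) (auto simp: U_neg_iff)

end

lemma hlift_slice_leading:
  assumes L: "L \<in> slice \<sigma>" and v: "v \<in> std_lattice \<sigma>" and d: "deg_le d v"
  shows "deg_le d (hlift \<sigma> L v)" and "coef (hlift \<sigma> L v) i d = coef v i d"
proof -
  have chart: "L \<in> Gr_chart \<sigma>" using L slice_subset_Gr_chart by blast
  obtain A u where A: "A \<in> neg_loop_group" "u \<in> std_lattice \<sigma>" "hlift \<sigma> L v = A *v u"
    using L hlift_in[OF chart, of v] by (auto simp: slice_def)
  note * = slice_leading[OF A(1) v A(2) _ d]
  show "deg_le d (hlift \<sigma> L v)" "coef (hlift \<sigma> L v) i d = coef v i d"
    using * hlift_diff[OF chart, of v] A(3) by auto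
qed

section \<open>Operators on the finite-dimensional quotient\<close>

text \<open>If \<open>p\<close> is the least exponent killing \<open>v\<close>, the vectors
  \<open>T^(p-1) v, ..., T v, v\<close> are independent, so \<open>p\<close> is at most the size of
  a spanning set. The bound does not depend on \<open>T\<close>, which later makes expressions
  polynomial in the operator.\<close>

lemma nilpotent_orbit_bound:
  fixes T :: "('m::finite) lvec \<Rightarrow> 'm lvec"
  assumes B: "finite B" and F: "F = cv.span B" and T: "\<And>v. v \<in> F \<Longrightarrow> T v \<in> F"
    and add: "\<And>v w. v \<in> F \<Longrightarrow> w \<in> F \<Longrightarrow> T (v + w) = T v + T w"
    and scale: "\<And>c v. v \<in> F \<Longrightarrow> T (cmul c v) = cmul c (T v)"
    and v: "v \<in> F" and nil: "(T ^^ n) v = 0"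
  shows "(T ^^ card B) v = 0"
proof (rule ccontr)
  assume ne: "(T ^^ card B) v \<noteq> 0"
  have sub: "cv.subspace F" by (simp add: F)
  have TF: "w \<in> F \<Longrightarrow> (T ^^ q) w \<in> F" for q w by (induction q) (auto intro: T)
  have T0: "T 0 = 0" using scale[OF cv.subspace_0[OF sub], of 0] by simp
  have Tadd: "x \<in> F \<Longrightarrow> y \<in> F \<Longrightarrow> (T ^^ q) (x + y) = (T ^^ q) x + (T ^^ q) y" for q x y
    by (induction q) (auto simp: add TF)
  have Tscale: "x \<in> F \<Longrightarrow> (T ^^ q) (cmul c x) = cmul c ((T ^^ q) x)" for q x c
    by (induction q) (auto simp: scale TF)
  have Tz: "(T ^^ q) 0 = 0" for q by (induction q) (auto simp: T0)
  define p where "p = (LEAST n. (T ^^ n) v = 0)"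
  have p: "(T ^^ p) v = 0" unfolding p_def using nil by (rule LeastI)
  have least: "(T ^^ q) v \<noteq> 0" if "q < p" for q
    using not_less_Least that unfolding p_def by blast
  have le: "(T ^^ (q + r)) v = (T ^^ q) ((T ^^ r) v)" for q r by (simp add: funpow_add)
  have "card B < p"
  proof (rule ccontr)
    assume "\<not> card B < p"
    then have "(T ^^ card B) v = (T ^^ (card B - p)) ((T ^^ p) v)" by (simp flip: le)
    then show False using ne p Tz by simp
  qed
  \<comment> \<open>The last \<open>q\<close> nonzero vectors of the orbit. All are killed by
    \<open>T^q\<close>, while the next one to be added is not.\<close>
  define V where "V q = (\<lambda>j. (T ^^ (p - 1 - j)) v) ` {..<q}" for q
  have ker: "cv.subspace {w \<in> F. (T ^^ q) w = 0}" for q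
    using sub by (auto simp: cv.subspace_def Tadd Tscale Tz)
  have "q \<le> p \<Longrightarrow> cv.independent (V q) \<and> card (V q) = q \<and> V q \<subseteq> {w \<in> F. (T ^^ q) w = 0}" for q
  proof (induction q)
    case 0
    then show ?case by (simp add: V_def cv.independent_empty)
  next
    case (Suc q)
    then have IH: "cv.independent (V q)" "card (V q) = q" "V q \<subseteq> {w \<in> F. (T ^^ q) w = 0}" by auto
    let ?x = "(T ^^ (p - 1 - q)) v"
    have V: "V (Suc q) = insert ?x (V q)" by (simp add: V_def lessThan_Suc)
    have "(T ^^ q) ?x = (T ^^ (p - 1)) v" using Suc.prems by (simp flip: le)
    then have "(T ^^ q) ?x \<noteq> 0" using least[of "p - 1"] Suc.prems by simp
    moreover have "cv.span (V q) \<subseteq> {w \<in> F. (T ^^ q) w = 0}"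
      using cv.span_minimal[OF IH(3) ker] .
    ultimately have notin: "?x \<notin> cv.span (V q)" by blast
    then have "?x \<notin> V q" using cv.span_base by blast
    then have "card (V (Suc q)) = Suc q" unfolding V using IH(2) by (simp add: V_def)
    moreover have "cv.independent (V (Suc q))"
      unfolding V using IH(1) notin by (rule cv.independent_insertI[rotated])
    moreover have "V (Suc q) \<subseteq> {w \<in> F. (T ^^ Suc q) w = 0}"
    proof -
      have "(T ^^ Suc q) ?x = (T ^^ p) v"
        using Suc.prems by (simp only: le[symmetric]) (simp add: Suc_diff_Suc)
      then have "?x \<in> {w \<in> F. (T ^^ Suc q) w = 0}" using p TF[OF v] by simp
      moreover have "V q \<subseteq> {w \<in> F. (T ^^ Suc q) w = 0}"
        using IH(3) by (auto simp: T0)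
      ultimately show ?thesis unfolding V by blast
    qed
    ultimately show ?case by blast
  qed
  from this[of p] have "cv.independent (V p)" "card (V p) = p" "V p \<subseteq> cv.span B"
    using F by auto
  then have "p \<le> card B" using cv.independent_span_bound[OF B] by metis
  then show False using \<open>card B < p\<close> by simp
qed

section \<open>Cosets and their truncated representatives\<close>

lemma cls_iff: "w \<in> cls S v \<longleftrightarrow> w - v \<in> z_lattice S"
proof
  assume "w \<in> cls S v"
  then show "w - v \<in> z_lattice S" unfolding cls_def by (auto elim!: set_plus_elim)
next
  assume "w - v \<in> z_lattice S"
  then have "v + (w - v) \<in> cls S v" unfolding cls_def by (intro set_plus_intro) auto
  then show "w \<in> cls S v" by simp
qed

lemma cls_eq_iff: "cls S v = cls S w \<longleftrightarrow> v - w \<in> z_lattice S"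
proof
  assume "cls S v = cls S w"
  then have "v \<in> cls S w" using cls_iff[of v S v] by (simp add: z_lattice_iff)
  then show "v - w \<in> z_lattice S" by (simp add: cls_iff)
next
  assume "v - w \<in> z_lattice S"
  then show "cls S v = cls S w"
    unfolding set_eq_iff cls_iff by (auto simp: z_lattice_iff)
qed

lemma cls_plus: "cls S v + cls S w = cls S (v + w)"
proof (intro equalityI subsetI)
  fix x assume "x \<in> cls S v + cls S w"
  then obtain a b where ab: "x = a + b" "a - v \<in> z_lattice S" "b - w \<in> z_lattice S"
    by (auto simp: cls_iff elim!: set_plus_elim)
  show "x \<in> cls S (v + w)"
    using ab(2,3) unfolding ab(1) cls_iff by (simp add: z_lattice_iff algebra_simps)
next
  fix x assume "x \<in> cls S (v + w)"
  then have "x - w \<in> cls S v" "w \<in> cls S w"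
    by (simp_all add: cls_iff algebra_simps) (simp add: z_lattice_iff)
  then have "(x - w) + w \<in> cls S v + cls S w" by (rule set_plus_intro)
  then show "x \<in> cls S v + cls S w" by simp
qed

lemma D_scale_cls: "D_scale S c (cls S v) = cls S (cmul c v)"
proof (intro equalityI subsetI)
  fix x assume "x \<in> D_scale S c (cls S v)"
  then obtain a b where ab: "x = cmul c a + b" "a - v \<in> z_lattice S" "b \<in> z_lattice S"
    by (auto simp: D_scale_def cls_iff elim!: set_plus_elim)
  then show "x \<in> cls S (cmul c v)"
    by (simp add: ab(1) cls_iff z_lattice_iff algebra_simps)
next
  fix x assume "x \<in> cls S (cmul c v)"
  then have "x - cmul c v \<in> z_lattice S" "v \<in> cls S v" 
    by (simp_all add: cls_iff) (simp add: z_lattice_iff)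
  then have "cmul c v + (x - cmul c v) \<in> cmul c ` cls S v + z_lattice S"
    by (intro set_plus_intro imageI)
  then show "x \<in> D_scale S c (cls S v)" by (simp add: D_scale_def)
qed

lemma z_image_cls: "zmul 1 ` cls S v + z_lattice S = cls S (zmul 1 v)"
proof (intro equalityI subsetI)
  fix x assume "x \<in> zmul 1 ` cls S v + z_lattice S"
  then obtain a b where ab: "x = zmul 1 a + b" "a - v \<in> z_lattice S" "b \<in> z_lattice S"
    by (auto simp: cls_iff elim!: set_plus_elim)
  then show "x \<in> cls S (zmul 1 v)"
    by (simp add: ab(1) cls_iff z_lattice_iff)
next
  fix x assume "x \<in> cls S (zmul 1 v)"
  then have "x - zmul 1 v \<in> z_lattice S" "v \<in> cls S v" 
    by (simp_all add: cls_iff) (simp add: z_lattice_iff)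
  then have "zmul 1 v + (x - zmul 1 v) \<in> zmul 1 ` cls S v + z_lattice S"
    by (intro set_plus_intro imageI)
  then show "x \<in> zmul 1 ` cls S v + z_lattice S" by simp
qed

abbreviation cut :: "int \<Rightarrow> ('m::finite) lvec \<Rightarrow> 'm lvec" where
  "cut S \<equiv> filt (\<lambda>_ n. n < S)"

lemma cut_eq_iff: "cut S v = cut S w \<longleftrightarrow> v - w \<in> z_lattice S"
proof
  assume "cut S v = cut S w"
  then have "coef (cut S v) i n = coef (cut S w) i n" for i n by simp
  then have "n < S \<Longrightarrow> coef v i n = coef w i n" for i n by (metis coef_filt)
  then show "v - w \<in> z_lattice S" by (simp add: z_lattice_iff)
qed (auto simp: z_lattice_iff intro: lvec_eqI)

lemma diff_cut_in [simp]: "v - cut S v \<in> z_lattice S" "cut S v - v \<in> z_lattice S"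
  by (simp_all add: z_lattice_iff)

text \<open>Truncation removes the dependence on the arbitrary choice and gives a normal form of
  cosets.\<close>

definition rep :: "int \<Rightarrow> ('m::finite) lvec set \<Rightarrow> 'm lvec" where
  "rep S X = cut S (SOME v. v \<in> X)"

lemma some_in_cls: "(SOME v. v \<in> cls S w) - w \<in> z_lattice S"
proof -
  have "w \<in> cls S w" by (simp add: cls_iff z_lattice_iff)
  then have "(SOME v. v \<in> cls S w) \<in> cls S w" by (rule someI)
  then show ?thesis by (simp add: cls_iff)
qed

lemma rep_cls [simp]: "rep S (cls S v) = cut S v"
  unfolding rep_def cut_eq_iff by (rule some_in_cls)

lemma D_coeff_cls: "1 \<le> k \<Longrightarrow> D_coeff S k i (cls S v) = coef v i (S - int k)"
  using some_in_cls[of S v] by (simp add: D_coeff_def z_lattice_iff flip: coef_def)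

lemma e_D_mon: "e_D S k i = cls S (mon i (S - int k))"
  by (simp add: e_D_def mon_def)

text \<open>Operators on cosets become maps of Laurent vectors with truncated values, so that powers
  and coefficients are computed without quotients.\<close>

definition lift :: "int \<Rightarrow> (('m::finite) lvec set \<Rightarrow> 'm lvec set) \<Rightarrow> 'm lvec \<Rightarrow> 'm lvec" where
  "lift S A v = rep S (A (cls S v))"

locale slice_setup =
  fixes \<sigma> :: "'m::finite \<Rightarrow> int" and S :: int
  assumes sub_std: "z_lattice S \<subseteq> std_lattice \<sigma>"
begin

lemma nonneg: "0 \<le> \<sigma> i + S"
proof -
  have "mon i S \<in> z_lattice S" by (auto simp: z_lattice_iff coef_mon)
  then have "mon i S \<in> std_lattice \<sigma>" using sub_std by blast
  then have "\<not> S < - \<sigma> i" unfolding std_lattice_iff by (metis coef_mon one_neq_zero)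
  then show ?thesis by simp
qed

lemma block_eq: "int (block \<sigma> S i) = \<sigma> i + S"
  using nonneg by (simp add: block_def)

section \<open>The quotient in monomial coordinates\<close>

definition J :: "('m \<times> int) set" where
  "J = {(j, n). - \<sigma> j \<le> n \<and> n < S}"

lemma J_iff [simp]: "(j, n) \<in> J \<longleftrightarrow> - \<sigma> j \<le> n \<and> n < S"
  by (simp add: J_def)

lemma finite_J [simp]: "finite J"
proof -
  have "J = (SIGMA j:UNIV. {- \<sigma> j..<S})" by (auto simp: J_def)
  then show ?thesis by simp
qed

text \<open>The monomial complement of \<open>z_lattice S\<close> in \<open>L_\<sigma>\<close>, a
  copy of \<open>\<D>\<close> inside the Laurent vectors. Given as a span, it fits
  \<open>nilpotent_orbit_bound\<close>.\<close>

definition core :: "'m lvec set" where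
  "core = cv.span ((\<lambda>(i, n). mon i n) ` J)"

lemma core_iff: "v \<in> core \<longleftrightarrow> (\<forall>i n. (i, n) \<notin> J \<longrightarrow> coef v i n = 0)"
proof
  have "cv.subspace {v. \<forall>i n. (i, n) \<notin> J \<longrightarrow> coef v i n = 0}"
    by (auto simp: cv.subspace_def)
  then have "core \<subseteq> {v. \<forall>i n. (i, n) \<notin> J \<longrightarrow> coef v i n = 0}"
    unfolding core_def by (rule cv.span_minimal[rotated]) (auto simp: coef_mon)
  then show "v \<in> core \<Longrightarrow> \<forall>i n. (i, n) \<notin> J \<longrightarrow> coef v i n = 0" by blast
next
  assume "\<forall>i n. (i, n) \<notin> J \<longrightarrow> coef v i n = 0"
  then have v: "v = (\<Sum>(i, n)\<in>J. cmul (coef v i n) (mon i n))"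
    by (intro finite_expansion) auto
  show "v \<in> core"
    unfolding core_def
    by (subst v, rule cv.span_sum) (clarsimp, rule cv.span_scale, rule cv.span_base, force)
qed

lemma core_subset: "v \<in> core \<Longrightarrow> v \<in> std_lattice \<sigma>"
  by (auto simp: core_iff std_lattice_iff)

lemma cut_core: "v \<in> std_lattice \<sigma> \<Longrightarrow> cut S v \<in> core"
  by (auto simp: core_iff std_lattice_iff)

lemma cut_core_id: "v \<in> core \<Longrightarrow> cut S v = v"
  by (rule lvec_eqI) (auto simp: core_iff)

lemma mon_std: "- \<sigma> j \<le> n \<Longrightarrow> mon j n \<in> std_lattice \<sigma>"
  by (auto simp: std_lattice_iff coef_mon)

lemma std_add: "v \<in> std_lattice \<sigma> \<Longrightarrow> w \<in> std_lattice \<sigma> \<Longrightarrow> v + w \<in> std_lattice \<sigma>"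
  and std_scale: "v \<in> std_lattice \<sigma> \<Longrightarrow> cmul c v \<in> std_lattice \<sigma>"
  and std_z: "v \<in> std_lattice \<sigma> \<Longrightarrow> zmul 1 v \<in> std_lattice \<sigma>"
  by (auto simp: std_lattice_iff)

lemma std_mod_z_lattice: "v \<in> std_lattice \<sigma> \<Longrightarrow> w - v \<in> z_lattice S \<Longrightarrow> w \<in> std_lattice \<sigma>"
  using std_add[of v "w - v"] sub_std by auto

lemma cls_in_D [simp]: "cls S v \<in> D_space \<sigma> S \<longleftrightarrow> v \<in> std_lattice \<sigma>"
  unfolding D_space_def using std_mod_z_lattice cls_eq_iff by blast

lemma D_space_E:
  assumes "X \<in> D_space \<sigma> S" obtains v where "v \<in> std_lattice \<sigma>" "X = cls S v"
  using assms unfolding D_space_def by blast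

lemma z_bar_cls: "v \<in> std_lattice \<sigma> \<Longrightarrow> z_bar \<sigma> S (cls S v) = cls S (zmul 1 v)"
  by (simp add: z_bar_def z_image_cls)

lemma cls_rep: "X \<in> D_space \<sigma> S \<Longrightarrow> cls S (rep S X) = X"
  by (elim D_space_E) (simp add: cls_eq_iff)

lemma rep_core: "X \<in> D_space \<sigma> S \<Longrightarrow> rep S X \<in> core"
  by (auto elim!: D_space_E intro: cut_core)

lemma End_D_cong:
  assumes "A \<in> End_D \<sigma> S" "B \<in> End_D \<sigma> S" "\<And>v. v \<in> std_lattice \<sigma> \<Longrightarrow> A (cls S v) = B (cls S v)"
  shows "A = B"
proof (rule extensionalityI)
  show "A \<in> extensional (D_space \<sigma> S)" "B \<in> extensional (D_space \<sigma> S)"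
    using assms by (auto simp: End_D_def PiE_def)
  fix X assume "X \<in> D_space \<sigma> S"
  then show "A X = B X" by (elim D_space_E) (simp add: assms(3))
qed

context
  fixes A assumes A: "A \<in> End_D \<sigma> S"
begin

lemma End_D_closed: "v \<in> std_lattice \<sigma> \<Longrightarrow> A (cls S v) \<in> D_space \<sigma> S"
  using A by (auto simp: End_D_def PiE_def)

lemma cls_lift: "v \<in> std_lattice \<sigma> \<Longrightarrow> cls S (lift S A v) = A (cls S v)"
  unfolding lift_def by (intro cls_rep End_D_closed)

lemma lift_core: "v \<in> std_lattice \<sigma> \<Longrightarrow> lift S A v \<in> core"
  unfolding lift_def by (intro rep_core End_D_closed)

lemma lift_std: "v \<in> std_lattice \<sigma> \<Longrightarrow> lift S A v \<in> std_lattice \<sigma>"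
  by (rule core_subset) (rule lift_core)

lemma lift_eqI: "v \<in> std_lattice \<sigma> \<Longrightarrow> A (cls S v) = cls S w \<Longrightarrow> lift S A v = cut S w"
  by (simp add: lift_def)

lemma lift_add:
  assumes v: "v \<in> std_lattice \<sigma>" and w: "w \<in> std_lattice \<sigma>"
  shows "lift S A (v + w) = lift S A v + lift S A w"
proof -
  have "A (cls S v + cls S w) = A (cls S v) + A (cls S w)"
    using A v w unfolding End_D_def by simp
  then have "A (cls S (v + w)) = cls S (lift S A v + lift S A w)"
    by (simp add: cls_plus cls_lift[OF v, symmetric] cls_lift[OF w, symmetric])
  then have "lift S A (v + w) = cut S (lift S A v + lift S A w)"
    using std_add[OF v w] by (rule lift_eqI[rotated])
  then show ?thesis using v w by (simp add: filt_add cut_core_id lift_core)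
qed

lemma lift_cmul:
  assumes v: "v \<in> std_lattice \<sigma>"
  shows "lift S A (cmul c v) = cmul c (lift S A v)"
proof -
  have "A (D_scale S c (cls S v)) = D_scale S c (A (cls S v))"
    using A v unfolding End_D_def by simp
  then have "A (cls S (cmul c v)) = cls S (cmul c (lift S A v))"
    by (simp add: D_scale_cls cls_lift[OF v, symmetric])
  then have "lift S A (cmul c v) = cut S (cmul c (lift S A v))"
    using std_scale[OF v] by (rule lift_eqI[rotated])
  then show ?thesis using v by (simp add: filt_cmul cut_core_id lift_core)
qed

lemma lift_cong: "v - w \<in> z_lattice S \<Longrightarrow> lift S A v = lift S A w"
  by (simp add: lift_def cls_eq_iff[symmetric])

lemma lift_0 [simp]: "lift S A 0 = 0"
  using lift_cmul[of 0 0] cv.subspace_0[OF subspace_std_lattice[of \<sigma>]] by simp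

lemma lift_sum:
  "finite I \<Longrightarrow> (\<And>i. i \<in> I \<Longrightarrow> f i \<in> std_lattice \<sigma>) \<Longrightarrow> lift S A (sum f I) = (\<Sum>i\<in>I. lift S A (f i))"
  by (induction I rule: finite_induct)
     (auto simp: lift_add cv.subspace_sum[OF subspace_std_lattice])

lemma lift_expand:
  assumes v: "v \<in> std_lattice \<sigma>"
  shows "lift S A v = (\<Sum>(j, n)\<in>J. cmul (coef v j n) (lift S A (mon j n)))"
proof -
  have "lift S A v = lift S A (cut S v)" by (rule lift_cong) simp
  also have "cut S v = (\<Sum>(j, n)\<in>J. cmul (coef (cut S v) j n) (mon j n))"
    using cut_core[OF v] by (intro finite_expansion) (auto simp: core_iff)
  also have "\<dots> = (\<Sum>p\<in>J. cmul (coef v (fst p) (snd p)) (mon (fst p) (snd p)))"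
    by (intro sum.cong) auto
  also have "lift S A \<dots> = (\<Sum>p\<in>J. lift S A (cmul (coef v (fst p) (snd p)) (mon (fst p) (snd p))))"
    by (intro lift_sum) (auto intro!: std_scale mon_std)
  also have "\<dots> = (\<Sum>p\<in>J. cmul (coef v (fst p) (snd p)) (lift S A (mon (fst p) (snd p))))"
    by (intro sum.cong lift_cmul) (auto intro!: mon_std)
  finally show ?thesis by (simp add: case_prod_unfold)
qed

lemma lift_pow_std: "v \<in> std_lattice \<sigma> \<Longrightarrow> (lift S A ^^ n) v \<in> std_lattice \<sigma>"
  by (induction n) (auto intro: lift_std)

lemma lift_pow_add:
  "v \<in> std_lattice \<sigma> \<Longrightarrow> w \<in> std_lattice \<sigma> \<Longrightarrow> (lift S A ^^ n) (v + w) = (lift S A ^^ n) v + (lift S A ^^ n) w"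
  by (induction n) (auto simp: lift_add lift_pow_std)

lemma lift_pow_cmul: "v \<in> std_lattice \<sigma> \<Longrightarrow> (lift S A ^^ n) (cmul c v) = cmul c ((lift S A ^^ n) v)"
  by (induction n) (auto simp: lift_cmul lift_pow_std)

lemma cls_lift_pow: "v \<in> std_lattice \<sigma> \<Longrightarrow> cls S ((lift S A ^^ n) v) = (A ^^ n) (cls S v)"
  by (induction n) (auto simp: cls_lift lift_pow_std)

lemma nilp_cone_iff:
  "A \<in> nilp_cone \<sigma> S \<longleftrightarrow> (\<exists>n. \<forall>v\<in>std_lattice \<sigma>. (lift S A ^^ n) v \<in> z_lattice S)"
proof -
  have "(\<forall>X\<in>D_space \<sigma> S. (A ^^ n) X = cls S 0) \<longleftrightarrow>
      (\<forall>v\<in>std_lattice \<sigma>. (lift S A ^^ n) v \<in> z_lattice S)" for n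
    by (auto simp: D_space_def cls_lift_pow[symmetric] cls_eq_iff)
  then show ?thesis using A by (simp add: nilp_cone_def)
qed

end

text \<open>\<open>card J\<close> is the dimension of \<open>\<D>\<close>. The additional step
  brings a vector of \<open>L_\<sigma>\<close> into \<open>core\<close>, where
  \<open>nilpotent_orbit_bound\<close> applies.\<close>

definition nil_bound :: nat where
  "nil_bound = Suc (card J)"

lemma nilp_lift_pow:
  assumes "A \<in> nilp_cone \<sigma> S" and v: "v \<in> std_lattice \<sigma>" and p: "nil_bound \<le> p"
  shows "(lift S A ^^ p) v = 0"
proof -
  have A: "A \<in> End_D \<sigma> S" using assms(1) by (simp add: nilp_cone_def)
  obtain n where n: "\<And>v. v \<in> std_lattice \<sigma> \<Longrightarrow> (lift S A ^^ n) v \<in> z_lattice S"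
    using assms(1) nilp_cone_iff[OF A] by blast
  let ?B = "(\<lambda>(i, n). mon i n) ` J" and ?w = "lift S A v"
  have w: "?w \<in> core" by (rule lift_core[OF A v])
  \<comment> \<open>Nilpotency only gives a vector of \<open>z_lattice S\<close>; one more
    application of the truncated operator makes it exactly 0.\<close>
  have "(lift S A ^^ Suc n) ?w = 0"
  proof -
    have "(lift S A ^^ Suc n) ?w = lift S A ((lift S A ^^ n) ?w)" by simp
    also have "\<dots> = lift S A 0" using n[OF core_subset[OF w]] by (intro lift_cong[OF A]) simp
    finally show ?thesis by (simp add: lift_0[OF A])
  qed
  then have zero: "(lift S A ^^ card ?B) ?w = 0"
    using w by (intro nilpotent_orbit_bound[of ?B core _ _ "Suc n"])
      (auto simp: core_def[symmetric] core_subset intro: lift_core[OF A] lift_add[OF A] lift_cmul[OF A])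
  have "card ?B \<le> card J" by (rule card_image_le) simp
  then have "Suc (card ?B) \<le> p" using p by (simp add: nil_bound_def)
  then obtain q where q: "p = q + Suc (card ?B)" by (metis add.commute le_Suc_ex)
  have "(lift S A ^^ p) v = (lift S A ^^ q) ((lift S A ^^ card ?B) ?w)"
    unfolding q funpow_add by (simp add: funpow_swap1)
  also have "\<dots> = 0" unfolding zero by (induction q) (auto simp: lift_0[OF A])
  finally show ?thesis .
qed

lemma nilp_coneI:
  assumes A: "A \<in> End_D \<sigma> S" and "\<And>j n. (j, n) \<in> J \<Longrightarrow> (lift S A ^^ p) (mon j n) = 0"
  shows "A \<in> nilp_cone \<sigma> S"
proof -
  have "(lift S A ^^ p) w = 0" if "w \<in> core" for w
  proof -
    have "cv.subspace {w \<in> std_lattice \<sigma>. (lift S A ^^ p) w = 0}"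
      using cv.subspace_0[OF subspace_std_lattice[of \<sigma>]] lift_pow_cmul[OF A, of 0 p 0]
      by (auto simp: cv.subspace_def lift_pow_add[OF A] lift_pow_cmul[OF A] std_add std_scale)
    then have "core \<subseteq> {w \<in> std_lattice \<sigma>. (lift S A ^^ p) w = 0}"
      unfolding core_def using assms(2)
      by (intro cv.span_minimal) (auto intro: mon_std)
    then show ?thesis using that by blast
  qed
  then have "(lift S A ^^ Suc p) v \<in> z_lattice S" if "v \<in> std_lattice \<sigma>" for v
    using lift_core[OF A that] by (simp add: funpow_swap1 z_lattice_iff)
  then show ?thesis using nilp_cone_iff[OF A] by blast
qed

end

section \<open>Operators of the slice and their lattices\<close>

context slice_setup
begin

text \<open>The representative of \<open>A - z_bar\<close> on cosets. For \<open>A\<close> in the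
  slice it is the map \<open>\<phi>\<close> of the embedding, with values in
  \<open>U_top \<sigma> S\<close>.\<close>

definition phi :: "('m lvec set \<Rightarrow> 'm lvec set) \<Rightarrow> 'm lvec \<Rightarrow> 'm lvec" where
  "phi A v = lift S A v - cut S (zmul 1 v)"

text \<open>A block of size 0 has \<open>- \<sigma> i = S\<close>, so excluding the exponents from
  \<open>S\<close> on removes exactly these components.\<close>

lemma U_top_iff: "u \<in> U_top \<sigma> S \<longleftrightarrow> (\<forall>i n. n \<noteq> - \<sigma> i \<or> S \<le> n \<longrightarrow> coef u i n = 0)"
proof
  assume u: "u \<in> U_top \<sigma> S"
  show "\<forall>i n. n \<noteq> - \<sigma> i \<or> S \<le> n \<longrightarrow> coef u i n = 0"
  proof (intro allI impI)
    fix i n assume n: "n \<noteq> - \<sigma> i \<or> S \<le> n"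
    show "coef u i n = 0"
    proof (cases "n = - \<sigma> i")
      case True
      then have "block \<sigma> S i = 0" using n nonneg[of i] by (simp add: block_def)
      then have "u $ i = 0" using u by (simp add: U_top_def)
      then show ?thesis by (simp add: coef_def)
    next
      case False
      then show ?thesis using u by (simp add: U_top_def U_space_iff)
    qed
  qed
next
  assume u: "\<forall>i n. n \<noteq> - \<sigma> i \<or> S \<le> n \<longrightarrow> coef u i n = 0"
  have "u $ i = 0" if "block \<sigma> S i = 0" for i
  proof (rule fls_eqI)
    fix n
    have "S \<le> - \<sigma> i" using that by (simp add: block_def)
    then have "coef u i n = 0" using u by (cases "n = - \<sigma> i") auto
    then show "fls_nth (u $ i) n = fls_nth 0 n" by (simp add: coef_def)
  qed
  then show "u \<in> U_top \<sigma> S" using u by (simp add: U_top_def U_space_iff)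
qed

lemma U_top_core: "u \<in> U_top \<sigma> S \<Longrightarrow> u \<in> core"
  by (force simp: U_top_iff core_iff)

text \<open>The condition on coefficients in the definition of the regular slice says that \<^term>\<open>phi A\<close>
  does not raise the total degree.\<close>

definition slice_op :: "('m lvec set \<Rightarrow> 'm lvec set) \<Rightarrow> bool" where
  "slice_op A \<longleftrightarrow> A \<in> End_D \<sigma> S \<and> (\<forall>v\<in>std_lattice \<sigma>. phi A v \<in> U_top \<sigma> S) \<and>
     (\<forall>j n i. (j, n) \<in> J \<longrightarrow> n < - \<sigma> i \<longrightarrow> coef (phi A (mon j n)) i (- \<sigma> i) = 0)"

lemma D_extensional_eqI:
  assumes "A \<in> extensional (D_space \<sigma> S)" "B \<in> extensional (D_space \<sigma> S)"
    "\<And>v. v \<in> std_lattice \<sigma> \<Longrightarrow> A (cls S v) = B (cls S v)"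
  shows "A = B"
proof (rule extensionalityI[OF assms(1,2)])
  fix X assume "X \<in> D_space \<sigma> S"
  then show "A X = B X" by (elim D_space_E) (simp add: assms(3))
qed

lemma End_D_I:
  assumes "\<And>v. v \<in> std_lattice \<sigma> \<Longrightarrow> A (cls S v) = cls S (f v)"
    and "\<And>v. v \<in> std_lattice \<sigma> \<Longrightarrow> f v \<in> std_lattice \<sigma>"
    and "\<And>v w. v \<in> std_lattice \<sigma> \<Longrightarrow> w \<in> std_lattice \<sigma> \<Longrightarrow> f (v + w) - (f v + f w) \<in> z_lattice S"
    and "\<And>c v. v \<in> std_lattice \<sigma> \<Longrightarrow> f (cmul c v) - cmul c (f v) \<in> z_lattice S"
    and "A \<in> extensional (D_space \<sigma> S)"
  shows "A \<in> End_D \<sigma> S"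
  unfolding End_D_def
proof (intro CollectI conjI ballI allI)
  have A: "A X \<in> D_space \<sigma> S" if X: "X \<in> D_space \<sigma> S" for X
    using that by (elim D_space_E) (simp add: assms)
  then show "A \<in> D_space \<sigma> S \<rightarrow>\<^sub>E D_space \<sigma> S" using assms(5) by (auto simp: PiE_def)
  fix X c
  assume "X \<in> D_space \<sigma> S"
  then obtain v where v: "v \<in> std_lattice \<sigma>" "X = cls S v" by (elim D_space_E)
  then show "A (D_scale S c X) = D_scale S c (A X)"
    by (simp add: D_scale_cls assms std_scale cls_eq_iff)
  fix Y
  assume "Y \<in> D_space \<sigma> S"
  then obtain w where w: "w \<in> std_lattice \<sigma>" "Y = cls S w" by (elim D_space_E)
  then show "A (X + Y) = A X + A Y"
    by (simp add: v cls_plus assms std_add cls_eq_iff)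
qed

lemma phi_add: "A \<in> End_D \<sigma> S \<Longrightarrow> v \<in> std_lattice \<sigma> \<Longrightarrow> w \<in> std_lattice \<sigma> \<Longrightarrow> phi A (v + w) = phi A v + phi A w"
  by (simp add: phi_def lift_add zmul_add filt_add)

lemma phi_cmul: "A \<in> End_D \<sigma> S \<Longrightarrow> v \<in> std_lattice \<sigma> \<Longrightarrow> phi A (cmul c v) = cmul c (phi A v)"
  by (simp add: phi_def lift_cmul zmul_cmul filt_cmul cv.scale_right_diff_distrib)

lemma phi_z_lattice:
  assumes "A \<in> End_D \<sigma> S" "v \<in> z_lattice S" shows "phi A v = 0"
proof -
  have "lift S A v = lift S A 0" by (rule lift_cong[OF assms(1)]) (use assms(2) in simp)
  moreover have "cut S (zmul 1 v) = cut S 0"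
    unfolding cut_eq_iff using assms(2) by (simp add: z_lattice_iff)
  ultimately show ?thesis using assms(1) by (simp add: phi_def lift_0)
qed

lemma phi_cong:
  assumes A: "A \<in> End_D \<sigma> S" and vw: "v - w \<in> z_lattice S"
  shows "phi A v = phi A w"
proof -
  have "lift S A v = lift S A w" by (rule lift_cong[OF A vw])
  moreover have "cut S (zmul 1 v) = cut S (zmul 1 w)"
    unfolding cut_eq_iff using vw by (simp add: z_lattice_iff)
  ultimately show ?thesis by (simp add: phi_def)
qed

text \<open>\<open>e_D S k j\<close> is the class of \<open>z^(S-k)\<close> in component
  \<open>j\<close>, and \<open>block \<sigma> S i\<close> is \<open>\<sigma> i + S\<close>; hence
  \<open>k > block \<sigma> S i\<close> says that the exponent \<open>S - k\<close> is less than
  \<open>- \<sigma> i\<close>. For blocks of size 0 the coefficient vanishes by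
  \<open>U_top\<close>.\<close>

lemma T_zbar_iff: "A \<in> T_zbar \<sigma> S \<longleftrightarrow> slice_op A"
proof
  assume "A \<in> T_zbar \<sigma> S"
  then obtain g where g: "g \<in> slice_directions \<sigma> S"
    and A: "A = (\<lambda>X\<in>D_space \<sigma> S. z_bar \<sigma> S X + g X)" by (auto simp: T_zbar_def)
  have gE: "g \<in> End_D \<sigma> S" using g by (simp add: slice_directions_def)
  have gU: "cut S (lift S g v) = lift S g v \<and> lift S g v \<in> U_top \<sigma> S" if v: "v \<in> std_lattice \<sigma>" for v
  proof -
    have "g (cls S v) \<in> cls S ` U_top \<sigma> S" using g v by (auto simp: slice_directions_def)
    then obtain u where u: "u \<in> U_top \<sigma> S" "g (cls S v) = cls S u" by blast
    then have "lift S g v = u" using U_top_core[OF u(1)] by (simp add: lift_def cut_core_id)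
    then show ?thesis using u U_top_core[OF u(1)] by (simp add: cut_core_id)
  qed
  have Acls: "A (cls S v) = cls S (zmul 1 v + lift S g v)" if "v \<in> std_lattice \<sigma>" for v
    using that by (simp add: A z_bar_cls cls_plus flip: cls_lift[OF gE])
  have AE: "A \<in> End_D \<sigma> S"
    using Acls
  proof (rule End_D_I)
    show "A \<in> extensional (D_space \<sigma> S)" by (simp add: A)
  qed (auto simp: lift_add[OF gE] lift_cmul[OF gE] zmul_add zmul_cmul std_add std_z lift_std[OF gE]
      z_lattice_iff algebra_simps)
  have phi: "phi A v = lift S g v" if v: "v \<in> std_lattice \<sigma>" for v
    using Acls[OF v] gU[OF v] by (simp add: phi_def lift_def filt_add)
  have "coef (lift S g (mon j n)) i (- \<sigma> i) = 0" if jn: "(j, n) \<in> J" "n < - \<sigma> i" for i j n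
  proof (cases "block \<sigma> S i = 0")
    case True
    have "lift S g (mon j n) \<in> U_top \<sigma> S" using gU mon_std jn by simp
    then have "lift S g (mon j n) $ i = 0" using True by (simp add: U_top_def)
    then show ?thesis by (simp add: coef_def)
  next
    case False
    define k where "k = nat (S - n)"
    have k: "n = S - int k" "1 \<le> k" using jn by (auto simp: k_def)
    have "int k \<le> int (block \<sigma> S j)" "int (block \<sigma> S i) < int k"
      unfolding block_eq using jn by (simp_all add: k_def)
    then have "D_coeff S (block \<sigma> S i) i (g (e_D S k j)) = 0"
      using g False k(2) by (simp add: slice_directions_def)
    moreover have "g (e_D S k j) = cls S (lift S g (mon j n))"
      using cls_lift[OF gE mon_std] jn by (simp add: e_D_mon k(1))
    ultimately show ?thesis using False
      by (simp add: D_coeff_cls block_eq)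
  qed
  then show "slice_op A" using AE gU phi mon_std by (auto simp: slice_op_def)
next
  assume op: "slice_op A"
  then have AE: "A \<in> End_D \<sigma> S" by (simp add: slice_op_def)
  define g where "g = (\<lambda>X\<in>D_space \<sigma> S. cls S (phi A (rep S X)))"
  have U: "phi A v \<in> U_top \<sigma> S" if "v \<in> std_lattice \<sigma>" for v
    using op that by (simp add: slice_op_def)
  have g: "g (cls S v) = cls S (phi A v)" if "v \<in> std_lattice \<sigma>" for v
    using that phi_cong[OF AE diff_cut_in(2)] by (simp add: g_def)
  have gE: "g \<in> End_D \<sigma> S"
    using g
  proof (rule End_D_I)
    show "g \<in> extensional (D_space \<sigma> S)" by (simp add: g_def)
  qed (auto simp: phi_add[OF AE] phi_cmul[OF AE] U U_top_core core_subset z_lattice_iff)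
  have "D_coeff S (block \<sigma> S i) i (g (e_D S k j)) = 0"
    if k: "1 \<le> block \<sigma> S i" "1 \<le> k" "k \<le> block \<sigma> S j" "k > block \<sigma> S i" for i j k
  proof -
    have "int k \<le> int (block \<sigma> S j)" "int (block \<sigma> S i) < int k" using k by auto
    then have jn: "(j, S - int k) \<in> J" "S - int k < - \<sigma> i"
      unfolding block_eq using k(2) by auto
    then have "coef (phi A (mon j (S - int k))) i (- \<sigma> i) = 0" using op by (simp add: slice_op_def)
    moreover have "g (e_D S k j) = cls S (phi A (mon j (S - int k)))"
      using jn by (simp add: e_D_mon g mon_std)
    ultimately show ?thesis using k(1) by (simp add: D_coeff_cls block_eq)
  qed
  moreover have "g ` D_space \<sigma> S \<subseteq> cls S ` U_top \<sigma> S"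
  proof
    fix Y assume "Y \<in> g ` D_space \<sigma> S"
    then obtain v where "v \<in> std_lattice \<sigma>" "Y = g (cls S v)" by (auto simp: D_space_def)
    then show "Y \<in> cls S ` U_top \<sigma> S" using U g by auto
  qed
  ultimately have gd: "g \<in> slice_directions \<sigma> S" using gE by (simp add: slice_directions_def)
  have "A = (\<lambda>X\<in>D_space \<sigma> S. z_bar \<sigma> S X + g X)"
  proof (rule D_extensional_eqI)
    show "A \<in> extensional (D_space \<sigma> S)" using AE by (simp add: End_D_def PiE_def)
    fix v assume v: "v \<in> std_lattice \<sigma>"
    have "zmul 1 v + phi A v - lift S A v \<in> z_lattice S" by (simp add: phi_def)
    then show "A (cls S v) = (\<lambda>X\<in>D_space \<sigma> S. z_bar \<sigma> S X + g X) (cls S v)"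
      using v by (simp add: z_bar_cls cls_plus g cls_eq_iff flip: cls_lift[OF AE])
        (simp add: z_lattice_iff)
  qed simp
  then show "A \<in> T_zbar \<sigma> S" unfolding T_zbar_def using gd by blast
qed

text \<open>Unlike \<open>lift S A\<close> this operator is not truncated. The two agree modulo
  \<open>z_lattice S\<close>, and for \<open>A\<close> in \<open>End_D \<sigma> S\<close> it is
  multiplication by \<open>z\<close> on \<open>z_lattice S\<close>.\<close>

definition z_phi :: "('m lvec set \<Rightarrow> 'm lvec set) \<Rightarrow> 'm lvec \<Rightarrow> 'm lvec" where
  "z_phi A v = zmul 1 v + phi A v"

lemma slice_embed_eq:
  assumes A: "slice_op A"
  shows "slice_embed \<sigma> S A = (\<lambda>v\<in>std_lattice \<sigma>. z_phi A v)"
    and "slice_embed \<sigma> S A = z_plus \<sigma> (restrict (phi A) (std_lattice \<sigma>))"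
proof -
  have AE: "A \<in> End_D \<sigma> S" using A by (simp add: slice_op_def)
  have "(THE u. u \<in> U_top \<sigma> S \<and>
          cls S u = A (cls S v) + D_scale S (- 1) (z_bar \<sigma> S (cls S v))) = phi A v"
    if v: "v \<in> std_lattice \<sigma>" for v
  proof -
    have "A (cls S v) + D_scale S (- 1) (z_bar \<sigma> S (cls S v)) = cls S (lift S A v + cmul (- 1) (zmul 1 v))"
      using v by (simp add: z_bar_cls D_scale_cls cls_plus flip: cls_lift[OF AE])
    also have "\<dots> = cls S (phi A v)"
      by (simp add: cls_eq_iff phi_def z_lattice_iff)
    finally have eq: "A (cls S v) + D_scale S (- 1) (z_bar \<sigma> S (cls S v)) = cls S (phi A v)" .
    have U: "phi A v \<in> U_top \<sigma> S" using A v by (simp add: slice_op_def)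
    show ?thesis
      unfolding eq
    proof (rule the_equality)
      fix u assume u: "u \<in> U_top \<sigma> S \<and> cls S u = cls S (phi A v)"
      then have "cut S u = cut S (phi A v)" by (simp add: cls_eq_iff cut_eq_iff)
      then show "u = phi A v" using u U U_top_core by (simp add: cut_core_id)
    qed (use U in simp)
  qed
  then show "slice_embed \<sigma> S A = (\<lambda>v\<in>std_lattice \<sigma>. z_phi A v)"
      "slice_embed \<sigma> S A = z_plus \<sigma> (restrict (phi A) (std_lattice \<sigma>))"
    by (auto simp: slice_embed_def z_plus_def z_phi_def fun_eq_iff restrict_def)
qed

definition slice_nilp where
  "slice_nilp = T_zbar \<sigma> S \<inter> nilp_cone \<sigma> S"

text \<open>By \<open>psi_eq\<close> every exponent from \<open>nil_bound\<close> on gives the same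
  value for nilpotent slice operators: once a vector has reached \<open>z_lattice S\<close>, the
  operator \<open>z_phi A\<close> is just \<open>z\<close>.\<close>

definition psi :: "('m lvec set \<Rightarrow> 'm lvec set) \<Rightarrow> 'm lvec \<Rightarrow> 'm lvec" where
  "psi A v = zmul (- int nil_bound) ((z_phi A ^^ nil_bound) v)"

text \<open>On nilpotent \<open>A\<close>, the map \<^term>\<open>jet A\<close> is the homomorphism of \<open>\<complex>[z]\<close>-modules from \<open>(\<D>, A)\<close> to
  \<open>U((z))/z\<^sup>S U[[z]]\<close> induced by \<open>v \<mapsto>\<close> (coefficient of \<open>z\<^sup>S\<^sup>-\<^sup>1\<close> in \<open>v\<close>). It depends polynomially on \<open>A\<close>,
  does not need \<open>A\<close> to lie in the slice, and agrees with \<^term>\<open>psi A\<close> modulo \<open>z\<^sup>S U[[z]]\<close> if it does.\<close>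

definition jet :: "('m lvec set \<Rightarrow> 'm lvec set) \<Rightarrow> 'm lvec \<Rightarrow> 'm lvec" where
  "jet A v = (\<Sum>n<nil_bound. zmul (- int n) (filt (\<lambda>_ k. k = S - 1) ((lift S A ^^ n) v)))"

lemma nilp_End: "A \<in> nilp_cone \<sigma> S \<Longrightarrow> A \<in> End_D \<sigma> S"
  by (simp add: nilp_cone_def)

lemma coef_jet:
  assumes nil: "A \<in> nilp_cone \<sigma> S" and v: "v \<in> std_lattice \<sigma>"
  shows "coef (jet A v) i n = (if n < S then coef ((lift S A ^^ nat (S - 1 - n)) v) i (S - 1) else 0)"
proof -
  have "coef (jet A v) i n = (\<Sum>q<nil_bound. if n = S - 1 - int q then coef ((lift S A ^^ q) v) i (S - 1) else 0)"
    unfolding jet_def coef_sum coef_zmul coef_filt by (intro sum.cong) (auto simp: algebra_simps)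
  also have "\<dots> = (if n < S then coef ((lift S A ^^ nat (S - 1 - n)) v) i (S - 1) else 0)"
  proof (cases "n < S")
    case True
    then have n': "n = S - 1 - int q \<longleftrightarrow> q = nat (S - 1 - n)" for q by auto
    \<comment> \<open>Powers from \<open>nil_bound\<close> on vanish, so the finite sum loses
      nothing.\<close>
    show ?thesis unfolding n' using True nilp_lift_pow[OF nil v, of "nat (S - 1 - n)"]
      by (cases "nat (S - 1 - n) < nil_bound") auto
  qed (auto intro: sum.neutral)
  finally show ?thesis .
qed

context
  fixes A assumes op: "slice_op A"
begin

lemma op_End: "A \<in> End_D \<sigma> S"
  using op by (simp add: slice_op_def)

lemma op_U: "v \<in> std_lattice \<sigma> \<Longrightarrow> phi A v \<in> U_top \<sigma> S"
  using op by (simp add: slice_op_def)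

lemma z_phi_std: "v \<in> std_lattice \<sigma> \<Longrightarrow> z_phi A v \<in> std_lattice \<sigma>"
  unfolding z_phi_def by (intro std_add std_z core_subset[OF U_top_core[OF op_U]])

lemma z_phi_pow_std: "v \<in> std_lattice \<sigma> \<Longrightarrow> (z_phi A ^^ n) v \<in> std_lattice \<sigma>"
  by (induction n) (auto intro: z_phi_std)

lemma z_phi_pow_add: "v \<in> std_lattice \<sigma> \<Longrightarrow> w \<in> std_lattice \<sigma> \<Longrightarrow> (z_phi A ^^ n) (v + w) = (z_phi A ^^ n) v + (z_phi A ^^ n) w"
proof (induction n)
  case (Suc n)
  then show ?case
    using z_phi_pow_std[of v n] z_phi_pow_std[of w n]
    by (simp add: z_phi_def[of A "_ + _"] z_phi_def[of A "(z_phi A ^^ n) _"] phi_add[OF op_End] zmul_add)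
qed simp

lemma z_phi_pow_cmul: "v \<in> std_lattice \<sigma> \<Longrightarrow> (z_phi A ^^ n) (cmul c v) = cmul c ((z_phi A ^^ n) v)"
  by (induction n) (simp_all add: z_phi_def[of A "cmul _ _"] z_phi_def[of A "(z_phi A ^^ _) _"]
      phi_cmul[OF op_End] z_phi_pow_std zmul_cmul cv.scale_right_distrib)

lemma z_phi_pow_z_lattice:
  assumes v: "v \<in> z_lattice S" shows "(z_phi A ^^ n) v = zmul (int n) v"
proof (induction n)
  case (Suc n)
  have "zmul (int n) v \<in> z_lattice S" using v by (rule zmul_in_z_lattice) simp
  then show ?case by (simp add: Suc z_phi_def[of A "zmul _ _"] phi_z_lattice[OF op_End] add.commute)
qed simp

lemma z_phi_pow_lift_pow: "v \<in> std_lattice \<sigma> \<Longrightarrow> (z_phi A ^^ n) v - (lift S A ^^ n) v \<in> z_lattice S"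
proof (induction n)
  case (Suc n)
  let ?w = "(z_phi A ^^ n) v"
  have w: "?w \<in> std_lattice \<sigma>" using Suc.prems by (rule z_phi_pow_std)
  have "lift S A ((lift S A ^^ n) v) = lift S A ?w"
    using lift_cong[OF op_End Suc.IH[OF Suc.prems]] by simp
  moreover have "z_phi A ?w - lift S A ?w \<in> z_lattice S"
    by (simp add: z_phi_def phi_def)
  ultimately show ?case by simp
qed (simp add: z_lattice_iff)

text \<open>\<open>slice_op\<close> constrains the monomials of \<open>J\<close>. Expanding
  \<open>v\<close> in them gives the bound for all vectors, since \<open>phi A\<close> is blind to
  \<open>z_lattice S\<close>.\<close>

lemma phi_dle:
  assumes v: "v \<in> std_lattice \<sigma>" and d: "deg_le d v"
  shows "deg_le d (phi A v)"
  unfolding deg_le_def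
proof (intro allI impI)
  fix i n assume n: "d < n"
  have phv: "phi A v \<in> U_top \<sigma> S" using op_U[OF v] .
  show "coef (phi A v) i n = 0"
  proof (cases "n = - \<sigma> i")
    case True
    have eq: "phi A v = (\<Sum>p\<in>J. cmul (coef v (fst p) (snd p)) (phi A (mon (fst p) (snd p))))"
    proof -
      have "phi A w = (\<Sum>p\<in>J. cmul (coef w (fst p) (snd p)) (phi A (mon (fst p) (snd p))))"
        if w: "w \<in> core" for w
      proof -
        have "finite K \<Longrightarrow> K \<subseteq> J \<Longrightarrow> phi A (\<Sum>p\<in>K. cmul (c p) (mon (fst p) (snd p)))
            = (\<Sum>p\<in>K. cmul (c p) (phi A (mon (fst p) (snd p))))" for K c
        proof (induction K rule: finite_induct)
          case empty
          then show ?case by (simp add: phi_z_lattice[OF op_End] z_lattice_iff)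
        next
          case (insert p K)
          have "mon (fst p) (snd p) \<in> std_lattice \<sigma>" using insert.prems mon_std[of "fst p" "snd p"]
            by (cases p) simp
          moreover have "(\<Sum>p\<in>K. cmul (c p) (mon (fst p) (snd p))) \<in> std_lattice \<sigma>"
            using insert.prems by (intro cv.subspace_sum) (auto intro!: std_scale mon_std)
          ultimately show ?case
            using insert by (simp add: phi_add[OF op_End] phi_cmul[OF op_End] std_scale)
        qed
        note lin = this[OF finite_J order.refl]
        have "w = (\<Sum>p\<in>J. cmul (coef w (fst p) (snd p)) (mon (fst p) (snd p)))"
          using w finite_expansion[OF finite_J, of w] by (simp add: case_prod_unfold core_iff) blast
        then show ?thesis using lin by metis
      qed
      from this[OF cut_core[OF v]] phi_cong[OF op_End diff_cut_in(2)[of S v]]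
      have "phi A v = (\<Sum>p\<in>J. cmul (coef (cut S v) (fst p) (snd p)) (phi A (mon (fst p) (snd p))))"
        by simp
      also have "\<dots> = (\<Sum>p\<in>J. cmul (coef v (fst p) (snd p)) (phi A (mon (fst p) (snd p))))"
        by (intro sum.cong) auto
      finally show ?thesis .
    qed
    \<comment> \<open>At the exponent \<open>n = - \<sigma> i > d\<close>, lower monomials
      contribute nothing by the slice condition, and the others do not occur in
      \<open>v\<close>.\<close>
    have zero: "coef v (fst p) (snd p) * coef (phi A (mon (fst p) (snd p))) i n = 0" if p: "p \<in> J" for p
    proof (cases "snd p < - \<sigma> i")
      case True
      then have "coef (phi A (mon (fst p) (snd p))) i (- \<sigma> i) = 0"
        using op p by (cases p) (simp add: slice_op_def)
      then show ?thesis using \<open>n = - \<sigma> i\<close> by simp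
    next
      case False
      then show ?thesis using n \<open>n = - \<sigma> i\<close> d by (simp add: deg_le_def)
    qed
    show ?thesis unfolding eq by (simp add: zero)
  qed (use phv in \<open>simp add: U_top_iff\<close>)
qed

text \<open>\<open>z\<close> raises degrees by exactly one and \<open>phi A\<close> by none, so the
  leading term of \<open>v\<close> is merely shifted.\<close>

lemma z_phi_pow_dle:
  assumes v: "v \<in> std_lattice \<sigma>" and d: "deg_le d v"
  shows "deg_le (d + int p) ((z_phi A ^^ p) v) \<and> (\<forall>i. coef ((z_phi A ^^ p) v) i (d + int p) = coef v i d)"
proof (induction p)
  case (Suc p)
  have "deg_le (d + int p) (phi A ((z_phi A ^^ p) v))"
    using Suc v by (intro phi_dle z_phi_pow_std) auto
  then show ?case using Suc
    by (auto simp: z_phi_def[of A "(z_phi A ^^ p) v"] deg_le_def algebra_simps)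
qed (use d in simp)

text \<open>Each step adds a term \<open>z^(-p-1) \<phi>(..)\<close>. As \<open>\<phi>\<close> lives
  at the exponents \<open>- \<sigma> i < S\<close>, the shift by at least one puts the term into
  \<open>U_neg \<sigma>\<close> and below \<open>S - 1\<close>.\<close>

lemma z_phi_pow_U_neg:
  assumes v: "v \<in> std_lattice \<sigma>"
  shows "zmul (- int p) ((z_phi A ^^ p) v) - v \<in> U_neg \<sigma> \<and>
    (\<forall>i n. S - 1 \<le> n \<longrightarrow> coef (zmul (- int p) ((z_phi A ^^ p) v)) i n = coef v i n)"
proof (induction p)
  case (Suc p)
  let ?w = "(z_phi A ^^ p) v"
  have "phi A ?w \<in> U_top \<sigma> S" using v by (intro op_U z_phi_pow_std)
  then have "zmul (- int (Suc p)) (phi A ?w) \<in> U_neg \<sigma>"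
    and z: "\<forall>i n. S - 1 \<le> n \<longrightarrow> coef (zmul (- int (Suc p)) (phi A ?w)) i n = 0"
    by (auto simp: U_top_iff U_neg_iff)
  moreover have eq: "zmul (- int (Suc p)) ((z_phi A ^^ Suc p) v)
      = zmul (- int p) ?w + zmul (- int (Suc p)) (phi A ?w)"
    by (simp add: z_phi_def zmul_add)
  ultimately show ?case using Suc unfolding eq by (simp add: U_neg_iff)
qed (simp add: U_neg_iff)

end

context
  fixes A assumes AX: "A \<in> slice_nilp"
begin

lemma slice_nilp_slice_op: "slice_op A"
  using AX by (simp add: slice_nilp_def T_zbar_iff)

lemma slice_nilp_nilp_cone: "A \<in> nilp_cone \<sigma> S"
  using AX by (simp add: slice_nilp_def)

lemmas slice_nilp_End = op_End[OF slice_nilp_slice_op]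

lemma z_phi_pow_in:
  assumes v: "v \<in> std_lattice \<sigma>" and p: "nil_bound \<le> p" shows "(z_phi A ^^ p) v \<in> z_lattice S"
  using z_phi_pow_lift_pow[OF slice_nilp_slice_op v, of p] nilp_lift_pow[OF slice_nilp_nilp_cone v p] by simp

lemma psi_eq:
  assumes v: "v \<in> std_lattice \<sigma>" and p: "nil_bound \<le> p"
  shows "zmul (- int p) ((z_phi A ^^ p) v) = psi A v"
proof -
  obtain q where q: "p = q + nil_bound" using p by (metis add.commute le_Suc_ex)
  have "(z_phi A ^^ p) v = zmul (int q) ((z_phi A ^^ nil_bound) v)"
    unfolding q funpow_add using z_phi_pow_z_lattice[OF slice_nilp_slice_op z_phi_pow_in[OF v order.refl]] by simp
  then show ?thesis by (simp add: psi_def q)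
qed

text \<open>Computed with exponent \<open>nil_bound + 1\<close>, the value \<open>psi A v\<close> is
  \<open>1/z\<close> times \<open>psi A (z_phi A v)\<close>.\<close>

lemma psi_z_phi: "v \<in> std_lattice \<sigma> \<Longrightarrow> psi A (z_phi A v) = zmul 1 (psi A v)"
  using psi_eq[of v "Suc nil_bound"] by (simp add: psi_def funpow_swap1 zmul_zmul[symmetric] del: zmul_zmul)
    (metis (no_types, opaque_lifting) add.commute diff_add_cancel uminus_add_conv_diff zmul_zmul)

lemma psi_z_phi_pow: "v \<in> std_lattice \<sigma> \<Longrightarrow> psi A ((z_phi A ^^ n) v) = zmul (int n) (psi A v)"
  by (induction n) (simp_all add: psi_z_phi z_phi_pow_std[OF slice_nilp_slice_op] add.commute)

lemma psi_U_neg: "v \<in> std_lattice \<sigma> \<Longrightarrow> psi A v - v \<in> U_neg \<sigma>"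
  using z_phi_pow_U_neg[OF slice_nilp_slice_op] by (simp add: psi_def)

lemma psi_top: "v \<in> std_lattice \<sigma> \<Longrightarrow> S - 1 \<le> n \<Longrightarrow> coef (psi A v) i n = coef v i n"
  using z_phi_pow_U_neg[OF slice_nilp_slice_op] unfolding psi_def by blast

lemma psi_z_lattice: "v \<in> z_lattice S \<Longrightarrow> psi A v = v"
  by (simp add: psi_def z_phi_pow_z_lattice[OF slice_nilp_slice_op])

lemma psi_add: "v \<in> std_lattice \<sigma> \<Longrightarrow> w \<in> std_lattice \<sigma> \<Longrightarrow> psi A (v + w) = psi A v + psi A w"
  by (simp add: psi_def z_phi_pow_add[OF slice_nilp_slice_op] zmul_add)

lemma psi_cmul: "v \<in> std_lattice \<sigma> \<Longrightarrow> psi A (cmul c v) = cmul c (psi A v)"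
  by (simp add: psi_def z_phi_pow_cmul[OF slice_nilp_slice_op] zmul_cmul)

lemma psi_diff: "v \<in> std_lattice \<sigma> \<Longrightarrow> w \<in> std_lattice \<sigma> \<Longrightarrow> psi A (v - w) = psi A v - psi A w"
  using psi_add[of v "cmul (-1) w"] psi_cmul[of w "-1"] std_scale[of w "-1"]
  by (metis add_uminus_conv_diff cv.scale_minus_left cv.scale_one)

lemma psi_dle: "v \<in> std_lattice \<sigma> \<Longrightarrow> deg_le d v \<Longrightarrow> deg_le d (psi A v)"
  and psi_lead: "v \<in> std_lattice \<sigma> \<Longrightarrow> deg_le d v \<Longrightarrow> coef (psi A v) i d = coef v i d"
  using z_phi_pow_dle[OF slice_nilp_slice_op, of v d nil_bound] by (auto simp: psi_def deg_le_def)

lemma Psi0_S_eq: "Psi0_S \<sigma> S A = psi A ` std_lattice \<sigma>"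
proof -
  let ?B = "slice_embed \<sigma> S A"
  have B: "?B = (\<lambda>v\<in>std_lattice \<sigma>. z_phi A v)" by (rule slice_embed_eq[OF slice_nilp_slice_op])
  have Bp: "(?B ^^ n) v = (z_phi A ^^ n) v" if "v \<in> std_lattice \<sigma>" for v n
    using that by (induction n) (auto simp: B z_phi_pow_std[OF slice_nilp_slice_op])
  have "v + (\<Sum>k | 1 \<le> k \<and> ?B ((?B ^^ (k - 1)) v) - zmul 1 ((?B ^^ (k - 1)) v) \<noteq> 0.
      zmul (- int k) (?B ((?B ^^ (k - 1)) v) - zmul 1 ((?B ^^ (k - 1)) v))) = psi A v"
    if v: "v \<in> std_lattice \<sigma>" for v
  proof -
    define f where "f k = phi A ((z_phi A ^^ (k - 1)) v)" for k
    have f: "?B ((?B ^^ (k - 1)) v) - zmul 1 ((?B ^^ (k - 1)) v) = f k" for k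
      using v by (simp add: Bp f_def) (simp add: B z_phi_pow_std[OF slice_nilp_slice_op] z_phi_def)
    \<comment> \<open>\<open>Psi0\<close> sums over all indices with nonzero term, and a sum over an
      infinite set would be 0 by default; finiteness therefore comes first.\<close>
    have "f k = 0" if "nil_bound < k" for k
      unfolding f_def using that v by (intro phi_z_lattice[OF slice_nilp_End] z_phi_pow_in) auto
    then have sub: "{k. 1 \<le> k \<and> f k \<noteq> 0} \<subseteq> {1..nil_bound}" by (auto simp flip: not_less)
    have "(\<Sum>k | 1 \<le> k \<and> f k \<noteq> 0. zmul (- int k) (f k)) = (\<Sum>k=1..nil_bound. zmul (- int k) (f k))"
      using sub by (intro sum.mono_neutral_left) auto
    moreover have "v + (\<Sum>k=1..p. zmul (- int k) (f k)) = zmul (- int p) ((z_phi A ^^ p) v)" for p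
    proof (induction p)
      case (Suc p)
      have "v + (\<Sum>k=1..Suc p. zmul (- int k) (f k))
          = zmul (- int p) ((z_phi A ^^ p) v) + zmul (- int (Suc p)) (f (Suc p))"
        using Suc by (simp add: add.assoc[symmetric])
      also have "\<dots> = zmul (- int (Suc p)) ((z_phi A ^^ Suc p) v)"
        by (simp add: f_def z_phi_def zmul_add)
      finally show ?case .
    qed simp
    ultimately show ?thesis unfolding f by (simp add: psi_def)
  qed
  then show ?thesis
    unfolding Psi0_S_def Psi0_def Let_def by (intro image_cong) auto
qed

text \<open>\<open>psi_z_phi_pow\<close> moves the exponent up to \<open>S - 1\<close>, where
  \<open>psi_top\<close> makes \<open>psi A\<close> invisible; at that exponent
  \<open>z_phi A\<close> and \<open>lift S A\<close> have the same powers.\<close>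

lemma jet_eq_cut_psi:
  assumes v: "v \<in> std_lattice \<sigma>" shows "jet A v = cut S (psi A v)"
proof (rule lvec_eqI)
  fix i n
  show "coef (jet A v) i n = coef (cut S (psi A v)) i n"
  proof (cases "n < S")
    case True
    define q where "q = nat (S - 1 - n)"
    have n: "n = S - 1 - int q" using True by (simp add: q_def)
    have "coef (psi A v) i n = coef (zmul (int q) (psi A v)) i (S - 1)"
      using n by simp
    also have "\<dots> = coef ((z_phi A ^^ q) v) i (S - 1)"
      using v by (simp add: psi_top z_phi_pow_std[OF slice_nilp_slice_op] flip: psi_z_phi_pow del: coef_zmul)
    also have "\<dots> = coef ((lift S A ^^ q) v) i (S - 1)"
      using z_phi_pow_lift_pow[OF slice_nilp_slice_op v, of q] by (simp add: z_lattice_iff)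
    finally show ?thesis using True by (simp add: coef_jet[OF slice_nilp_nilp_cone v] q_def)
  qed (simp add: coef_jet[OF slice_nilp_nilp_cone v])
qed

lemma slice_embed_in: "slice_embed \<sigma> S A \<in> T_z \<sigma> \<inter> N_z \<sigma>"
proof -
  let ?f = "restrict (phi A) (std_lattice \<sigma>)"
  have "?f \<in> Hom_LU \<sigma>"
    unfolding Hom_LU_def clinear_maps_def
    using op_U[OF slice_nilp_slice_op] z_lattice_in_loop_Gr[of S] sub_std
    by (auto simp: U_top_def std_add std_scale phi_add[OF slice_nilp_End] phi_cmul[OF slice_nilp_End]
        phi_z_lattice[OF slice_nilp_End] subset_iff intro!: bexI[of _ "z_lattice S"])
  then have "slice_embed \<sigma> S A \<in> T_z \<sigma>"
    unfolding T_z_def slice_embed_eq(2)[OF slice_nilp_slice_op] by blast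
  moreover have "slice_embed \<sigma> S A \<in> N_z \<sigma>"
  proof -
    let ?B = "slice_embed \<sigma> S A"
    have B: "?B = (\<lambda>v\<in>std_lattice \<sigma>. z_phi A v)" by (rule slice_embed_eq[OF slice_nilp_slice_op])
    have Bp: "(?B ^^ n) v = (z_phi A ^^ n) v" if "v \<in> std_lattice \<sigma>" for v n
      using that by (induction n) (auto simp: B z_phi_pow_std[OF slice_nilp_slice_op])
    have "?B \<in> clinear_maps (std_lattice \<sigma>) (std_lattice \<sigma>)"
      unfolding clinear_maps_def B
      using z_phi_pow_add[OF slice_nilp_slice_op, of _ _ 1] z_phi_pow_cmul[OF slice_nilp_slice_op, of _ 1]
      by (auto simp: z_phi_std[OF slice_nilp_slice_op] std_add std_scale)
    moreover have "\<forall>v\<in>z_lattice S. ?B v = zmul 1 v"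
      using sub_std by (auto simp: B z_phi_def phi_z_lattice[OF slice_nilp_End])
    moreover have "\<forall>v\<in>std_lattice \<sigma>. (?B ^^ nil_bound) v \<in> z_lattice S"
      using z_phi_pow_in by (simp add: Bp)
    ultimately show ?thesis
      unfolding N_z_def using z_lattice_in_loop_Gr[of S] sub_std by blast
  qed
  ultimately show ?thesis by blast
qed

end

end

section \<open>The bijection between nilpotent operators and lattices\<close>

lemma mult_vec_axis: "A *v (\<chi> k. B $ k $ j) = (\<chi> k. (A ** B) $ k $ j)"
  for A :: "complex fls ^ 'm::finite ^ 'm"
  by (simp add: matrix_vector_mult_def matrix_matrix_mult_def)

lemma matrix_vector_mul_sum: "A *v sum f I = (\<Sum>i\<in>I. A *v f i)"
  for A :: "complex fls ^ 'm::finite ^ 'm"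
  by (induction I rule: infinite_finite_induct) (simp_all add: matrix_vector_mul_add)

lemma mon_eq_axis: "mon j n = zmul n (axis j 1)"
proof -
  have "mon j 0 = axis j 1" by (simp add: mon_def)
  then show ?thesis by (metis add_0 zmul_mon)
qed

lemma loop_Gr_upper_bound:
  assumes "L \<in> loop_Gr" obtains N where "L \<subseteq> z_lattice (- N)"
proof -
  obtain A :: "complex fls ^ 'a ^ 'a" where L: "L = (\<lambda>v. A *v v) ` std_lattice (\<lambda>_. 0)"
    using assms by (auto simp: loop_Gr_def)
  obtain M where M: "\<And>k v. v \<in> z_lattice k \<Longrightarrow> A *v v \<in> z_lattice (k - M)"
    using matrix_z_lattice_bound by blast
  have "L \<subseteq> z_lattice (- M)"
    unfolding L using M[of _ 0] z_lattice_eq_std[of 0] by auto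
  then show ?thesis by (rule that)
qed

context slice_setup
begin

context
  fixes A assumes AX: "A \<in> slice_nilp"
begin

lemma zsub_psi_image: "zsub (psi A ` std_lattice \<sigma>)"
  unfolding zsub_def cv.subspace_def
proof (intro conjI ballI allI)
  show "0 \<in> psi A ` std_lattice \<sigma>"
    using psi_z_lattice[OF AX, of 0] by (force simp: z_lattice_iff std_lattice_iff)
  fix x y c
  assume "x \<in> psi A ` std_lattice \<sigma>"
  then obtain v where v: "v \<in> std_lattice \<sigma>" "x = psi A v" by blast
  show "cmul c x \<in> psi A ` std_lattice \<sigma>"
    using v std_scale[of v c] by (auto simp flip: psi_cmul[OF AX])
  show "zmul 1 x \<in> psi A ` std_lattice \<sigma>"
    using v z_phi_std[OF slice_nilp_slice_op[OF AX] v(1)] by (auto simp flip: psi_z_phi[OF AX])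
  assume "y \<in> psi A ` std_lattice \<sigma>"
  then obtain w where w: "w \<in> std_lattice \<sigma>" "y = psi A w" by blast
  show "x + y \<in> psi A ` std_lattice \<sigma>"
    using v w std_add[of v w] by (auto simp flip: psi_add[OF AX])
qed

lemma z_lattice_subset_psi_image: "z_lattice S \<subseteq> psi A ` std_lattice \<sigma>"
proof
  fix v :: "'m lvec" assume v: "v \<in> z_lattice S"
  then have "v = psi A v" by (simp add: psi_z_lattice[OF AX])
  then show "v \<in> psi A ` std_lattice \<sigma>" using v sub_std by blast
qed

text \<open>The columns of the group element are \<open>z\<^sup>\<sigma>\<^sup>j g(z\<^sup>-\<^sup>\<sigma>\<^sup>j e\<^sub>j)\<close>. Since \<^term>\<open>psi A\<close> and this matrix
  preserve leading terms, induction on the degree shows that they have the same image on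
  polynomial vectors, whence the matrix is invertible over polynomials in \<open>z\<^sup>-\<^sup>1\<close>.\<close>

lemma psi_image_in_slice: "psi A ` std_lattice \<sigma> \<in> slice \<sigma>"
proof -
  let ?L = "psi A ` std_lattice \<sigma>"
  define B :: "complex fls ^ 'm ^ 'm" where
    "B = (\<chi> i j. zmul (\<sigma> j) (psi A (mon j (- \<sigma> j))) $ i)"
  have Bax: "B *v axis j 1 = zmul (\<sigma> j) (psi A (mon j (- \<sigma> j)))" for j
    by (simp add: lvec_eq_iff matrix_vector_mult_def axis_def B_def if_distrib cong: if_cong)
  have lead: "deg_le (- \<sigma> j) (psi A (mon j (- \<sigma> j)))"
      "coef (psi A (mon j (- \<sigma> j))) i (- \<sigma> j) = coef (mon j (- \<sigma> j)) i (- \<sigma> j)" for i j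
    by (rule psi_dle[OF AX mon_std[OF order.refl] deg_le_mon])
      (rule psi_lead[OF AX mon_std[OF order.refl] deg_le_mon])
  have unip: "neg_unip B"
    unfolding neg_unip_def
  proof (intro allI conjI)
    fix i j
    have "fls_nth (B $ i $ j) n = coef (psi A (mon j (- \<sigma> j))) i (n - \<sigma> j)" for n
      unfolding B_def by (simp flip: coef_def)
    then show "B $ i $ j \<in> inv_polys" "fls_nth (B $ i $ j) 0 = (if i = j then 1 else 0)"
      using lead(1)[of j] lead(2)[of j i] by (auto simp: inv_polys_def deg_le_def coef_mon)
  qed
  have Bstd: "B *v v \<in> ?L" if v: "v \<in> std_lattice \<sigma>" for v
  proof -
    have "v $ j *s (B *v axis j 1) \<in> ?L" for j
    proof -
      have "fls_shift (- \<sigma> j) (v $ j) \<in> power_series"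
        using v by (simp add: power_series_iff std_lattice_iff coef_def)
      then have "fls_shift (- \<sigma> j) (v $ j) *s psi A (mon j (- \<sigma> j)) \<in> ?L"
        by (rule zsub_power_series_smult[OF zsub_psi_image z_lattice_subset_psi_image])
          (intro imageI mon_std order.refl)
      moreover have "v $ j *s (B *v axis j 1) = fls_shift (- \<sigma> j) (v $ j) *s psi A (mon j (- \<sigma> j))"
        unfolding Bax by (simp add: zmul_def fls_shifted_times_simps)
      ultimately show ?thesis by simp
    qed
    then show ?thesis
      using zsub_psi_image unfolding matrix_vector_sum_columns[of B v] zsub_def
      by (intro cv.subspace_sum) auto
  qed
  define c where "c = Min (range (\<lambda>i. - \<sigma> i)) - 1"
  have c: "c < - \<sigma> i" for i
    unfolding c_def by (smt (verit) Min_le finite_class.finite_UNIV finite_imageI rangeI)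
  have poly: "w \<in> std_lattice \<sigma> \<Longrightarrow> deg_le (c + int k) w \<Longrightarrow>
      \<exists>u\<in>std_lattice \<sigma>. deg_le (c + int k) u \<and> psi A w = B *v u" for k w
  proof (induction k arbitrary: w)
    case 0
    then have "coef w i n = 0" for i n
      using c[of i] by (cases "n < - \<sigma> i") (auto simp: std_lattice_iff deg_le_def)
    then have "w = 0" by (intro lvec_eqI) simp
    then show ?case
      using psi_z_lattice[OF AX, of 0]
      by (intro bexI[of _ 0]) (auto simp: z_lattice_iff std_lattice_iff deg_le_def)
  next
    case (Suc k)
    let ?d = "c + int (Suc k)"
    define u where "u = filt (\<lambda>i n. n = ?d) w"
    have u: "u \<in> std_lattice \<sigma>" "deg_le ?d u"
      using Suc.prems by (auto simp: u_def std_lattice_iff deg_le_def)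
    \<comment> \<open>\<open>psi A w\<close> and \<open>B *v u\<close> have the same leading term,
      so subtracting \<open>x\<close> lowers the degree.\<close>
    obtain x where x: "x \<in> std_lattice \<sigma>" "B *v u = psi A x" using Bstd[OF u(1)] by blast
    have wx: "w - x \<in> std_lattice \<sigma>" using Suc.prems x by (auto simp: std_lattice_iff)
    have gd: "psi A (w - x) = psi A w - B *v u"
      using x Suc.prems by (simp add: psi_diff[OF AX])
    note lB = neg_unip_lead[OF unip u(2)]
    have "deg_le ?d (psi A (w - x))"
      unfolding gd using psi_dle[OF AX Suc.prems] lB(1) by (rule deg_le_diff)
    moreover have "coef (psi A (w - x)) i ?d = 0" for i
      unfolding gd using psi_lead[OF AX Suc.prems, of i] lB(2)[of i] by (simp add: u_def)
    ultimately have d1: "deg_le (?d - 1) (psi A (w - x))" by (rule deg_le_decrease)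
    \<comment> \<open>The drop of degree passes from \<open>psi A (w - x)\<close> back to
      \<open>w - x\<close>, because the two agree at all exponents occurring in
      \<open>L_\<sigma>\<close>.\<close>
    have "coef (w - x) i n = 0" if "?d - 1 < n" for i n
    proof (cases "n < - \<sigma> i")
      case False
      then have "coef (w - x) i n = coef (psi A (w - x)) i n"
        using psi_U_neg[OF AX wx] by (simp add: U_neg_iff)
      then show ?thesis using d1 that by (simp add: deg_le_def)
    qed (use wx in \<open>simp add: std_lattice_iff\<close>)
    then have "deg_le (c + int k) (w - x)" by (simp add: deg_le_def)
    from Suc.IH[OF wx this] obtain y where
      y: "y \<in> std_lattice \<sigma>" "deg_le (c + int k) y" "psi A (w - x) = B *v y" by blast
    have "psi A w = B *v (u + y)" using gd y(3) by (simp add: matrix_vector_mul_add)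
    moreover have "deg_le ?d (u + y)" using u(2) y(2) by (intro deg_le_add) (auto simp: deg_le_def)
    ultimately show ?case using u y std_add by blast
  qed
  have poly': "\<exists>u\<in>std_lattice \<sigma>. deg_le d u \<and> psi A w = B *v u" if "w \<in> std_lattice \<sigma>" "deg_le d w" for d w
  proof (cases "c \<le> d")
    case True
    then have "d = c + int (nat (d - c))" by simp
    then show ?thesis using poly that by metis
  next
    case False
    then have "coef w i n = 0" for i n
      using c[of i] that by (cases "n < - \<sigma> i") (auto simp: std_lattice_iff deg_le_def)
    then have "w = 0" by (intro lvec_eqI) simp
    then show ?thesis
      using psi_z_lattice[OF AX, of 0]
      by (intro bexI[of _ 0]) (auto simp: z_lattice_iff std_lattice_iff deg_le_def)
  qed
  \<comment> \<open>\<open>psi A\<close> fixes the vectors \<open>z^S e_j\<close>, which therefore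
    have preimages of degree at most \<open>S\<close> under \<open>B\<close>. Shifted by
    \<open>z^(-S)\<close> these become the columns of the inverse, with entries polynomial in
    \<open>1/z\<close>.\<close>
  have "\<exists>p. p \<in> std_lattice \<sigma> \<and> deg_le S p \<and> mon j S = B *v p" for j
  proof -
    have "mon j S \<in> z_lattice S" by (auto simp: z_lattice_iff coef_mon)
    then show ?thesis
      using poly'[of "mon j S" S] sub_std psi_z_lattice[OF AX, of "mon j S"] by auto
  qed
  then obtain p where p: "p j \<in> std_lattice \<sigma>" "deg_le S (p j)" "mon j S = B *v p j" for j by metis
  \<comment> \<open>\<open>poly'\<close> needs a degree bound. The part of \<open>v\<close> from
    \<open>z^S\<close> on is a power series combination of the vectors
    \<open>z^S e_j = B *v p j\<close>.\<close>
  have img: "psi A v \<in> (\<lambda>v. B *v v) ` std_lattice \<sigma>" if v: "v \<in> std_lattice \<sigma>" for v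
  proof -
    let ?r = "v - cut S v"
    have c: "cut S v \<in> std_lattice \<sigma>" "deg_le S (cut S v)"
      using v by (auto simp: std_lattice_iff deg_le_def)
    obtain u where u: "u \<in> std_lattice \<sigma>" "psi A (cut S v) = B *v u" using poly'[OF c] by blast
    let ?q = "\<lambda>j. fls_shift S (?r $ j) *s p j"
    have rq: "?r $ j *s axis j 1 = B *v ?q j" for j
    proof -
      have "B *v ?q j = fls_shift S (?r $ j) *s mon j S"
        by (simp only: p(3) vector_scalar_commute)
      then show ?thesis
        by (simp add: mon_eq_axis zmul_def fls_shifted_times_simps)
    qed
    have "?r = (\<Sum>j\<in>UNIV. ?r $ j *s axis j 1)"
      using matrix_vector_sum_columns[of "Finite_Cartesian_Product.mat 1" ?r]
      by (simp only: matrix_vector_mul_lid)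
    also have "\<dots> = (\<Sum>j\<in>UNIV. B *v ?q j)" by (simp only: rq)
    finally have r: "?r = B *v (\<Sum>j\<in>UNIV. ?q j)"
      by (simp only: matrix_vector_mul_sum)
    have "fls_shift S (?r $ j) \<in> power_series" for j
      using diff_cut_in(1)[of v S] by (simp add: z_lattice_iff power_series_iff coef_def)
    then have q: "(\<Sum>j\<in>UNIV. ?q j) \<in> std_lattice \<sigma>"
      by (intro cv.subspace_sum[OF subspace_std_lattice]
          zsub_power_series_smult[OF zsub_std_lattice sub_std] p(1))
    have "?r \<in> std_lattice \<sigma>" using diff_cut_in(1)[of v S] sub_std by blast
    then have "psi A v = psi A (cut S v) + psi A ?r"
      using psi_add[OF AX c(1), of ?r] by simp
    also have "\<dots> = B *v (u + (\<Sum>j\<in>UNIV. ?q j))"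
      by (simp only: psi_z_lattice[OF AX diff_cut_in(1)[of v S]] u(2) matrix_vector_mul_add r[symmetric])
    finally show ?thesis using std_add[OF u(1) q] by blast
  qed
  define C :: "complex fls ^ 'm ^ 'm" where "C = (\<chi> i j. zmul (- S) (p j) $ i)"
  have "B *v (\<chi> k. C $ k $ j) = axis j 1" for j
  proof -
    have "(\<chi> k. C $ k $ j) = zmul (- S) (p j)" by (simp add: C_def lvec_eq_iff)
    then have "B *v (\<chi> k. C $ k $ j) = zmul (- S) (mon j S)"
      by (simp only: p(3) matrix_vector_mul_zmul)
    then show ?thesis by (simp add: mon_eq_axis)
  qed
  then have "(\<chi> k. (B ** C) $ k $ j) = axis j 1" for j
    unfolding mult_vec_axis .
  then have "(\<chi> k. (B ** C) $ k $ j) $ i = axis j 1 $ i" for i j by simp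
  then have BC: "B ** C = Finite_Cartesian_Product.mat 1"
    by (simp add: lvec_eq_iff Finite_Cartesian_Product.mat_def axis_def)
  then have CB: "C ** B = Finite_Cartesian_Product.mat 1"
    using matrix_left_right_inverse by blast
  have "C $ i $ j \<in> inv_polys" for i j
  proof -
    have "fls_nth (C $ i $ j) n = coef (p j) i (n + S)" for n
      unfolding C_def by (simp flip: coef_def)
    then show ?thesis using p(2)[of j] by (simp add: inv_polys_def deg_le_def)
  qed
  then have "B \<in> neg_loop_group"
    using unip BC CB by (auto simp: neg_loop_group_def GL_over_def neg_unip_def)
  moreover have "?L = (\<lambda>v. B *v v) ` std_lattice \<sigma>"
    using img Bstd by blast
  ultimately show ?thesis by (auto simp: slice_def)
qed

lemma psi_eq_hlift:
  assumes "v \<in> std_lattice \<sigma>" shows "hlift \<sigma> (psi A ` std_lattice \<sigma>) v = psi A v"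
  using psi_image_in_slice slice_subset_Gr_chart assms
  by (intro hlift_eqI psi_U_neg[OF AX]) auto

end

definition slice_lattices where
  "slice_lattices = {L \<in> slice \<sigma>. z_lattice S \<subseteq> L}"

abbreviation pr :: "'m lvec \<Rightarrow> 'm lvec" where
  "pr \<equiv> filt (\<lambda>i n. - \<sigma> i \<le> n)"

text \<open>The operator \<open>h^(-1) z h\<close> on cosets, with \<open>pr\<close> as inverse of
  \<open>hlift \<sigma> L\<close> on \<open>L\<close>. It is wanted for chart lattices outside the
  slice too, since lattices near a slice lattice may be such.\<close>

definition Phi :: "'m lvec set \<Rightarrow> 'm lvec set \<Rightarrow> 'm lvec set" where
  "Phi L = (\<lambda>X\<in>D_space \<sigma> S. cls S (pr (zmul 1 (hlift \<sigma> L (rep S X)))))"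

lemma pr_std: "pr v \<in> std_lattice \<sigma>"
  by (simp add: std_lattice_iff)

lemma Psi0_S_in_slice_lattices: "A \<in> slice_nilp \<Longrightarrow> Psi0_S \<sigma> S A \<in> slice_lattices"
  by (simp add: slice_lattices_def Psi0_S_eq psi_image_in_slice z_lattice_subset_psi_image)

context
  fixes L :: "'m lvec set"
  assumes chart: "L \<in> Gr_chart \<sigma>" and zL: "z_lattice S \<subseteq> L"
begin

lemma hlift_z_lattice: "v \<in> z_lattice S \<Longrightarrow> hlift \<sigma> L v = v"
  using zL by (intro hlift_id[OF chart]) auto

lemma hlift_cong_z: "v - w \<in> z_lattice S \<Longrightarrow> hlift \<sigma> L v - hlift \<sigma> L w \<in> z_lattice S"
  using hlift_add[OF chart, of "v - w" w] hlift_z_lattice[of "v - w"] by simp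

lemma hlift_pr: "w \<in> L \<Longrightarrow> hlift \<sigma> L (pr w) = w"
  by (intro hlift_eqI[OF chart]) (auto simp: U_neg_iff)

lemma Phi_cls:
  assumes "v \<in> std_lattice \<sigma>"
  shows "Phi L (cls S v) = cls S (pr (zmul 1 (hlift \<sigma> L v)))"
  using hlift_cong_z[OF diff_cut_in(2)[of S v]] assms
  by (simp add: Phi_def cls_eq_iff) (simp add: z_lattice_iff)

lemma Phi_End: "Phi L \<in> End_D \<sigma> S"
  using Phi_cls
proof (rule End_D_I)
  show "Phi L \<in> extensional (D_space \<sigma> S)" by (simp add: Phi_def)
qed (auto simp: pr_std hlift_add[OF chart] hlift_cmul[OF chart] filt_add filt_cmul zmul_add zmul_cmul
    z_lattice_iff)

lemma lift_Phi: "v \<in> std_lattice \<sigma> \<Longrightarrow> lift S (Phi L) v = cut S (pr (zmul 1 (hlift \<sigma> L v)))"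
  by (simp add: lift_def Phi_cls)

text \<open>Only a congruence, since \<open>lift\<close> truncates after every step.\<close>

lemma hlift_lift_Phi_pow:
  "v \<in> std_lattice \<sigma> \<Longrightarrow> hlift \<sigma> L ((lift S (Phi L) ^^ n) v) - zmul (int n) (hlift \<sigma> L v) \<in> z_lattice S"
proof (induction n)
  case (Suc n)
  let ?w = "(lift S (Phi L) ^^ n) v"
  have w: "?w \<in> std_lattice \<sigma>" using Suc.prems by (rule lift_pow_std[OF Phi_End])
  have hz: "zmul 1 (hlift \<sigma> L ?w) \<in> L"
    using hlift_in[OF chart] chart_zsub[OF chart] by (simp add: zsub_def)
  have "hlift \<sigma> L (lift S (Phi L) ?w) - hlift \<sigma> L (pr (zmul 1 (hlift \<sigma> L ?w))) \<in> z_lattice S"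
    unfolding lift_Phi[OF w] by (intro hlift_cong_z diff_cut_in)
  then have "hlift \<sigma> L (lift S (Phi L) ?w) - zmul 1 (hlift \<sigma> L ?w) \<in> z_lattice S"
    unfolding hlift_pr[OF hz] .
  moreover have "zmul 1 (hlift \<sigma> L ?w - zmul (int n) (hlift \<sigma> L v)) \<in> z_lattice S"
    using Suc by (intro zmul_in_z_lattice[of _ S]) auto
  ultimately show ?case
    by (simp add: zmul_diff z_lattice_iff)
qed (simp add: z_lattice_iff)

lemma Phi_nilp: "Phi L \<in> nilp_cone \<sigma> S"
proof -
  have "L \<in> loop_Gr" using chart by (simp add: Gr_chart_def)
  then obtain N where N: "L \<subseteq> z_lattice (- N)" by (rule loop_Gr_upper_bound)
  \<comment> \<open>Multiplication by \<open>z^(S+N)\<close> moves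
    \<open>L \<subseteq> z_lattice (- N)\<close> into \<open>z_lattice S\<close>.\<close>
  have "(lift S (Phi L) ^^ nat (S + N)) v \<in> z_lattice S" if v: "v \<in> std_lattice \<sigma>" for v
  proof -
    let ?w = "(lift S (Phi L) ^^ nat (S + N)) v"
    have "zmul (int (nat (S + N))) (hlift \<sigma> L v) \<in> z_lattice S"
      using N hlift_in[OF chart] by (intro zmul_in_z_lattice[of _ "- N"]) auto
    then have "hlift \<sigma> L ?w \<in> z_lattice S"
      using hlift_lift_Phi_pow[OF v, of "nat (S + N)"] by (simp add: z_lattice_iff)
    then have h: "coef (hlift \<sigma> L ?w) i n = 0" if "n < S" for i n using that by (simp add: z_lattice_iff)
    have "?w \<in> std_lattice \<sigma>" using v by (rule lift_pow_std[OF Phi_End])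
    then have "coef ?w i n = 0" if "n < S" for i n
      using h[OF that, of i] coef_hlift[OF chart, of i n ?w]
      by (cases "- \<sigma> i \<le> n") (auto simp: std_lattice_iff)
    then show ?thesis by (simp add: z_lattice_iff)
  qed
  then show ?thesis using nilp_cone_iff[OF Phi_End] by blast
qed

end

lemma slice_lattices_chart: "L \<in> slice_lattices \<Longrightarrow> L \<in> Gr_chart \<sigma>"
  and slice_lattices_z_lattice: "L \<in> slice_lattices \<Longrightarrow> z_lattice S \<subseteq> L"
  using slice_subset_Gr_chart by (auto simp: slice_lattices_def)

text \<open>Values in \<open>U_top\<close> only require the chart. The vanishing conditions are
  where \<open>L \<in> slice \<sigma>\<close> enters, through preservation of leading terms.\<close>

lemma Phi_in_slice_nilp:
  assumes L: "L \<in> slice_lattices" shows "Phi L \<in> slice_nilp"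
proof -
  note LY = slice_lattices_chart[OF L] slice_lattices_z_lattice[OF L]
  have Ls: "L \<in> slice \<sigma>" using L by (simp add: slice_lattices_def)
  have phi: "phi (Phi L) v = cut S (pr (zmul 1 (hlift \<sigma> L v)) - zmul 1 v)" if "v \<in> std_lattice \<sigma>" for v
    using that by (intro lvec_eqI) (simp add: phi_def lift_Phi[OF LY])
  have "phi (Phi L) v \<in> U_top \<sigma> S" if v: "v \<in> std_lattice \<sigma>" for v
    unfolding phi[OF v] U_top_iff
  proof (intro allI impI)
    fix i n assume n: "n \<noteq> - \<sigma> i \<or> S \<le> n"
    show "coef (cut S (pr (zmul 1 (hlift \<sigma> L v)) - zmul 1 v)) i n = 0"
    proof (cases "n < - \<sigma> i")
      case True
      then show ?thesis using v by (simp add: std_lattice_iff)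
    next
      case False
      then show ?thesis using n coef_hlift[OF LY(1), of i "n - 1" v] by auto
    qed
  qed
  moreover have "coef (phi (Phi L) (mon j n)) i (- \<sigma> i) = 0" if jn: "(j, n) \<in> J" "n < - \<sigma> i" for i j n
  proof -
    have std: "mon j n \<in> std_lattice \<sigma>" using jn by (intro mon_std) simp
    \<comment> \<open>Multiplication by \<open>z\<close> brings the coefficient at
      \<open>- \<sigma> i - 1\<close> to \<open>- \<sigma> i\<close>. As
      \<open>n \<le> - \<sigma> i - 1\<close>, that exponent is the leading one or exceeds the
      degree.\<close>
    have "coef (hlift \<sigma> L (mon j n)) i (- \<sigma> i - 1) = coef (mon j n) i (- \<sigma> i - 1)"
    proof (cases "n = - \<sigma> i - 1")
      case True
      then show ?thesis using hlift_slice_leading(2)[OF Ls std deg_le_mon] by simp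
    next
      case False
      then show ?thesis
        using hlift_slice_leading(1)[OF Ls std deg_le_mon] jn by (auto simp: deg_le_def coef_mon)
    qed
    then show ?thesis unfolding phi[OF std] by (auto simp: coef_mon)
  qed
  ultimately have "slice_op (Phi L)" using Phi_End[OF LY] by (simp add: slice_op_def)
  then show ?thesis using Phi_nilp[OF LY] by (simp add: slice_nilp_def T_zbar_iff)
qed

text \<open>\<open>coef_hlift\<close> leaves open only the exponent \<open>S - 1\<close> in
  components with a block of size 0, and there the leading terms of slice lattices decide.\<close>

lemma hlift_top:
  assumes L: "L \<in> slice_lattices" and v: "v \<in> std_lattice \<sigma>" and n: "S - 1 \<le> n"
  shows "coef (hlift \<sigma> L v) i n = coef v i n"
proof -
  note LY = slice_lattices_chart[OF L] slice_lattices_z_lattice[OF L]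
  have Ls: "L \<in> slice \<sigma>" using L by (simp add: slice_lattices_def)
  have c: "cut S v \<in> std_lattice \<sigma>" "deg_le (S - 1) (cut S v)"
    using v by (auto simp: std_lattice_iff deg_le_def)
  have "coef (hlift \<sigma> L (cut S v)) i n = coef (cut S v) i n"
    using hlift_slice_leading[OF Ls c] n c(2) by (cases "n = S - 1") (auto simp: deg_le_def)
  moreover have "hlift \<sigma> L v = hlift \<sigma> L (cut S v) + (v - cut S v)"
    using hlift_add[OF LY(1), of "cut S v" "v - cut S v"] hlift_z_lattice[OF LY diff_cut_in(1)[of v S]]
    by simp
  ultimately show ?thesis by simp
qed

text \<open>For slice lattices \<open>h\<close> intertwines \<open>z + \<phi>\<close> with
  \<open>z\<close> exactly, not only modulo \<open>z_lattice S\<close>. Hence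
  \<open>z^p h v = h ((z + \<phi>)^p v)\<close>, and for \<open>p = nil_bound\<close> the argument
  on the right lies in \<open>z_lattice S\<close>, where \<open>h\<close> is the identity. So
  \<open>h\<close> is \<open>psi\<close>.\<close>

lemma Psi0_S_Phi:
  assumes L: "L \<in> slice_lattices" shows "Psi0_S \<sigma> S (Phi L) = L"
proof -
  note LY = slice_lattices_chart[OF L] slice_lattices_z_lattice[OF L]
  note LX = Phi_in_slice_nilp[OF L]
  have z_phi: "z_phi (Phi L) v = pr (zmul 1 (hlift \<sigma> L v))" if v: "v \<in> std_lattice \<sigma>" for v
  proof (rule lvec_eqI)
    fix i n
    have "phi (Phi L) v = cut S (pr (zmul 1 (hlift \<sigma> L v)) - zmul 1 v)"
      using v by (intro lvec_eqI) (simp add: phi_def lift_Phi[OF LY])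
    then show "coef (z_phi (Phi L) v) i n = coef (pr (zmul 1 (hlift \<sigma> L v))) i n"
      using hlift_top[OF L v, of "n - 1" i] nonneg[of i] by (simp add: z_phi_def)
  qed
  have hAz: "hlift \<sigma> L ((z_phi (Phi L) ^^ n) v) = zmul (int n) (hlift \<sigma> L v)" if v: "v \<in> std_lattice \<sigma>" for v n
  proof (induction n)
    case (Suc n)
    let ?w = "(z_phi (Phi L) ^^ n) v"
    have w: "?w \<in> std_lattice \<sigma>" using v by (rule z_phi_pow_std[OF slice_nilp_slice_op[OF LX]])
    have "zmul 1 (hlift \<sigma> L ?w) \<in> L"
      using hlift_in[OF LY(1)] chart_zsub[OF LY(1)] by (simp add: zsub_def)
    then have "hlift \<sigma> L (z_phi (Phi L) ?w) = zmul 1 (hlift \<sigma> L ?w)"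
      by (simp add: z_phi[OF w] hlift_pr[OF LY])
    then show ?case by (simp add: Suc add.commute)
  qed simp
  have h: "hlift \<sigma> L v = psi (Phi L) v" if v: "v \<in> std_lattice \<sigma>" for v
  proof -
    have "zmul (int nil_bound) (hlift \<sigma> L v) = (z_phi (Phi L) ^^ nil_bound) v"
      using hAz[OF v] hlift_z_lattice[OF LY z_phi_pow_in[OF LX v order.refl]] by simp
    then have "psi (Phi L) v = zmul (- int nil_bound) (zmul (int nil_bound) (hlift \<sigma> L v))" by (simp add: psi_def)
    then show ?thesis by simp
  qed
  have "hlift \<sigma> L ` std_lattice \<sigma> = L"
  proof (intro equalityI subsetI)
    fix w assume "w \<in> L"
    then have "w = hlift \<sigma> L (pr w)" by (simp add: hlift_pr[OF LY])
    then show "w \<in> hlift \<sigma> L ` std_lattice \<sigma>" using pr_std by blast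
  qed (auto intro: hlift_in[OF LY(1)])
  then show ?thesis using h by (simp add: Psi0_S_eq[OF LX])
qed

lemma Phi_Psi0_S:
  assumes A: "A \<in> slice_nilp" shows "Phi (Psi0_S \<sigma> S A) = A"
proof -
  let ?L = "Psi0_S \<sigma> S A"
  note LY = slice_lattices_chart[OF Psi0_S_in_slice_lattices[OF A]] slice_lattices_z_lattice[OF Psi0_S_in_slice_lattices[OF A]]
  show ?thesis
  proof (rule End_D_cong[OF Phi_End[OF LY] slice_nilp_End[OF A]])
    fix v assume v: "v \<in> std_lattice \<sigma>"
    have Av: "z_phi A v \<in> std_lattice \<sigma>" using v by (rule z_phi_std[OF slice_nilp_slice_op[OF A]])
    have "pr (zmul 1 (hlift \<sigma> ?L v)) = pr (psi A (z_phi A v))"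
      using v by (simp add: Psi0_S_eq[OF A] psi_eq_hlift[OF A] psi_z_phi[OF A])
    also have "\<dots> = z_phi A v"
      using psi_U_neg[OF A Av] Av by (intro lvec_eqI) (auto simp: U_neg_iff std_lattice_iff)
    finally show "Phi ?L (cls S v) = A (cls S v)"
      using v by (simp add: Phi_cls[OF LY] cls_eq_iff z_phi_def phi_def flip: cls_lift[OF slice_nilp_End[OF A]])
  qed
qed

lemma bij_Psi0_S: "bij_betw (Psi0_S \<sigma> S) slice_nilp slice_lattices"
  using Phi_in_slice_nilp Phi_Psi0_S Psi0_S_in_slice_lattices Psi0_S_Phi by (intro bij_betw_byWitness[of _ Phi]) auto

end

section \<open>Regular functions and morphisms\<close>

lemma polyfun_sum: "(\<And>i. i \<in> I \<Longrightarrow> f i \<in> polyfun C) \<Longrightarrow> (\<lambda>x. \<Sum>i\<in>I. f i x) \<in> polyfun C"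
  by (induction I rule: infinite_finite_induct) (simp_all add: polyfun.const polyfun.add)

lemma polyfun_prod: "(\<And>i. i \<in> I \<Longrightarrow> f i \<in> polyfun C) \<Longrightarrow> (\<lambda>x. \<Prod>i\<in>I. f i x) \<in> polyfun C"
  by (induction I rule: infinite_finite_induct) (simp_all add: polyfun.const polyfun.mult)

section \<open>Determinants and inverses of matrices with polynomial entries\<close>

lemma polyfun_det:
  assumes "\<And>a c. a < n \<Longrightarrow> c < n \<Longrightarrow> E a c \<in> polyfun C"
  shows "(\<lambda>x. Determinant.det (Matrix.mat n n (\<lambda>(a, c). E a c x))) \<in> polyfun C"
proof -
  have eq: "Determinant.det (Matrix.mat n n (\<lambda>(a, c). E a c x)) =
      (\<Sum>p | p permutes {0..<n}. signof p * (\<Prod>a = 0..<n. if p a < n then E a (p a) x else 0))" for x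
  proof -
    have "(\<Prod>a = 0..<n. Matrix.mat n n (\<lambda>(a, c). E a c x) $$ (a, p a)) =
        (\<Prod>a = 0..<n. if p a < n then E a (p a) x else 0)" if "p permutes {0..<n}" for p
      using permutes_in_image[OF that] by (intro prod.cong) auto
    then show ?thesis by (simp add: det_def'[of _ n])
  qed
  have "(\<lambda>x. if p a < n then E a (p a) x else 0) \<in> polyfun C" if "a < n" for p a
    using assms[OF that] by (cases "p a < n") (auto intro: polyfun.const)
  then show ?thesis
    unfolding eq by (intro polyfun_sum polyfun.mult[OF polyfun.const] polyfun_prod) (simp only: atLeastLessThan_iff)
qed

lemma polyfun_adj_mat:
  assumes E: "\<And>a c. a < n \<Longrightarrow> c < n \<Longrightarrow> E a c \<in> polyfun C" and ij: "i < n" "j < n"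
  shows "(\<lambda>x. adj_mat (Matrix.mat n n (\<lambda>(a, c). E a c x)) $$ (i, j)) \<in> polyfun C"
proof -
  let ?s = "\<lambda>k a. if a < k then a else Suc a"
  have eq: "adj_mat (Matrix.mat n n (\<lambda>(a, c). E a c x)) $$ (i, j) = (- 1) ^ (j + i) *
      Determinant.det (Matrix.mat (n - 1) (n - 1) (\<lambda>(a, c). E (?s j a) (?s i c) x))" for x
    using ij unfolding adj_mat_def cofactor_def mat_delete_def
    by (auto intro!: arg_cong[of _ _ Determinant.det] cong_mat)
  have "E (?s j a) (?s i c) \<in> polyfun C" if "a < n - 1" "c < n - 1" for a c
    using that by (intro E) auto
  then show ?thesis
    unfolding eq by (rule polyfun.mult[OF polyfun.const polyfun_det])
qed

text \<open>Comparison of traces: \<open>tr (M R) = tr (R M)\<close>, in characteristic 0.\<close>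

lemma card_eq_of_inverse_matrices:
  fixes M R :: "_ \<Rightarrow> _ \<Rightarrow> complex"
  assumes "finite I" "finite K"
    and MR: "\<And>i. i \<in> I \<Longrightarrow> (\<Sum>k\<in>K. M i k * R k i) = 1"
    and RM: "\<And>k. k \<in> K \<Longrightarrow> (\<Sum>i\<in>I. R k i * M i k) = 1"
  shows "card I = card K"
proof -
  have "of_nat (card I) = (\<Sum>i\<in>I. \<Sum>k\<in>K. M i k * R k i)" using MR by simp
  also have "\<dots> = (\<Sum>k\<in>K. \<Sum>i\<in>I. R k i * M i k)"
    by (subst sum.swap) (simp add: mult.commute)
  also have "\<dots> = of_nat (card K)" using RM by simp
  finally show ?thesis by (simp only: of_nat_eq_iff)
qed

text \<open>The adjugate satisfies \<open>M Q = Q M = \<delta>\<close> identically, so invertibility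
  at the single point \<open>x0\<close> supplies a rational inverse \<open>Q / \<delta>\<close>
  wherever \<open>\<delta>\<close> is nonzero. Rows and columns are indexed by different finite
  sets, as in the comparison of a frame with monomials.\<close>

lemma polyfun_matrix_inverse:
  assumes fin: "finite I" "finite K"
    and M: "\<And>i k. i \<in> I \<Longrightarrow> k \<in> K \<Longrightarrow> M i k \<in> polyfun C"
    and MR: "\<And>i j. i \<in> I \<Longrightarrow> j \<in> I \<Longrightarrow> (\<Sum>k\<in>K. M i k x0 * R k j) = (if i = j then 1 else 0)"
    and RM: "\<And>k l. k \<in> K \<Longrightarrow> l \<in> K \<Longrightarrow> (\<Sum>i\<in>I. R k i * M i l x0) = (if k = l then 1 else 0)"
  obtains \<delta> Q where "\<delta> \<in> polyfun C" "\<delta> x0 \<noteq> 0"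
    "\<And>k i. k \<in> K \<Longrightarrow> i \<in> I \<Longrightarrow> Q k i \<in> polyfun C"
    "\<And>x i j. i \<in> I \<Longrightarrow> j \<in> I \<Longrightarrow> (\<Sum>k\<in>K. M i k x * Q k j x) = (if i = j then \<delta> x else 0)"
    "\<And>x k l. k \<in> K \<Longrightarrow> l \<in> K \<Longrightarrow> (\<Sum>i\<in>I. Q k i x * M i l x) = (if k = l then \<delta> x else 0)"
proof -
  define n where "n = card I"
  have "card K = n" using card_eq_of_inverse_matrices[OF fin, of "\<lambda>i k. M i k x0" R] MR RM
    by (simp add: n_def)
  then obtain f g where f: "bij_betw f {0..<n} I" and g: "bij_betw g {0..<n} K"
    using fin ex_bij_betw_nat_finite[of I] ex_bij_betw_nat_finite[of K] by (auto simp: n_def)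
  have fI: "a < n \<Longrightarrow> f a \<in> I" and gK: "a < n \<Longrightarrow> g a \<in> K" for a
    using f g by (auto simp: bij_betw_def)
  have feq: "f a = f b \<longleftrightarrow> a = b" and geq: "g a = g b \<longleftrightarrow> a = b" if "a < n" "b < n" for a b
    using f g that inj_on_eq_iff[of f "{0..<n}" a b] inj_on_eq_iff[of g "{0..<n}" a b]
    by (simp_all add: bij_betw_def)
  define f' where "f' = inv_into {0..<n} f"
  define g' where "g' = inv_into {0..<n} g"
  have f': "i \<in> I \<Longrightarrow> f' i < n \<and> f (f' i) = i" for i
    using f bij_betw_inv_into_right[OF f] bij_betw_apply[OF bij_betw_inv_into[OF f]] by (simp add: f'_def)
  have g': "i \<in> K \<Longrightarrow> g' i < n \<and> g (g' i) = i" for i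
    using g bij_betw_inv_into_right[OF g] bij_betw_apply[OF bij_betw_inv_into[OF g]] by (simp add: g'_def)
  have f'f: "a < n \<Longrightarrow> f' (f a) = a" and g'g: "a < n \<Longrightarrow> g' (g a) = a" for a
    using bij_betw_inv_into_left[OF f] bij_betw_inv_into_left[OF g] by (auto simp: f'_def g'_def)
  define N where "N x = Matrix.mat n n (\<lambda>(a, c). M (f a) (g c) x)" for x
  define \<delta> where "\<delta> x = Determinant.det (N x)" for x
  define Q where "Q k i x = adj_mat (N x) $$ (g' k, f' i)" for k i x
  have N: "N x \<in> carrier_mat n n" for x by (simp add: N_def)
  note adj = adj_mat[OF N]
  have poly: "M (f a) (g c) \<in> polyfun C" if "a < n" "c < n" for a c
    using that by (intro M fI gK)
  have d: "\<delta> \<in> polyfun C"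
    unfolding \<delta>_def N_def using polyfun_det[OF poly] by simp
  have Qp: "Q k i \<in> polyfun C" if "k \<in> K" "i \<in> I" for k i
  proof -
    have "(\<lambda>x. adj_mat (N x) $$ (g' k, f' i)) \<in> polyfun C"
      unfolding N_def using that f' g' by (intro polyfun_adj_mat poly) auto
    then show ?thesis by (simp add: Q_def[abs_def])
  qed
  have "N x0 * Matrix.mat n n (\<lambda>(a, c). R (g a) (f c)) = 1\<^sub>m n"
  proof (rule eq_matI)
    fix a c assume ac: "a < dim_row (1\<^sub>m n)" "c < dim_col (1\<^sub>m n)"
    then have "(N x0 * Matrix.mat n n (\<lambda>(a, c). R (g a) (f c))) $$ (a, c)
        = (\<Sum>b = 0..<n. M (f a) (g b) x0 * R (g b) (f c))"
      by (simp add: N_def scalar_prod_def)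
    also have "\<dots> = (\<Sum>k\<in>K. M (f a) k x0 * R k (f c))"
      by (rule sum.reindex_bij_betw[OF g])
    also have "\<dots> = 1\<^sub>m n $$ (a, c)" using ac MR fI feq by simp
    finally show "(N x0 * Matrix.mat n n (\<lambda>(a, c). R (g a) (f c))) $$ (a, c) = 1\<^sub>m n $$ (a, c)" .
  qed (auto simp: N_def)
  then have "\<delta> x0 * Determinant.det (Matrix.mat n n (\<lambda>(a, c). R (g a) (f c))) = 1"
    unfolding \<delta>_def by (subst det_mult[OF N, symmetric]) auto
  then have d0: "\<delta> x0 \<noteq> 0" by auto
  have MQ: "(\<Sum>k\<in>K. M i k x * Q k j x) = (if i = j then \<delta> x else 0)" if ij: "i \<in> I" "j \<in> I" for x i j
  proof -
    have "(\<Sum>k\<in>K. M i k x * Q k j x) = (\<Sum>b = 0..<n. M i (g b) x * Q (g b) j x)"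
      by (rule sum.reindex_bij_betw[OF g, symmetric])
    also have "\<dots> = (N x * adj_mat (N x)) $$ (f' i, f' j)"
      using adj(1)[of x] f'[OF ij(1)] f'[OF ij(2)]
      by (auto simp: Q_def scalar_prod_def g'g N_def intro!: sum.cong)
    also have "\<dots> = (\<delta> x \<cdot>\<^sub>m 1\<^sub>m n) $$ (f' i, f' j)" by (simp add: adj(2) \<delta>_def)
    also have "\<dots> = (if i = j then \<delta> x else 0)"
      using f'[OF ij(1)] f'[OF ij(2)] by auto
    finally show ?thesis .
  qed
  have QM: "(\<Sum>i\<in>I. Q k i x * M i l x) = (if k = l then \<delta> x else 0)" if kl: "k \<in> K" "l \<in> K" for x k l
  proof -
    have "(\<Sum>i\<in>I. Q k i x * M i l x) = (\<Sum>b = 0..<n. Q k (f b) x * M (f b) l x)"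
      by (rule sum.reindex_bij_betw[OF f, symmetric])
    also have "\<dots> = (adj_mat (N x) * N x) $$ (g' k, g' l)"
      using adj(1)[of x] g'[OF kl(1)] g'[OF kl(2)]
      by (auto simp: Q_def scalar_prod_def f'f N_def intro!: sum.cong)
    also have "\<dots> = (\<delta> x \<cdot>\<^sub>m 1\<^sub>m n) $$ (g' k, g' l)" by (simp add: adj(3) \<delta>_def)
    also have "\<dots> = (if k = l then \<delta> x else 0)"
      using g'[OF kl(1)] g'[OF kl(2)] by auto
    finally show ?thesis .
  qed
  show ?thesis by (rule that[OF d d0 Qp MQ QM])
qed

section \<open>Principal open sets and regular functions\<close>

lemma openin_zariski:
  "openin (zariski C M) U \<longleftrightarrow>
    U \<subseteq> M \<and> (\<forall>x\<in>U. \<exists>p\<in>polyfun C. p x \<noteq> 0 \<and> {y \<in> M. p y \<noteq> 0} \<subseteq> U)" (is "_ \<longleftrightarrow> ?R U")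
proof
  assume "openin (zariski C M) U"
  then have "generate_topology_on {{x \<in> M. p x \<noteq> 0} |p. p \<in> polyfun C} U"
    by (simp add: zariski_def openin_topology_generated_by_iff)
  then show "?R U"
  proof induction
    case (Int a b)
    have "\<exists>p\<in>polyfun C. p x \<noteq> 0 \<and> {y \<in> M. p y \<noteq> 0} \<subseteq> a \<inter> b" if x: "x \<in> a \<inter> b" for x
    proof -
      obtain p q where "p \<in> polyfun C" "p x \<noteq> 0" "{y \<in> M. p y \<noteq> 0} \<subseteq> a"
        "q \<in> polyfun C" "q x \<noteq> 0" "{y \<in> M. q y \<noteq> 0} \<subseteq> b"
        using Int.IH x by blast
      then show ?thesis by (intro bexI[of _ "\<lambda>x. p x * q x"]) (auto simp: polyfun.mult)
    qed
    then show ?case using Int.IH by blast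
  next
    case (UN K)
    then show ?case by (meson Sup_le_iff UnionE Union_upper dual_order.trans)
  qed auto
next
  assume R: "?R U"
  define B where "B = {{x \<in> M. p x \<noteq> 0} |p. p \<in> polyfun C \<and> {y \<in> M. p y \<noteq> 0} \<subseteq> U}"
  have "\<Union>B = U" using R unfolding B_def by blast
  moreover have "openin (zariski C M) W" if "W \<in> B" for W
    unfolding zariski_def using that by (intro topology_generated_by_Basis) (auto simp: B_def)
  then have "openin (zariski C M) (\<Union>B)" by (rule openin_Union)
  ultimately show "openin (zariski C M) U" by simp
qed

lemma openin_subtopology_zariski:
  assumes "X \<subseteq> M"
  shows "openin (subtopology (zariski C M) X) U \<longleftrightarrow>
    U \<subseteq> X \<and> (\<forall>x\<in>U. \<exists>p\<in>polyfun C. p x \<noteq> 0 \<and> {y \<in> X. p y \<noteq> 0} \<subseteq> U)"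
proof
  assume "openin (subtopology (zariski C M) X) U"
  then obtain T where T: "openin (zariski C M) T" "U = T \<inter> X" by (auto simp: openin_subtopology)
  have "\<exists>p\<in>polyfun C. p x \<noteq> 0 \<and> {y \<in> X. p y \<noteq> 0} \<subseteq> U" if "x \<in> U" for x
  proof -
    obtain p where "p \<in> polyfun C" "p x \<noteq> 0" "{y \<in> M. p y \<noteq> 0} \<subseteq> T"
      using T \<open>x \<in> U\<close> unfolding openin_zariski by blast
    then show ?thesis using T(2) assms by (intro bexI[of _ p]) auto
  qed
  then show "U \<subseteq> X \<and> (\<forall>x\<in>U. \<exists>p\<in>polyfun C. p x \<noteq> 0 \<and> {y \<in> X. p y \<noteq> 0} \<subseteq> U)"
    using T(2) by blast
next
  assume R: "U \<subseteq> X \<and> (\<forall>x\<in>U. \<exists>p\<in>polyfun C. p x \<noteq> 0 \<and> {y \<in> X. p y \<noteq> 0} \<subseteq> U)"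
  define T where "T = \<Union> {{y \<in> M. p y \<noteq> 0} |p. p \<in> polyfun C \<and> {y \<in> X. p y \<noteq> 0} \<subseteq> U}"
  have "openin (zariski C M) T" unfolding openin_zariski T_def by blast
  moreover have "U = T \<inter> X" using R assms unfolding T_def by blast
  ultimately show "openin (subtopology (zariski C M) X) U" by (auto simp: openin_subtopology)
qed

lemma regular_onE:
  assumes "regular_on C Z f" "x \<in> Z"
  obtains p q where "p \<in> polyfun C" "q \<in> polyfun C" "q x \<noteq> 0"
    "\<And>y. y \<in> Z \<Longrightarrow> q y \<noteq> 0 \<Longrightarrow> f y = p y / q y"
  using assms unfolding regular_on_def by blast

lemma regular_onI:
  assumes "\<And>x. x \<in> Z \<Longrightarrow> \<exists>p\<in>polyfun C. \<exists>q\<in>polyfun C. q x \<noteq> 0 \<and> (\<forall>y\<in>Z. q y \<noteq> 0 \<longrightarrow> f y = p y / q y)"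
  shows "regular_on C Z f"
  using assms unfolding regular_on_def by blast

lemma regular_on_polyfun: "p \<in> polyfun C \<Longrightarrow> regular_on C Z p"
  by (rule regular_onI, rule bexI[of _ p], rule bexI[of _ "\<lambda>_. 1"]) (auto intro: polyfun.const)

lemma regular_on_cong: "regular_on C Z f \<Longrightarrow> Z' \<subseteq> Z \<Longrightarrow> (\<And>x. x \<in> Z' \<Longrightarrow> g x = f x) \<Longrightarrow> regular_on C Z' g"
  unfolding regular_on_def by (metis subsetD)

lemma regular_on_add:
  assumes "regular_on C Z f" "regular_on C Z g"
  shows "regular_on C Z (\<lambda>x. f x + g x)"
proof (rule regular_onI)
  fix x assume x: "x \<in> Z"
  obtain p q where p: "p \<in> polyfun C" "q \<in> polyfun C" "q x \<noteq> 0"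
    "\<And>y. y \<in> Z \<Longrightarrow> q y \<noteq> 0 \<Longrightarrow> f y = p y / q y" using regular_onE[OF assms(1) x] by metis
  obtain r s where r: "r \<in> polyfun C" "s \<in> polyfun C" "s x \<noteq> 0"
    "\<And>y. y \<in> Z \<Longrightarrow> s y \<noteq> 0 \<Longrightarrow> g y = r y / s y" using regular_onE[OF assms(2) x] by metis
  show "\<exists>p\<in>polyfun C. \<exists>q\<in>polyfun C. q x \<noteq> 0 \<and> (\<forall>y\<in>Z. q y \<noteq> 0 \<longrightarrow> f y + g y = p y / q y)"
  proof (rule bexI[of _ "\<lambda>x. p x * s x + r x * q x"], rule bexI[of _ "\<lambda>x. q x * s x"])
    show "q x * s x \<noteq> 0 \<and> (\<forall>y\<in>Z. q y * s y \<noteq> 0 \<longrightarrow>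
        f y + g y = (p y * s y + r y * q y) / (q y * s y))"
      using p r by (simp add: add_frac_eq)
  qed (use p r in \<open>simp_all add: polyfun.add polyfun.mult\<close>)
qed

lemma regular_on_mult:
  assumes "regular_on C Z f" "regular_on C Z g"
  shows "regular_on C Z (\<lambda>x. f x * g x)"
proof (rule regular_onI)
  fix x assume x: "x \<in> Z"
  obtain p q where p: "p \<in> polyfun C" "q \<in> polyfun C" "q x \<noteq> 0"
    "\<And>y. y \<in> Z \<Longrightarrow> q y \<noteq> 0 \<Longrightarrow> f y = p y / q y" using regular_onE[OF assms(1) x] by metis
  obtain r s where r: "r \<in> polyfun C" "s \<in> polyfun C" "s x \<noteq> 0"
    "\<And>y. y \<in> Z \<Longrightarrow> s y \<noteq> 0 \<Longrightarrow> g y = r y / s y" using regular_onE[OF assms(2) x] by metis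
  show "\<exists>p\<in>polyfun C. \<exists>q\<in>polyfun C. q x \<noteq> 0 \<and> (\<forall>y\<in>Z. q y \<noteq> 0 \<longrightarrow> f y * g y = p y / q y)"
  proof (rule bexI[of _ "\<lambda>x. p x * r x"], rule bexI[of _ "\<lambda>x. q x * s x"])
    show "q x * s x \<noteq> 0 \<and> (\<forall>y\<in>Z. q y * s y \<noteq> 0 \<longrightarrow>
        f y * g y = (p y * r y) / (q y * s y))"
      using p r by simp
  qed (use p r in \<open>simp_all add: polyfun.mult\<close>)
qed

lemma regular_on_polyfun_comp:
  assumes "p \<in> polyfun C" "\<And>c. c \<in> C \<Longrightarrow> regular_on C' Z (\<lambda>x. c (h x))"
  shows "regular_on C' Z (\<lambda>x. p (h x))"
  using assms(1)
  by induction
     (simp_all add: assms(2) regular_on_add regular_on_mult regular_on_polyfun polyfun.const)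

lemma regular_on_comp:
  assumes f: "regular_on C W f" and h: "\<And>x. x \<in> Z \<Longrightarrow> h x \<in> W"
    and c: "\<And>c. c \<in> C \<Longrightarrow> regular_on C' Z (\<lambda>x. c (h x))"
  shows "regular_on C' Z (\<lambda>x. f (h x))"
proof (rule regular_onI)
  have poly: "regular_on C' Z (\<lambda>x. p (h x))" if "p \<in> polyfun C" for p
    using that by (rule regular_on_polyfun_comp) (rule c)
  fix x assume x: "x \<in> Z"
  obtain p q where p: "p \<in> polyfun C" "q \<in> polyfun C" "q (h x) \<noteq> 0"
    "\<And>y. y \<in> W \<Longrightarrow> q y \<noteq> 0 \<Longrightarrow> f y = p y / q y" using regular_onE[OF f h[OF x]] by metis
  obtain a b where a: "a \<in> polyfun C'" "b \<in> polyfun C'" "b x \<noteq> 0"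
    "\<And>y. y \<in> Z \<Longrightarrow> b y \<noteq> 0 \<Longrightarrow> p (h y) = a y / b y"
    using regular_onE[OF poly[OF p(1)] x] by metis
  obtain r s where r: "r \<in> polyfun C'" "s \<in> polyfun C'" "s x \<noteq> 0"
    "\<And>y. y \<in> Z \<Longrightarrow> s y \<noteq> 0 \<Longrightarrow> q (h y) = r y / s y"
    using regular_onE[OF poly[OF p(2)] x] by metis
  have "f (h y) = (a y * s y * s y) / (b y * r y * s y)" if "y \<in> Z" "b y * r y * s y \<noteq> 0" for y
  proof -
    have nz: "b y \<noteq> 0" "r y \<noteq> 0" "s y \<noteq> 0" using that(2) by auto
    then have "q (h y) \<noteq> 0" using r(4)[OF that(1)] by simp
    then have "f (h y) = (a y / b y) / (r y / s y)"
      using p(4)[OF h[OF that(1)]] a(4)[OF that(1) nz(1)] r(4)[OF that(1) nz(3)] by simp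
    then show ?thesis using nz by simp
  qed
  moreover have "r x \<noteq> 0" using r(3) r(4)[OF x] p(3) by auto
  ultimately show "\<exists>p\<in>polyfun C'. \<exists>q\<in>polyfun C'. q x \<noteq> 0 \<and> (\<forall>y\<in>Z. q y \<noteq> 0 \<longrightarrow> f (h y) = p y / q y)"
    using a(1-3) r(1-3)
    by - (rule bexI[of _ "\<lambda>x. a x * s x * s x"], rule bexI[of _ "\<lambda>x. b x * r x * s x"],
      simp_all add: polyfun.mult)
qed

lemma regular_on_nonzero_open:
  assumes W: "openin (zariski C M) W" and f: "regular_on C W f"
  shows "openin (zariski C M) {x \<in> W. f x \<noteq> 0}"
  unfolding openin_zariski
proof (intro conjI ballI)
  show "{x \<in> W. f x \<noteq> 0} \<subseteq> M" using W unfolding openin_zariski by blast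
  fix x assume x: "x \<in> {x \<in> W. f x \<noteq> 0}"
  then have xW: "x \<in> W" by simp
  obtain p q where p: "p \<in> polyfun C" "q \<in> polyfun C" "q x \<noteq> 0"
    "\<And>y. y \<in> W \<Longrightarrow> q y \<noteq> 0 \<Longrightarrow> f y = p y / q y" using regular_onE[OF f xW] by metis
  obtain r where r: "r \<in> polyfun C" "r x \<noteq> 0" "{y \<in> M. r y \<noteq> 0} \<subseteq> W"
    using W x unfolding openin_zariski by blast
  \<comment> \<open>Nonvanishing of \<open>r\<close> keeps the point in \<open>W\<close>, that of
    \<open>q\<close> makes the fraction valid, and that of \<open>p\<close> makes it
    nonzero.\<close>
  show "\<exists>p\<in>polyfun C. p x \<noteq> 0 \<and> {y \<in> M. p y \<noteq> 0} \<subseteq> {x \<in> W. f x \<noteq> 0}"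
    using p r x by (intro bexI[of _ "\<lambda>x. p x * q x * r x"]) (auto simp: polyfun.mult)
qed

section \<open>Open sets of the loop Grassmannian and morphisms\<close>

lemma Gr_open_nonzero:
  assumes "Gr_open W" and "\<And>N d. regular_on (frame_coords N d) (frames_over N d W) (\<lambda>b. f (frame_lattice N d b))"
  shows "Gr_open {L \<in> W. f L \<noteq> 0}"
proof -
  have "frames_over N d {L \<in> W. f L \<noteq> 0} = {b \<in> frames_over N d W. f (frame_lattice N d b) \<noteq> 0}" for N d
    by (auto simp: frames_over_def)
  then show ?thesis
    using assms regular_on_nonzero_open unfolding Gr_open_def by fastforce
qed

lemma openin_loop_Gr_fspace: "openin (ztop loop_Gr_fspace) V \<longleftrightarrow> Gr_open V"
  by (simp add: loop_Gr_fspace_def openin_loop_Gr)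

lemma Gr_open_Union: "(\<And>V. V \<in> K \<Longrightarrow> Gr_open V) \<Longrightarrow> Gr_open (\<Union>K)"
  unfolding openin_loop_Gr_fspace[symmetric] by (rule openin_Union)

lemma polyfun_pullback:
  assumes "p \<in> polyfun C'" and "\<And>c. c \<in> C' \<Longrightarrow> \<exists>p\<in>polyfun C. \<forall>x\<in>M. c (\<beta> x) = p x"
  shows "\<exists>q\<in>polyfun C. \<forall>x\<in>M. p (\<beta> x) = q x"
  using assms(1)
proof induction
  case (const c)
  show ?case by (rule bexI[OF _ polyfun.const[of c]]) simp
next
  case (add p q)
  then obtain p' q' where "p' \<in> polyfun C" "q' \<in> polyfun C"
    "\<forall>x\<in>M. p (\<beta> x) = p' x" "\<forall>x\<in>M. q (\<beta> x) = q' x" by blast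
  then show ?case by (intro bexI[OF _ polyfun.add[of p' C q']]) auto
next
  case (mult p q)
  then obtain p' q' where "p' \<in> polyfun C" "q' \<in> polyfun C"
    "\<forall>x\<in>M. p (\<beta> x) = p' x" "\<forall>x\<in>M. q (\<beta> x) = q' x" by blast
  then show ?case by (intro bexI[OF _ polyfun.mult[of p' C q']]) auto
qed (rule assms(2))

text \<open>Openness and regularity on the loop Grassmannian are tested on frames, so a polynomial
  lift of \<open>\<phi>\<close> to frames of one fixed size suffices.\<close>

lemma fspace_morphism_to_loop_Gr:
  assumes X: "X \<subseteq> M" and Y: "\<phi> ` X \<subseteq> Y"
    and \<beta>: "\<And>x. x \<in> X \<Longrightarrow> \<beta> x \<in> Gr_frames N d \<and> frame_lattice N d (\<beta> x) = \<phi> x"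
    and poly: "\<And>c. c \<in> frame_coords N d \<Longrightarrow> \<exists>p\<in>polyfun C. \<forall>x\<in>M. c (\<beta> x) = p x"
  shows "fspace_morphism (affine_fspace C M) X loop_Gr_fspace Y \<phi>"
  unfolding fspace_morphism_def
proof (intro conjI allI impI Y)
  fix V f
  assume "openin (subtopology (ztop loop_Gr_fspace) Y) V \<and> regfun loop_Gr_fspace V f"
  then obtain V' where V': "Gr_open V'" "V = V' \<inter> Y"
    and f: "regular_on (frame_coords N d) (frames_over N d V) (f \<circ> frame_lattice N d)"
    by (auto simp: openin_subtopology openin_loop_Gr_fspace) (simp add: loop_Gr_fspace_def)
  have poly': "\<exists>q\<in>polyfun C. \<forall>x\<in>M. p (\<beta> x) = q x" if "p \<in> polyfun (frame_coords N d)" for p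
    using that by (rule polyfun_pullback) (rule poly)
  have "openin (subtopology (zariski C M) X) {x \<in> X. \<phi> x \<in> V}"
    unfolding openin_subtopology_zariski[OF X]
  proof (intro conjI ballI)
    fix x assume x: "x \<in> {x \<in> X. \<phi> x \<in> V}"
    then have "\<beta> x \<in> frames_over N d V'" using V' \<beta> by (auto simp: frames_over_def)
    then obtain p where p: "p \<in> polyfun (frame_coords N d)" "p (\<beta> x) \<noteq> 0"
      "{b \<in> Gr_frames N d. p b \<noteq> 0} \<subseteq> frames_over N d V'"
      using V'(1) unfolding Gr_open_def openin_zariski by blast
    have "\<phi> y \<in> V" if "y \<in> X" "p (\<beta> y) \<noteq> 0" for y
    proof -
      have "\<beta> y \<in> frames_over N d V'" using p(3) that \<beta> by blast
      then show ?thesis using V'(2) Y that \<beta> by (auto simp: frames_over_def)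
    qed
    moreover obtain r where "r \<in> polyfun C" "\<forall>x\<in>M. p (\<beta> x) = r x"
      using poly'[OF p(1)] by blast
    ultimately show "\<exists>p\<in>polyfun C. p x \<noteq> 0 \<and> {y \<in> X. p y \<noteq> 0} \<subseteq> {x \<in> X. \<phi> x \<in> V}"
      using p(2) x X by (intro bexI[of _ r]) auto
  qed auto
  then show "openin (subtopology (ztop (affine_fspace C M)) X) {x \<in> X. \<phi> x \<in> V}"
    by (simp add: affine_fspace_def)
  have "regular_on C {x \<in> X. \<phi> x \<in> V} (\<lambda>x. (f \<circ> frame_lattice N d) (\<beta> x))"
    using f
  proof (rule regular_on_comp)
    fix c :: "(nat \<Rightarrow> 'b lvec) \<Rightarrow> complex" assume "c \<in> frame_coords N d"
    then obtain p where "p \<in> polyfun C" "\<forall>x\<in>M. c (\<beta> x) = p x" using poly by blast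
    then show "regular_on C {x \<in> X. \<phi> x \<in> V} (\<lambda>x. c (\<beta> x))"
      using X by (intro regular_on_cong[OF regular_on_polyfun[of p C "{x \<in> X. \<phi> x \<in> V}"]]) auto
  qed (auto simp: frames_over_def \<beta>)
  then have "regular_on C {x \<in> X. \<phi> x \<in> V} (f \<circ> \<phi>)"
    by (rule regular_on_cong) (auto simp: \<beta>)
  then show "regfun (affine_fspace C M) {x \<in> X. \<phi> x \<in> V} (f \<circ> \<phi>)"
    by (simp add: affine_fspace_def)
qed

text \<open>A relatively open subset of \<open>Y\<close> must be cut out by an open set of the whole
  Grassmannian. The coordinates of \<open>\<phi>\<close> are therefore extended to functions
  \<open>\<kappa>\<close> regular on an open set around \<open>Y\<close>, where
  \<open>\<phi>\<close> itself need not make sense.\<close>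

lemma fspace_morphism_from_loop_Gr:
  assumes X: "X \<subseteq> M" and Y: "\<phi> ` Y \<subseteq> X" and W: "Gr_open W" "Y \<subseteq> W"
    and reg: "\<And>c N d. c \<in> C \<Longrightarrow>
      regular_on (frame_coords N d) (frames_over N d W) (\<lambda>b. \<kappa> c (frame_lattice N d b))"
    and \<kappa>: "\<And>c L. c \<in> C \<Longrightarrow> L \<in> Y \<Longrightarrow> \<kappa> c L = c (\<phi> L)"
  shows "fspace_morphism loop_Gr_fspace Y (affine_fspace C M) X \<phi>"
  unfolding fspace_morphism_def
proof (intro conjI allI impI Y)
  fix V f
  assume "openin (subtopology (ztop (affine_fspace C M)) X) V \<and> regfun (affine_fspace C M) V f"
  then have V: "openin (subtopology (zariski C M) X) V" and f: "regular_on C V f"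
    by (auto simp: affine_fspace_def)
  have ext: "\<exists>q. (\<forall>N d. regular_on (frame_coords N d) (frames_over N d W) (\<lambda>b. q (frame_lattice N d b))) \<and>
      (\<forall>L\<in>Y. q L = p (\<phi> L))" if "p \<in> polyfun C" for p
    using that
  proof induction
    case (const c)
    show ?case by (intro exI[of _ "\<lambda>_. c"]) (auto intro: regular_on_polyfun polyfun.const)
  next
    case (coord c)
    then show ?case by (intro exI[of _ "\<kappa> c"]) (auto intro: reg \<kappa>)
  next
    case (add p q)
    then obtain p' q' where "\<And>N d. regular_on (frame_coords N d) (frames_over N d W) (\<lambda>b. p' (frame_lattice N d b))"
        "\<And>L. L \<in> Y \<Longrightarrow> p' L = p (\<phi> L)"
        "\<And>N d. regular_on (frame_coords N d) (frames_over N d W) (\<lambda>b. q' (frame_lattice N d b))"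
        "\<And>L. L \<in> Y \<Longrightarrow> q' L = q (\<phi> L)" by blast
    then show ?case by (intro exI[of _ "\<lambda>L. p' L + q' L"]) (auto intro: regular_on_add)
  next
    case (mult p q)
    then obtain p' q' where "\<And>N d. regular_on (frame_coords N d) (frames_over N d W) (\<lambda>b. p' (frame_lattice N d b))"
        "\<And>L. L \<in> Y \<Longrightarrow> p' L = p (\<phi> L)"
        "\<And>N d. regular_on (frame_coords N d) (frames_over N d W) (\<lambda>b. q' (frame_lattice N d b))"
        "\<And>L. L \<in> Y \<Longrightarrow> q' L = q (\<phi> L)" by blast
    then show ?case by (intro exI[of _ "\<lambda>L. p' L * q' L"]) (auto intro: regular_on_mult)
  qed
  \<comment> \<open>All nonvanishing loci of regular functions on \<open>W\<close> that meet
    \<open>Y\<close> inside the preimage of \<open>V\<close>; their union is the open set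
    required.\<close>
  define K where "K = {{L \<in> W. q L \<noteq> 0} |q.
     (\<forall>N d. regular_on (frame_coords N d) (frames_over N d W) (\<lambda>b. q (frame_lattice N d b))) \<and>
     (\<forall>L\<in>Y. q L \<noteq> 0 \<longrightarrow> \<phi> L \<in> V)}"
  have "Gr_open (\<Union>K)"
    unfolding K_def by (rule Gr_open_Union) (auto intro: Gr_open_nonzero[OF W(1)])
  moreover have "{L \<in> Y. \<phi> L \<in> V} = \<Union>K \<inter> Y"
  proof (intro equalityI subsetI)
    fix L assume L: "L \<in> {L \<in> Y. \<phi> L \<in> V}"
    then obtain p where p: "p \<in> polyfun C" "p (\<phi> L) \<noteq> 0" "{y \<in> X. p y \<noteq> 0} \<subseteq> V"
      using V unfolding openin_subtopology_zariski[OF X] by blast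
    obtain q where q: "\<forall>N d. regular_on (frame_coords N d) (frames_over N d W) (\<lambda>b. q (frame_lattice N d b))"
      "\<forall>L\<in>Y. q L = p (\<phi> L)" using ext[OF p(1)] by blast
    have "\<forall>L\<in>Y. q L \<noteq> 0 \<longrightarrow> \<phi> L \<in> V" using q(2) p(3) Y by auto
    with q(1) have "{L \<in> W. q L \<noteq> 0} \<in> K" unfolding K_def by auto
    moreover have "L \<in> {L \<in> W. q L \<noteq> 0}" using L q(2) p(2) W(2) by auto
    ultimately show "L \<in> \<Union>K \<inter> Y" using L by blast
  qed (auto simp: K_def)
  ultimately show "openin (subtopology (ztop loop_Gr_fspace) Y) {L \<in> Y. \<phi> L \<in> V}"
    by (auto simp: openin_subtopology openin_loop_Gr_fspace)
  have "regular_on (frame_coords N d) (frames_over N d {L \<in> Y. \<phi> L \<in> V})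
      (\<lambda>b. f (\<phi> (frame_lattice N d b)))" for N d
  proof (rule regular_on_comp[OF f])
    fix c assume c: "c \<in> C"
    show "regular_on (frame_coords N d) (frames_over N d {L \<in> Y. \<phi> L \<in> V}) (\<lambda>b. c (\<phi> (frame_lattice N d b)))"
      by (rule regular_on_cong[OF reg[OF c, of N d]]) (use W(2) \<kappa>[OF c] in \<open>auto simp: frames_over_def\<close>)
  qed (simp add: frames_over_def)
  then show "regfun loop_Gr_fspace {L \<in> Y. \<phi> L \<in> V} (f \<circ> \<phi>)"
    by (simp add: loop_Gr_fspace_def comp_def)
qed

section \<open>Frames and the chart\<close>

text \<open>\<open>basis_mod\<close> asserts unique coordinates, which forces extensional
  coefficient functions. Spanning and independence with arbitrary coefficients are easier to carry
  along linear maps.\<close>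

lemma basis_mod_iff:
  assumes W: "cv.subspace W" and I: "finite I"
  shows "basis_mod I b W L \<longleftrightarrow> b ` I \<subseteq> L \<and>
    (\<forall>v\<in>L. \<exists>c. v - (\<Sum>i\<in>I. cmul (c i) (b i)) \<in> W) \<and>
    (\<forall>c. (\<Sum>i\<in>I. cmul (c i) (b i)) \<in> W \<and> L \<noteq> {} \<longrightarrow> (\<forall>i\<in>I. c i = 0))" (is "?l \<longleftrightarrow> ?r")
proof
  have diff: "(\<Sum>i\<in>I. cmul (c i) (b i)) - (\<Sum>i\<in>I. cmul (c' i) (b i))
      = (\<Sum>i\<in>I. cmul (c i - c' i) (b i))" for c c'
    by (simp add: sum_subtractf cv.scale_left_diff_distrib)
  have restr: "(\<Sum>i\<in>I. cmul (restrict c I i) (b i)) = (\<Sum>i\<in>I. cmul (c i) (b i))" for c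
    by (intro sum.cong) auto
  {
    assume l: ?l
    have "\<forall>i\<in>I. c i = 0" if c: "(\<Sum>i\<in>I. cmul (c i) (b i)) \<in> W" and "L \<noteq> {}" for c
    proof -
      obtain v where "v \<in> L" using \<open>L \<noteq> {}\<close> by blast
      with l have "\<exists>!c. c \<in> I \<rightarrow>\<^sub>E UNIV \<and> v - (\<Sum>i\<in>I. cmul (c i) (b i)) \<in> W"
        unfolding basis_mod_def by (elim conjE bspec)
      then show ?thesis
      proof (rule ex1E)
        fix a assume a: "a \<in> I \<rightarrow>\<^sub>E UNIV \<and> v - (\<Sum>i\<in>I. cmul (a i) (b i)) \<in> W"
          and uniq: "\<forall>a'. a' \<in> I \<rightarrow>\<^sub>E UNIV \<and> v - (\<Sum>i\<in>I. cmul (a' i) (b i)) \<in> W \<longrightarrow> a' = a"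
        let ?a = "restrict (\<lambda>i. a i + c i) I"
        have "v - (\<Sum>i\<in>I. cmul (?a i) (b i)) =
            (v - (\<Sum>i\<in>I. cmul (a i) (b i))) - (\<Sum>i\<in>I. cmul (c i) (b i))"
          unfolding restr by (simp add: cv.scale_left_distrib sum.distrib)
        also have "\<dots> \<in> W" by (rule cv.subspace_diff[OF W conjunct2[OF a] c])
        finally have "v - (\<Sum>i\<in>I. cmul (?a i) (b i)) \<in> W" .
        moreover have "?a \<in> I \<rightarrow>\<^sub>E UNIV" by simp
        ultimately have "?a = a" using uniq by blast
        then have ai: "?a i = a i" for i by (rule fun_cong)
        show "\<forall>i\<in>I. c i = 0"
        proof
          fix i assume "i \<in> I"
          then show "c i = 0" using ai[of i] by simp
        qed
      qed
    qed
    moreover have "\<exists>c. v - (\<Sum>i\<in>I. cmul (c i) (b i)) \<in> W" if "v \<in> L" for v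
    proof -
      have "\<exists>!c. c \<in> I \<rightarrow>\<^sub>E UNIV \<and> v - (\<Sum>i\<in>I. cmul (c i) (b i)) \<in> W"
        using l that unfolding basis_mod_def by (elim conjE bspec)
      then show ?thesis by (elim ex1E conjE) (rule exI)
    qed
    moreover have "b ` I \<subseteq> L" using l by (simp add: basis_mod_def)
    ultimately show ?r by simp
  }
  assume r: ?r
  have "\<exists>!c. c \<in> I \<rightarrow>\<^sub>E UNIV \<and> v - (\<Sum>i\<in>I. cmul (c i) (b i)) \<in> W" if v: "v \<in> L" for v
  proof -
    obtain c where c: "v - (\<Sum>i\<in>I. cmul (c i) (b i)) \<in> W"
      using r v by (elim conjE ballE exE) auto
    show ?thesis
    proof (rule ex1I[of _ "restrict c I"])
      show "restrict c I \<in> I \<rightarrow>\<^sub>E UNIV \<and> v - (\<Sum>i\<in>I. cmul (restrict c I i) (b i)) \<in> W"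
        using c unfolding restr by auto
      fix c' assume c': "c' \<in> I \<rightarrow>\<^sub>E UNIV \<and> v - (\<Sum>i\<in>I. cmul (c' i) (b i)) \<in> W"
      have "(\<Sum>i\<in>I. cmul (c i - c' i) (b i)) =
          (v - (\<Sum>i\<in>I. cmul (c' i) (b i))) - (v - (\<Sum>i\<in>I. cmul (c i) (b i)))"
        unfolding diff[symmetric] by simp
      also have "\<dots> \<in> W" by (rule cv.subspace_diff[OF W conjunct2[OF c'] c])
      finally have "(\<Sum>i\<in>I. cmul (c i - c' i) (b i)) \<in> W" .
      moreover have "L \<noteq> {}" using v by blast
      ultimately have eq: "\<forall>i\<in>I. c i - c' i = 0"
        using r by (elim conjE) (drule spec[of _ "\<lambda>i. c i - c' i"], simp)
      show "c' = restrict c I"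
      proof (rule extensionalityI[of _ I])
        show "c' \<in> extensional I" using c' by (auto simp: PiE_def)
      qed (use eq in auto)
    qed
  qed
  moreover have "b ` I \<subseteq> L" using r by (rule conjunct1)
  ultimately show ?l unfolding basis_mod_def by (intro conjI ballI)
qed

lemma basis_mod_subset: "basis_mod I b W L \<Longrightarrow> i \<in> I \<Longrightarrow> b i \<in> L"
  by (auto simp: basis_mod_def)

lemma basis_mod_span:
  assumes "basis_mod I b W L" "v \<in> L" obtains c where "v - (\<Sum>i\<in>I. cmul (c i) (b i)) \<in> W"
proof -
  have "\<exists>!c. c \<in> I \<rightarrow>\<^sub>E UNIV \<and> v - (\<Sum>i\<in>I. cmul (c i) (b i)) \<in> W"
    using assms unfolding basis_mod_def by (elim conjE bspec)
  then show ?thesis by (elim ex1E conjE) (rule that)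
qed

lemma basis_mod_indep:
  assumes "basis_mod I b W L" "cv.subspace W" "finite I" "L \<noteq> {}" "(\<Sum>i\<in>I. cmul (c i) (b i)) \<in> W" "i \<in> I"
  shows "c i = 0"
proof -
  have "\<forall>c. (\<Sum>i\<in>I. cmul (c i) (b i)) \<in> W \<and> L \<noteq> {} \<longrightarrow> (\<forall>i\<in>I. c i = 0)"
    using assms(1) unfolding basis_mod_iff[OF assms(2,3)] by (elim conjE)
  then show ?thesis using assms(4-6) by simp
qed

lemma basis_mod_reindex:
  assumes W: "cv.subspace W" "finite I" and f: "bij_betw f K I" and b: "basis_mod I b W L"
  shows "basis_mod K (\<lambda>k. b (f k)) W L"
proof -
  have K: "finite K" using f W(2) bij_betw_finite by blast
  have sum: "(\<Sum>k\<in>K. cmul (c k) (b (f k))) = (\<Sum>i\<in>I. cmul (c (inv_into K f i)) (b i))" for c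
    using f by (subst sum.reindex_bij_betw[OF f, symmetric])
      (auto intro!: sum.cong simp: bij_betw_inv_into_left[OF f])
  have sum': "(\<Sum>i\<in>I. cmul (c i) (b i)) = (\<Sum>k\<in>K. cmul (c (f k)) (b (f k)))" for c
    by (rule sum.reindex_bij_betw[OF f, symmetric])
  show ?thesis
    unfolding basis_mod_iff[OF W(1) K]
  proof (intro conjI ballI allI impI)
    show "(\<lambda>k. b (f k)) ` K \<subseteq> L" using b f by (auto simp: basis_mod_def bij_betw_def)
    fix v assume "v \<in> L"
    then obtain c where "v - (\<Sum>i\<in>I. cmul (c i) (b i)) \<in> W" using b by (elim basis_mod_span)
    then show "\<exists>c. v - (\<Sum>k\<in>K. cmul (c k) (b (f k))) \<in> W"
      unfolding sum' by (rule exI[of _ "\<lambda>k. c (f k)"])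
  next
    fix c k
    assume "(\<Sum>k\<in>K. cmul (c k) (b (f k))) \<in> W \<and> L \<noteq> {}" and k: "k \<in> K"
    moreover have fk: "f k \<in> I" using f k by (auto simp: bij_betw_def)
    ultimately have "c (inv_into K f (f k)) = 0"
      unfolding sum using basis_mod_indep[OF b W(1) W(2) _ _ fk, of "\<lambda>i. c (inv_into K f i)"] by blast
    then show "c k = 0" using bij_betw_inv_into_left[OF f k] by simp
  qed
qed

text \<open>The conditions say that \<open>T\<close> induces an isomorphism
  \<open>L1/W1 \<rightarrow> L2/W2\<close>. Linearity is asked on \<open>L1\<close> only, because
  the operators below are linear only there.\<close>

lemma basis_mod_transport:
  assumes W: "cv.subspace W1" "cv.subspace W2" "finite I" and L1: "cv.subspace L1"
    and T: "\<And>v w. v \<in> L1 \<Longrightarrow> w \<in> L1 \<Longrightarrow> T (v + w) = T v + T w"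
      "\<And>c v. v \<in> L1 \<Longrightarrow> T (cmul c v) = cmul c (T v)"
    and L2: "\<And>v. v \<in> L1 \<Longrightarrow> T v \<in> L2"
    and ker: "\<And>v. v \<in> L1 \<Longrightarrow> T v \<in> W2 \<longleftrightarrow> v \<in> W1"
    and surj: "\<And>w. w \<in> L2 \<Longrightarrow> \<exists>v\<in>L1. w - T v \<in> W2"
    and b: "basis_mod I b W1 L1"
  shows "basis_mod I (\<lambda>i. T (b i)) W2 L2"
proof -
  have bL: "b i \<in> L1" if "i \<in> I" for i using b that by (rule basis_mod_subset)
  have T0: "T 0 = 0" using T(2)[OF cv.subspace_0[OF L1], of 0] by simp
  have sumL: "(\<Sum>i\<in>I'. cmul (c i) (b i)) \<in> L1" if "I' \<subseteq> I" for c I'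
    using that bL by (intro cv.subspace_sum[OF L1] cv.subspace_scale[OF L1]) auto
  have "finite I' \<Longrightarrow> I' \<subseteq> I \<Longrightarrow> T (\<Sum>i\<in>I'. cmul (c i) (b i)) = (\<Sum>i\<in>I'. cmul (c i) (T (b i)))" for I' c
    by (induction I' rule: finite_induct)
       (auto simp: T0 T(2)[OF bL] T(1)[OF cv.subspace_scale[OF L1 bL] sumL])
  from this[OF W(3) order.refl]
  have Tsum: "T (\<Sum>i\<in>I. cmul (c i) (b i)) = (\<Sum>i\<in>I. cmul (c i) (T (b i)))" for c .
  have Tdiff: "T (v - w) = T v - T w" if "v \<in> L1" "w \<in> L1" for v w
    using T(1)[OF cv.subspace_diff[OF L1 that] that(2)] by (simp add: eq_diff_eq)
  show ?thesis
    unfolding basis_mod_iff[OF W(2,3)]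
  proof (intro conjI ballI allI impI)
    show "(\<lambda>i. T (b i)) ` I \<subseteq> L2" using bL L2 by auto
    fix w assume "w \<in> L2"
    then obtain v where v: "v \<in> L1" "w - T v \<in> W2" using surj by blast
    obtain c where c: "v - (\<Sum>i\<in>I. cmul (c i) (b i)) \<in> W1" using b v(1) by (rule basis_mod_span)
    have "T (v - (\<Sum>i\<in>I. cmul (c i) (b i))) \<in> W2"
      using c ker[OF cv.subspace_diff[OF L1 v(1) sumL]] by blast
    then have "(w - T v) + (T v - (\<Sum>i\<in>I. cmul (c i) (T (b i)))) \<in> W2"
      using v(2) Tdiff[OF v(1) sumL] Tsum by (intro cv.subspace_add[OF W(2)]) auto
    then show "\<exists>c. w - (\<Sum>i\<in>I. cmul (c i) (T (b i))) \<in> W2" by auto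
  next
    fix c i
    assume *: "(\<Sum>i\<in>I. cmul (c i) (T (b i))) \<in> W2 \<and> L2 \<noteq> {}" and i: "i \<in> I"
    then have "(\<Sum>i\<in>I. cmul (c i) (b i)) \<in> W1"
      using ker[OF sumL[OF order.refl], of c] Tsum by simp
    moreover have "L1 \<noteq> {}" using cv.subspace_0[OF L1] by blast
    ultimately show "c i = 0" using basis_mod_indep[OF b W(1,3) _ _ i] by blast
  qed
qed

section \<open>Frames and the lattices they span\<close>

lemma frame_lattice_unique:
  assumes "cv.subspace L" "z_lattice (int N) \<subseteq> L" "basis_mod {..<d} b (z_lattice (int N)) L"
  shows "frame_lattice N d b = L"
proof (intro equalityI subsetI)
  fix v assume "v \<in> frame_lattice N d b"
  then obtain c where "v - (\<Sum>a<d. cmul (c a) (b a)) \<in> z_lattice (int N)"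
    by (auto simp: frame_lattice_def)
  moreover have "(\<Sum>a<d. cmul (c a) (b a)) \<in> L"
    using basis_mod_subset[OF assms(3)]
    by (intro cv.subspace_sum[OF assms(1)] cv.subspace_scale[OF assms(1)]) auto
  ultimately have "(v - (\<Sum>a<d. cmul (c a) (b a))) + (\<Sum>a<d. cmul (c a) (b a)) \<in> L"
    using assms(2) by (intro cv.subspace_add[OF assms(1)]) auto
  then show "v \<in> L" by simp
next
  fix v assume "v \<in> L"
  then show "v \<in> frame_lattice N d b"
    using assms(3) by (auto simp: frame_lattice_def elim: basis_mod_span)
qed

lemma Gr_piece_subspace: "L \<in> Gr_piece N \<Longrightarrow> cv.subspace L"
  using loop_Gr_zsub by (auto simp: Gr_piece_def zsub_def)

lemma Gr_framesD:
  assumes "b \<in> Gr_frames N d"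
  shows "frame_lattice N d b \<in> Gr_piece N"
    and "basis_mod {..<d} b (z_lattice (int N)) (frame_lattice N d b)"
proof -
  obtain L where L: "L \<in> Gr_piece N" "basis_mod {..<d} b (z_lattice (int N)) L"
    using assms by (auto simp: Gr_frames_def)
  moreover have "frame_lattice N d b = L"
    using L by (intro frame_lattice_unique Gr_piece_subspace) (auto simp: Gr_piece_def)
  ultimately show "frame_lattice N d b \<in> Gr_piece N"
    "basis_mod {..<d} b (z_lattice (int N)) (frame_lattice N d b)" by auto
qed

text \<open>To compare \<open>L\<close> with \<^term>\<open>std_lattice \<sigma>\<close>, a frame of \<open>L\<close> modulo \<open>z\<^sup>N L\<^sub>0\<close> is extended by
  monomials to a frame modulo \<open>z\<^sup>N\<^sup>' L\<^sub>0\<close> for some \<open>N'\<close> with \<open>z\<^sup>N\<^sup>' L\<^sub>0 \<subseteq> L\<^sub>\<sigma>\<close>.\<close>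

definition ext_frame :: "nat \<Rightarrow> (nat \<Rightarrow> ('m::finite) lvec) \<Rightarrow> nat + 'm \<times> int \<Rightarrow> 'm lvec" where
  "ext_frame N b k = (case k of Inl a \<Rightarrow> filt (\<lambda>_ m. - int N \<le> m \<and> m < int N) (b a) | Inr p \<Rightarrow> mon (fst p) (snd p))"

definition ext_index :: "nat \<Rightarrow> nat \<Rightarrow> int \<Rightarrow> (nat + ('m::finite) \<times> int) set" where
  "ext_index N d N' = Inl ` {..<d} \<union> Inr ` (UNIV \<times> {int N..<N'})"

lemma finite_ext_index: "finite (ext_index N d N')"
  by (simp add: ext_index_def)

lemma sum_ext_index:
  "(\<Sum>k\<in>ext_index N d N'. f k) = (\<Sum>a<d. f (Inl a)) + (\<Sum>p\<in>UNIV \<times> {int N..<N'}. f (Inr p))"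
  unfolding ext_index_def by (subst sum.union_disjoint) (auto simp: sum.reindex)

lemma ext_frame_polyfun:
  assumes "k \<in> ext_index N d N'"
  shows "(\<lambda>b. coef (ext_frame N b k) i m) \<in> polyfun (frame_coords N d)"
proof (cases k)
  case (Inl a)
  then have a: "a < d" using assms by (auto simp: ext_index_def)
  show ?thesis
  proof (cases "- int N \<le> m \<and> m < int N")
    case True
    then have "(\<lambda>b. fls_nth (b a $ i) m) \<in> polyfun (frame_coords N d)"
      using a by (intro polyfun.coord) (auto simp: frame_coords_def)
    then show ?thesis using True by (simp add: ext_frame_def Inl) (simp add: coef_def)
  next
    case False
    then have "(\<lambda>b. coef (ext_frame N b k) i m) = (\<lambda>_. 0)"
      by (auto simp: ext_frame_def Inl fun_eq_iff)
    then show ?thesis by (simp add: polyfun.const)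
  qed
qed (simp add: ext_frame_def polyfun.const)

text \<open>\<open>L / z^N'\<close> is an extension of \<open>L / z^N\<close> by
  \<open>z^N / z^N'\<close>, and the latter has a basis of monomials. Cutting the frame to exponents
  from \<open>- N\<close> to \<open>N - 1\<close> changes it by \<open>z_lattice (int N)\<close>
  only and makes its coefficients coordinate functions.\<close>

lemma basis_mod_ext_frame:
  fixes b :: "nat \<Rightarrow> ('m::finite) lvec"
  assumes b: "b \<in> Gr_frames N d" and N': "int N \<le> N'"
  shows "basis_mod (ext_index N d N') (ext_frame N b) (z_lattice N') (frame_lattice N d b)"
proof -
  let ?L = "frame_lattice N d b" and ?E = "UNIV \<times> {int N..<N'}"
  note bm = Gr_framesD(2)[OF b]
  have L: "?L \<in> Gr_piece N" by (rule Gr_framesD(1)[OF b])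
  note sub = Gr_piece_subspace[OF L]
  have zL: "z_lattice (int N) \<subseteq> ?L" "?L \<subseteq> z_lattice (- int N)" using L by (auto simp: Gr_piece_def)
  have bL: "b a \<in> ?L" if "a < d" for a using basis_mod_subset[OF bm] that by simp
  have diff: "b a - ext_frame N b (Inl a) \<in> z_lattice (int N)" if "a < d" for a
  proof -
    have "b a \<in> z_lattice (- int N)" using bL[OF that] zL(2) by blast
    then show ?thesis by (auto simp: z_lattice_iff ext_frame_def)
  qed
  have monz: "mon i m \<in> z_lattice (int N)" if "int N \<le> m" for i :: 'm and m
    using that by (auto simp: z_lattice_iff coef_mon)
  have sumE: "(\<Sum>p\<in>?E. cmul (c p) (ext_frame N b (Inr p))) \<in> z_lattice (int N)" for c
    by (intro cv.subspace_sum[OF subspace_z_lattice] cv.subspace_scale[OF subspace_z_lattice])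
      (auto simp: ext_frame_def intro: monz)
  have sumD: "(\<Sum>a<d. cmul (c a) (b a)) - (\<Sum>a<d. cmul (c a) (ext_frame N b (Inl a))) \<in> z_lattice (int N)" for c
    unfolding sum_subtractf[symmetric] cv.scale_right_diff_distrib[symmetric] using diff
    by (intro cv.subspace_sum[OF subspace_z_lattice] cv.subspace_scale[OF subspace_z_lattice]) auto
  have coef_sumE: "coef (\<Sum>p\<in>?E. cmul (c p) (ext_frame N b (Inr p))) i m = (if (i, m) \<in> ?E then c (i, m) else 0)" for c i m
  proof -
    have "coef (\<Sum>p\<in>?E. cmul (c p) (ext_frame N b (Inr p))) i m = (\<Sum>p\<in>?E. if p = (i, m) then c (i, m) else 0)"
      unfolding coef_sum by (intro sum.cong) (auto simp: ext_frame_def coef_mon)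
    then show ?thesis by simp
  qed
  show ?thesis
    unfolding basis_mod_iff[OF subspace_z_lattice finite_ext_index] sum_ext_index
  proof (intro conjI ballI allI impI)
    show "ext_frame N b ` ext_index N d N' \<subseteq> ?L"
    proof
      fix x assume "x \<in> ext_frame N b ` ext_index N d N'"
      then consider a where "a < d" "x = ext_frame N b (Inl a)"
        | p where "p \<in> ?E" "x = ext_frame N b (Inr p)" by (auto simp: ext_index_def)
      then show "x \<in> ?L"
      proof cases
        case (1 a)
        have "b a - (b a - ext_frame N b (Inl a)) \<in> ?L"
          using bL[OF 1(1)] subsetD[OF zL(1) diff[OF 1(1)]] by (rule cv.subspace_diff[OF sub])
        then show ?thesis using 1 by simp
      next
        case (2 p)
        then show ?thesis using monz zL(1) by (auto simp: ext_frame_def)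
      qed
    qed
    fix v assume "v \<in> ?L"
    then obtain c where c: "v - (\<Sum>a<d. cmul (c a) (b a)) \<in> z_lattice (int N)"
      using bm by (elim basis_mod_span)
    define r where "r = v - (\<Sum>a<d. cmul (c a) (ext_frame N b (Inl a)))"
    have "(v - (\<Sum>a<d. cmul (c a) (b a))) +
      ((\<Sum>a<d. cmul (c a) (b a)) - (\<Sum>a<d. cmul (c a) (ext_frame N b (Inl a)))) \<in> z_lattice (int N)"
      using c sumD by (rule cv.subspace_add[OF subspace_z_lattice])
    then have r: "r \<in> z_lattice (int N)" by (simp add: r_def)
    define c' where "c' = case_sum c (\<lambda>p. coef r (fst p) (snd p))"
    have "v - ((\<Sum>a<d. cmul (c' (Inl a)) (ext_frame N b (Inl a))) +
        (\<Sum>p\<in>?E. cmul (c' (Inr p)) (ext_frame N b (Inr p)))) =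
        r - (\<Sum>p\<in>?E. cmul (coef r (fst p) (snd p)) (ext_frame N b (Inr p)))"
      by (simp add: c'_def r_def)
    also have "\<dots> \<in> z_lattice N'"
      unfolding z_lattice_iff coef_diff coef_sumE using r by (auto simp: z_lattice_iff)
    finally show "\<exists>c. v - ((\<Sum>a<d. cmul (c (Inl a)) (ext_frame N b (Inl a))) +
        (\<Sum>p\<in>?E. cmul (c (Inr p)) (ext_frame N b (Inr p)))) \<in> z_lattice N'" by blast
  next
    fix c and k :: "nat + 'm \<times> int"
    let ?s = "\<Sum>a<d. cmul (c (Inl a)) (ext_frame N b (Inl a))" and
        ?t = "\<Sum>p\<in>?E. cmul (c (Inr p)) (ext_frame N b (Inr p))"
    assume *: "?s + ?t \<in> z_lattice N' \<and> ?L \<noteq> {}" and k: "k \<in> ext_index N d N'"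
    have "?s + ?t \<in> z_lattice (int N)" using * z_lattice_mono[OF N'] by blast
    then have "(\<Sum>a<d. cmul (c (Inl a)) (b a)) \<in> z_lattice (int N)"
      using sumE[of "\<lambda>p. c (Inr p)"] sumD[of "\<lambda>a. c (Inl a)"] by (simp add: z_lattice_iff)
    then have cl: "c (Inl a) = 0" if "a < d" for a
      using basis_mod_indep[OF bm subspace_z_lattice, of "\<lambda>a. c (Inl a)" a] * that by auto
    then have t: "?t \<in> z_lattice N'" using * by simp
    have cr: "c (Inr p) = 0" if p: "p \<in> ?E" for p
    proof -
      have "coef ?t (fst p) (snd p) = 0" using t p by (auto simp: z_lattice_iff)
      then show ?thesis unfolding coef_sumE using p by simp
    qed
    show "c k = 0" using k cl cr by (auto simp: ext_index_def)
  qed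
qed

text \<open>Modulo \<open>z^N'\<close> the projection of \<open>L\<close> to
  \<open>L_\<sigma>\<close> has as its matrix \<open>M\<close> the coefficients of an extended frame
  at the exponents of \<open>L_\<sigma>\<close>. The lattice lies in the chart where
  \<open>M\<close> is invertible, and the inverse gives the coordinates of the lifted monomials in
  the frame.\<close>

lemma chart_local:
  fixes \<sigma> :: "'m::finite \<Rightarrow> int"
  assumes b0: "b0 \<in> Gr_frames N d" and chart0: "frame_lattice N d b0 \<in> Gr_chart \<sigma>"
    and n0: "- \<sigma> j0 \<le> n0"
  obtains \<delta> q where "\<delta> \<in> polyfun (frame_coords N d)" "q \<in> polyfun (frame_coords N d)" "\<delta> b0 \<noteq> 0"
    "\<And>b. b \<in> Gr_frames N d \<Longrightarrow> \<delta> b \<noteq> 0 \<Longrightarrow> frame_lattice N d b \<in> Gr_chart \<sigma> \<and>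
      coef (hlift \<sigma> (frame_lattice N d b) (mon j0 n0)) i0 m0 = q b / \<delta> b"
proof -
  \<comment> \<open>Large enough to extend the frame, to have \<open>z^N'\<close> inside
    \<open>L_\<sigma>\<close>, and to keep \<open>(j0, n0)\<close> among the indices.\<close>
  define N' where "N' = Max ({int N, n0 + 1} \<union> range (\<lambda>i. - \<sigma> i))"
  have N': "int N \<le> N'" "n0 < N'" "- \<sigma> i \<le> N'" for i
  proof -
    have fin: "finite ({int N, n0 + 1} \<union> range (\<lambda>i. - \<sigma> i))" by simp
    have "n0 + 1 \<le> N'" unfolding N'_def by (rule Max_ge[OF fin]) simp
    then show "n0 < N'" by simp
    show "int N \<le> N'" "- \<sigma> i \<le> N'" unfolding N'_def by (rule Max_ge[OF fin]; simp)+
  qed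
  define I where "I = (SIGMA i:UNIV. {- \<sigma> i..<N'})"
  have I: "(i, m) \<in> I \<longleftrightarrow> - \<sigma> i \<le> m \<and> m < N'" for i m by (simp add: I_def)
  have finI: "finite I" by (simp add: I_def)
  define K where "K = (ext_index N d N' :: (nat + 'm \<times> int) set)"
  have finK: "finite K" by (simp add: K_def finite_ext_index)
  define M where "M p k b = coef (ext_frame N b k) (fst p) (snd p)"
    for p :: "'m \<times> int" and k and b :: "nat \<Rightarrow> 'm lvec"
  have ext: "basis_mod K (ext_frame N b) (z_lattice N') (frame_lattice N d b)"
    if "b \<in> Gr_frames N d" for b :: "nat \<Rightarrow> 'm lvec"
    unfolding K_def using that N'(1) by (rule basis_mod_ext_frame)
  let ?L0 = "frame_lattice N d b0"
  have zL: "z_lattice N' \<subseteq> frame_lattice N d b" if "b \<in> Gr_frames N d" for b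
    using Gr_framesD(1)[OF that] z_lattice_mono[OF N'(1)] by (auto simp: Gr_piece_def)
  have "\<exists>c. hlift \<sigma> ?L0 (mon (fst p) (snd p)) - (\<Sum>k\<in>K. cmul (c k) (ext_frame N b0 k)) \<in> z_lattice N'" for p
    by (rule basis_mod_span[OF ext[OF b0] hlift_in[OF chart0, of "mon (fst p) (snd p)"]])
      (rule exI, assumption)
  \<comment> \<open>\<open>R\<close> is the inverse of \<open>M\<close> at \<open>b0\<close>,
    supplied by the splitting that defines the chart.\<close>
  then obtain R where R: "hlift \<sigma> ?L0 (mon (fst p) (snd p)) - (\<Sum>k\<in>K. cmul (R p k) (ext_frame N b0 k)) \<in> z_lattice N'" for p
    by metis
  have MR: "(\<Sum>k\<in>K. M p k b0 * R p' k) = (if p = p' then 1 else 0)" if p: "p \<in> I" "p' \<in> I" for p p'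
  proof -
    have "(\<Sum>k\<in>K. M p k b0 * R p' k) = coef (\<Sum>k\<in>K. cmul (R p' k) (ext_frame N b0 k)) (fst p) (snd p)"
      by (simp add: M_def mult.commute)
    also have "\<dots> = coef (hlift \<sigma> ?L0 (mon (fst p') (snd p'))) (fst p) (snd p)"
      using R[of p'] p(1) I[of "fst p" "snd p"] by (simp add: z_lattice_iff)
    also have "\<dots> = coef (mon (fst p') (snd p')) (fst p) (snd p)"
      using p(1) I[of "fst p" "snd p"] by (intro coef_hlift[OF chart0]) simp
    finally show ?thesis by (auto simp: coef_mon prod_eq_iff)
  qed
  have RM: "(\<Sum>p\<in>I. R p k * M p l b0) = (if k = l then 1 else 0)" if kl: "k \<in> K" "l \<in> K" for k l
  proof -
    define v where "v = ext_frame N b0 l"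
    have vL: "v \<in> ?L0" unfolding v_def using ext[OF b0] kl(2) by (rule basis_mod_subset)
    have hsum: "finite F \<Longrightarrow> hlift \<sigma> ?L0 (\<Sum>p\<in>F. cmul (c p) (mon (fst p) (snd p)))
        = (\<Sum>p\<in>F. cmul (c p) (hlift \<sigma> ?L0 (mon (fst p) (snd p))))" for F c
    proof (induction F rule: finite_induct)
      case empty
      show ?case by (simp add: hlift_id[OF chart0] cv.subspace_0[OF chart_subspace[OF chart0]])
    qed (simp add: hlift_add[OF chart0] hlift_cmul[OF chart0])
    define r where "r = filt (\<lambda>_ m. N' \<le> m) v"
    have rz: "r \<in> z_lattice N'" by (simp add: r_def z_lattice_iff)
    have "v = hlift \<sigma> ?L0 v" by (simp add: hlift_id[OF chart0 vL])
    \<comment> \<open>\<open>v\<close> is determined by its coefficients at exponents of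
      \<open>L_\<sigma>\<close>: those in \<open>I\<close> and those of the tail
      \<open>r\<close>.\<close>
    also have "\<dots> = hlift \<sigma> ?L0 ((\<Sum>p\<in>I. cmul (M p l b0) (mon (fst p) (snd p))) + r)"
    proof (rule hlift_cong[OF chart0])
      fix i m assume "- \<sigma> i \<le> m"
      have "coef (\<Sum>p\<in>I. cmul (M p l b0) (mon (fst p) (snd p))) i m
          = (\<Sum>p\<in>I. if p = (i, m) then coef v i m else 0)"
        unfolding coef_sum by (intro sum.cong) (auto simp: M_def coef_mon v_def)
      also have "\<dots> = (if (i, m) \<in> I then coef v i m else 0)" using finI by simp
      finally show "coef v i m = coef ((\<Sum>p\<in>I. cmul (M p l b0) (mon (fst p) (snd p))) + r) i m"
        using \<open>- \<sigma> i \<le> m\<close> I[of i m] by (auto simp: r_def)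
    qed
    also have "\<dots> = (\<Sum>p\<in>I. cmul (M p l b0) (hlift \<sigma> ?L0 (mon (fst p) (snd p)))) + r"
      using rz zL[OF b0] by (simp add: hlift_add[OF chart0] hsum finI hlift_id[OF chart0] subset_iff)
    finally have v: "v - (\<Sum>p\<in>I. cmul (M p l b0) (hlift \<sigma> ?L0 (mon (fst p) (snd p)))) = r"
      by simp
    let ?h = "\<lambda>p. hlift \<sigma> ?L0 (mon (fst p) (snd p))"
    let ?e = "\<lambda>p. \<Sum>k\<in>K. cmul (R p k) (ext_frame N b0 k)"
    have "(\<Sum>p\<in>I. cmul (M p l b0) (?h p - ?e p)) \<in> z_lattice N'"
      using R by (intro cv.subspace_sum[OF subspace_z_lattice] cv.subspace_scale[OF subspace_z_lattice])
    then have "r + (\<Sum>p\<in>I. cmul (M p l b0) (?h p - ?e p)) \<in> z_lattice N'"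
      using rz by (intro cv.subspace_add[OF subspace_z_lattice])
    moreover have "r + (\<Sum>p\<in>I. cmul (M p l b0) (?h p - ?e p)) = v - (\<Sum>p\<in>I. cmul (M p l b0) (?e p))"
      unfolding v[symmetric] by (simp add: cv.scale_right_diff_distrib sum_subtractf)
    moreover have "(\<Sum>p\<in>I. cmul (M p l b0) (?e p)) = (\<Sum>k\<in>K. cmul (\<Sum>p\<in>I. R p k * M p l b0) (ext_frame N b0 k))"
      unfolding cv.scale_sum_right cv.scale_sum_left cv.scale_scale
      by (subst sum.swap) (simp add: mult.commute)
    moreover have "v = (\<Sum>k\<in>K. cmul (if k = l then 1 else 0) (ext_frame N b0 k))"
    proof -
      have "(\<Sum>k\<in>K. cmul (if k = l then 1 else 0) (ext_frame N b0 k)) = (\<Sum>k\<in>K. if k = l then v else 0)"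
        by (intro sum.cong) (auto simp: v_def)
      then show ?thesis using kl(2) finK by simp
    qed
    ultimately have "(\<Sum>k\<in>K. cmul ((if k = l then 1 else 0) - (\<Sum>p\<in>I. R p k * M p l b0)) (ext_frame N b0 k)) \<in> z_lattice N'"
      by (simp add: cv.scale_left_diff_distrib sum_subtractf)
    note z = this
    have "?L0 \<noteq> {}" using vL by blast
    then have "(if k = l then 1 else 0) - (\<Sum>p\<in>I. R p k * M p l b0) = 0"
      by (rule basis_mod_indep[OF ext[OF b0] subspace_z_lattice finK _ z kl(1)])
    then show ?thesis by simp
  qed
  have Mpoly: "M p k \<in> polyfun (frame_coords N d)" if "k \<in> K" for p k
    using ext_frame_polyfun[of k N d N' "fst p" "snd p"] that unfolding K_def M_def[abs_def] .
  obtain \<delta> Q where \<delta>: "\<delta> \<in> polyfun (frame_coords N d)" "\<delta> b0 \<noteq> 0"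
    and Q: "\<And>k p. k \<in> K \<Longrightarrow> p \<in> I \<Longrightarrow> Q k p \<in> polyfun (frame_coords N d)"
    and MQ: "\<And>b p p'. p \<in> I \<Longrightarrow> p' \<in> I \<Longrightarrow> (\<Sum>k\<in>K. M p k b * Q k p' b) = (if p = p' then \<delta> b else 0)"
    and QM: "\<And>b k l. k \<in> K \<Longrightarrow> l \<in> K \<Longrightarrow> (\<Sum>p\<in>I. Q k p b * M p l b) = (if k = l then \<delta> b else 0)"
    by (rule polyfun_matrix_inverse[OF finI finK, where M = M and R = "\<lambda>k p. R p k"
          and C = "frame_coords N d" and ?x0.0 = b0])
      (use Mpoly MR RM in \<open>assumption | blast\<close>)+
  define q where "q b = (\<Sum>k\<in>K. Q k (j0, n0) b * coef (ext_frame N b k) i0 m0)" for b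
  have j0I: "(j0, n0) \<in> I" using n0 N' by (simp add: I)
  have "q \<in> polyfun (frame_coords N d)"
  proof -
    have "(\<lambda>b. \<Sum>k\<in>K. Q k (j0, n0) b * M (i0, m0) k b) \<in> polyfun (frame_coords N d)"
      by (intro polyfun_sum polyfun.mult Q Mpoly j0I)
    then show ?thesis by (simp add: q_def[abs_def] M_def)
  qed
  moreover have "frame_lattice N d b \<in> Gr_chart \<sigma> \<and>
      coef (hlift \<sigma> (frame_lattice N d b) (mon j0 n0)) i0 m0 = q b / \<delta> b"
    if b: "b \<in> Gr_frames N d" and nz: "\<delta> b \<noteq> 0" for b
  proof -
    let ?L = "frame_lattice N d b"
    note sub = Gr_piece_subspace[OF Gr_framesD(1)[OF b]]
    have LGr: "?L \<in> loop_Gr" using Gr_framesD(1)[OF b] by (simp add: Gr_piece_def)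
    have eL: "ext_frame N b k \<in> ?L" if "k \<in> K" for k using ext[OF b] that by (rule basis_mod_subset)
    \<comment> \<open>The column of \<open>Q / \<delta>\<close> belonging to \<open>p\<close>; for
      \<open>p \<in> I\<close> it gives a vector of \<open>?L\<close> projecting to the monomial
      \<open>p\<close>.\<close>
    define y where "y p = (\<Sum>k\<in>K. cmul (Q k p b / \<delta> b) (ext_frame N b k))" for p
    have yL: "y p \<in> ?L" for p
      unfolding y_def by (intro cv.subspace_sum[OF sub] cv.subspace_scale[OF sub] eL)
    have coy: "coef (y p) i m = (\<Sum>k\<in>K. M (i, m) k b * Q k p b) / \<delta> b" for p i m
      unfolding y_def coef_sum coef_cmul M_def sum_divide_distrib by (simp add: mult.commute)
    have top: "coef (ext_frame N b k) i m = 0" if "k \<in> K" "N' \<le> m" for k i m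
      using that N'(1) by (auto simp: K_def ext_index_def ext_frame_def coef_mon)
    have ytop: "coef (y p) i m = 0" if "N' \<le> m" for p i m
      using that top by (simp add: y_def)
    have yI: "coef (y p) i m = coef (mon (fst p) (snd p)) i m" if p: "p \<in> I" and m: "- \<sigma> i \<le> m" for p i m
    proof (cases "m < N'")
      case True
      then have "(i, m) \<in> I" using m by (simp add: I)
      then show ?thesis unfolding coy using MQ[OF _ p] nz by (auto simp: coef_mon)
    next
      case False
      then show ?thesis using ytop[of m p i] p I[of "fst p" "snd p"] by (auto simp: coef_mon)
    qed
    \<comment> \<open>Injectivity of the projection uses that \<open>Q / \<delta>\<close> is a left
      inverse of \<open>M\<close>, surjectivity that it is a right inverse.\<close>
    have "?L \<inter> U_neg \<sigma> \<subseteq> {0}"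
    proof
      fix x assume x: "x \<in> ?L \<inter> U_neg \<sigma>"
      then obtain c where c: "x - (\<Sum>k\<in>K. cmul (c k) (ext_frame N b k)) \<in> z_lattice N'"
        using ext[OF b] by (elim basis_mod_span) auto
      have Mc: "(\<Sum>k\<in>K. M p k b * c k) = 0" if p: "p \<in> I" for p
      proof -
        have "coef x (fst p) (snd p) = coef (\<Sum>k\<in>K. cmul (c k) (ext_frame N b k)) (fst p) (snd p)"
          using c p I[of "fst p" "snd p"] by (simp add: z_lattice_iff)
        moreover have "coef x (fst p) (snd p) = 0" using x p I[of "fst p" "snd p"] by (simp add: U_neg_iff)
        ultimately show ?thesis by (simp add: M_def mult.commute)
      qed
      have "c l = 0" if l: "l \<in> K" for l
      proof -
        have "\<delta> b * c l = (\<Sum>k\<in>K. (if l = k then \<delta> b else 0) * c k)"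
          using l finK by (simp add: if_distrib[of "\<lambda>x. x * _"] cong: if_cong)
        also have "\<dots> = (\<Sum>k\<in>K. (\<Sum>p\<in>I. Q l p b * M p k b) * c k)"
          using QM[OF l] by simp
        also have "\<dots> = (\<Sum>p\<in>I. Q l p b * (\<Sum>k\<in>K. M p k b * c k))"
          unfolding sum_distrib_right sum_distrib_left by (subst sum.swap) (simp add: mult.assoc)
        also have "\<dots> = 0" using Mc by simp
        finally show ?thesis using nz by simp
      qed
      then have xz: "x \<in> z_lattice N'" using c by simp
      have "coef x i m = 0" for i m
        using xz x N'(3)[of i] by (cases "m < N'") (auto simp: z_lattice_iff U_neg_iff)
      then show "x \<in> {0}" by (auto intro: lvec_eqI)
    qed
    moreover have "0 \<in> ?L \<inter> U_neg \<sigma>" using cv.subspace_0[OF sub] by (simp add: U_neg_iff)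
    moreover have "w \<in> ?L + U_neg \<sigma>" for w
    proof -
      define r where "r = filt (\<lambda>_ m. N' \<le> m) w"
      define x where "x = (\<Sum>p\<in>I. cmul (coef w (fst p) (snd p)) (y p)) + r"
      have "r \<in> ?L" using zL[OF b] by (auto simp: r_def z_lattice_iff)
      then have xL: "x \<in> ?L"
        unfolding x_def by (intro cv.subspace_add[OF sub] cv.subspace_sum[OF sub] cv.subspace_scale[OF sub] yL)
      have "w - x \<in> U_neg \<sigma>"
        unfolding U_neg_iff
      proof (intro allI impI)
        fix i m assume m: "- \<sigma> i \<le> m"
        have "coef (\<Sum>p\<in>I. cmul (coef w (fst p) (snd p)) (y p)) i m =
            (\<Sum>p\<in>I. if p = (i, m) then coef w i m else 0)"
          unfolding coef_sum by (intro sum.cong) (auto simp: yI[OF _ m] coef_mon)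
        also have "\<dots> = (if (i, m) \<in> I then coef w i m else 0)" using finI by simp
        finally show "coef (w - x) i m = 0" using m by (simp add: x_def r_def I)
      qed
      then have "x + (w - x) \<in> ?L + U_neg \<sigma>" using xL by (intro set_plus_intro)
      then show ?thesis by simp
    qed
    ultimately have chart: "?L \<in> Gr_chart \<sigma>" using LGr by (auto simp: Gr_chart_def)
    have "hlift \<sigma> ?L (mon j0 n0) = y (j0, n0)"
      using yL yI[OF j0I] by (intro hlift_eqI[OF chart]) (auto simp: U_neg_iff)
    then have "coef (hlift \<sigma> ?L (mon j0 n0)) i0 m0 = q b / \<delta> b"
      by (simp add: coy q_def M_def mult.commute)
    then show ?thesis using chart by blast
  qed
  ultimately show ?thesis using that \<delta> by blast
qed

lemma Gr_open_chart: "Gr_open (Gr_chart \<sigma>)"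
  unfolding Gr_open_def
proof (intro conjI allI)
  fix N d
  show "openin (zariski (frame_coords N d) (Gr_frames N d)) (frames_over N d (Gr_chart \<sigma>))"
    unfolding openin_zariski
  proof (intro conjI ballI)
    fix b assume "b \<in> frames_over N d (Gr_chart \<sigma>)"
    then have b: "b \<in> Gr_frames N d" "frame_lattice N d b \<in> Gr_chart \<sigma>"
      by (auto simp: frames_over_def)
    obtain \<delta> where "\<delta> \<in> polyfun (frame_coords N d)" "\<delta> b \<noteq> 0"
      "\<And>b. b \<in> Gr_frames N d \<Longrightarrow> \<delta> b \<noteq> 0 \<Longrightarrow> frame_lattice N d b \<in> Gr_chart \<sigma>"
      by (rule chart_local[OF b order.refl, of undefined undefined undefined]) blast
    then show "\<exists>p\<in>polyfun (frame_coords N d). p b \<noteq> 0 \<and>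
        {y \<in> Gr_frames N d. p y \<noteq> 0} \<subseteq> frames_over N d (Gr_chart \<sigma>)"
      by (intro bexI[of _ \<delta>]) (auto simp: frames_over_def)
  qed (auto simp: frames_over_def)
qed (auto simp: Gr_chart_def)

lemma hlift_regular:
  assumes "- \<sigma> j \<le> n"
  shows "regular_on (frame_coords N d) (frames_over N d (Gr_chart \<sigma>))
    (\<lambda>b. coef (hlift \<sigma> (frame_lattice N d b) (mon j n)) i m)"
proof (rule regular_onI)
  fix b assume "b \<in> frames_over N d (Gr_chart \<sigma>)"
  then have b: "b \<in> Gr_frames N d" "frame_lattice N d b \<in> Gr_chart \<sigma>"
    by (auto simp: frames_over_def)
  obtain \<delta> q where *: "\<delta> \<in> polyfun (frame_coords N d)" "q \<in> polyfun (frame_coords N d)" "\<delta> b \<noteq> 0"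
    "\<And>b. b \<in> Gr_frames N d \<Longrightarrow> \<delta> b \<noteq> 0 \<Longrightarrow>
      coef (hlift \<sigma> (frame_lattice N d b) (mon j n)) i m = q b / \<delta> b"
    by (rule chart_local[OF b assms, of i m]) blast
  show "\<exists>p\<in>polyfun (frame_coords N d). \<exists>q\<in>polyfun (frame_coords N d). q b \<noteq> 0 \<and>
      (\<forall>y\<in>frames_over N d (Gr_chart \<sigma>). q y \<noteq> 0 \<longrightarrow>
        coef (hlift \<sigma> (frame_lattice N d y) (mon j n)) i m = p y / q y)"
    by (rule bexI[OF _ *(2)], rule bexI[OF _ *(1)]) (use * in \<open>auto simp: frames_over_def\<close>)
qed

section \<open>Polynomial dependence of lattices on operators\<close>

lemma std_lattice_monomial_basis:
  fixes \<eta> :: "'m::finite \<Rightarrow> int"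
  assumes "\<And>i. - \<eta> i \<le> N"
  shows "basis_mod (SIGMA i:UNIV. {- \<eta> i..<N}) (\<lambda>p. mon (fst p) (snd p)) (z_lattice N) (std_lattice \<eta>)"
proof -
  let ?I = "SIGMA i:UNIV. {- \<eta> i..<N}"
  have fin: "finite ?I" by simp
  have coef: "coef (\<Sum>p\<in>?I. cmul (c p) (mon (fst p) (snd p))) i m = (if (i, m) \<in> ?I then c (i, m) else 0)" for c i m
  proof -
    have "coef (\<Sum>p\<in>?I. cmul (c p) (mon (fst p) (snd p))) i m = (\<Sum>p\<in>?I. if p = (i, m) then c (i, m) else 0)"
      unfolding coef_sum by (intro sum.cong) (auto simp: coef_mon)
    then show ?thesis using fin by simp
  qed
  show ?thesis
    unfolding basis_mod_iff[OF subspace_z_lattice fin]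
  proof (intro conjI ballI allI impI)
    show "(\<lambda>p. mon (fst p) (snd p)) ` ?I \<subseteq> std_lattice \<eta>"
      by (auto simp: std_lattice_iff coef_mon)
    fix v assume v: "v \<in> std_lattice \<eta>"
    have "v - (\<Sum>p\<in>?I. cmul (coef v (fst p) (snd p)) (mon (fst p) (snd p))) \<in> z_lattice N"
      unfolding z_lattice_iff coef_diff coef using v by (auto simp: std_lattice_iff)
    then show "\<exists>c. v - (\<Sum>p\<in>?I. cmul (c p) (mon (fst p) (snd p))) \<in> z_lattice N"
      by (rule exI[of _ "\<lambda>p. coef v (fst p) (snd p)"])
  next
    fix c p
    assume *: "(\<Sum>p\<in>?I. cmul (c p) (mon (fst p) (snd p))) \<in> z_lattice N \<and> std_lattice \<eta> \<noteq> {}"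
      and p: "p \<in> ?I"
    then have "coef (\<Sum>p\<in>?I. cmul (c p) (mon (fst p) (snd p))) (fst p) (snd p) = 0"
      unfolding z_lattice_iff by auto
    then show "c p = 0" unfolding coef using p by auto
  qed
qed

context slice_setup
begin

text \<open>The substitution \<open>n = S - k\<close> turns the Jordan index of \<open>e_D\<close>
  into an exponent and the bounds by \<open>block\<close> into \<open>J\<close>.\<close>

lemma End_coords_eq:
  "End_coords \<sigma> S = {(\<lambda>A. coef (lift S A (mon j m)) i k) |i k j m. (i, k) \<in> J \<and> (j, m) \<in> J}"
proof -
  have eq: "(\<lambda>A. D_coeff S r i (A (e_D S k j))) = (\<lambda>A. coef (lift S A (mon j (S - int k))) i (S - int r))"
    if "1 \<le> r" for r i k j
    using that by (auto simp: D_coeff_def e_D_mon lift_def rep_def simp flip: coef_def)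
  show ?thesis
  proof (intro equalityI subsetI)
    fix f assume "f \<in> End_coords \<sigma> S"
    then obtain r i k j where *: "f = (\<lambda>A. D_coeff S r i (A (e_D S k j)))"
      "1 \<le> r" "r \<le> block \<sigma> S i" "1 \<le> k" "k \<le> block \<sigma> S j"
      by (auto simp: End_coords_def)
    then have "int r \<le> \<sigma> i + S" "int k \<le> \<sigma> j + S" by (simp_all flip: block_eq)
    then have "(i, S - int r) \<in> J" "(j, S - int k) \<in> J" using * by auto
    then show "f \<in> {(\<lambda>A. coef (lift S A (mon j m)) i k) |i k j m. (i, k) \<in> J \<and> (j, m) \<in> J}"
      using *(1) eq[OF *(2)] by blast
  next
    fix f assume "f \<in> {(\<lambda>A. coef (lift S A (mon j m)) i k) |i k j m. (i, k) \<in> J \<and> (j, m) \<in> J}"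
    then obtain i k j m where *: "f = (\<lambda>A. coef (lift S A (mon j m)) i k)" "(i, k) \<in> J" "(j, m) \<in> J"
      by blast
    define r where "r = nat (S - k)"
    define l where "l = nat (S - m)"
    have rl: "k = S - int r" "m = S - int l" "1 \<le> r" "1 \<le> l" using * by (auto simp: r_def l_def)
    have "int r \<le> int (block \<sigma> S i)" "int l \<le> int (block \<sigma> S j)"
      unfolding block_eq using * by (auto simp: r_def l_def)
    then show "f \<in> End_coords \<sigma> S"
      unfolding End_coords_def using rl *(1) eq[of r i l j]
      by (intro CollectI exI[of _ r] exI[of _ i] exI[of _ l] exI[of _ j] conjI) simp_all
  qed
qed

text \<open>Agreement is demanded on \<open>End_D\<close> only: elsewhere the maps need not be
  linear, and \<open>lift\<close> has no matrix expansion.\<close>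

definition polyE :: "(('m lvec set \<Rightarrow> 'm lvec set) \<Rightarrow> complex) \<Rightarrow> bool" where
  "polyE f \<longleftrightarrow> (\<exists>p\<in>polyfun (End_coords \<sigma> S). \<forall>A\<in>End_D \<sigma> S. f A = p A)"

lemma polyE_const: "polyE (\<lambda>_. c)"
  unfolding polyE_def by (rule bexI[OF _ polyfun.const[of c]]) simp

lemma polyE_mult: "polyE f \<Longrightarrow> polyE g \<Longrightarrow> polyE (\<lambda>A. f A * g A)"
  unfolding polyE_def
proof (elim bexE)
  fix p q
  assume "p \<in> polyfun (End_coords \<sigma> S)" "\<forall>A\<in>End_D \<sigma> S. f A = p A"
    "q \<in> polyfun (End_coords \<sigma> S)" "\<forall>A\<in>End_D \<sigma> S. g A = q A"
  then show "\<exists>p\<in>polyfun (End_coords \<sigma> S). \<forall>A\<in>End_D \<sigma> S. f A * g A = p A"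
    by (intro bexI[OF _ polyfun.mult[of p _ q]]) auto
qed

lemma polyE_add: "polyE f \<Longrightarrow> polyE g \<Longrightarrow> polyE (\<lambda>A. f A + g A)"
  unfolding polyE_def
proof (elim bexE)
  fix p q
  assume "p \<in> polyfun (End_coords \<sigma> S)" "\<forall>A\<in>End_D \<sigma> S. f A = p A"
    "q \<in> polyfun (End_coords \<sigma> S)" "\<forall>A\<in>End_D \<sigma> S. g A = q A"
  then show "\<exists>p\<in>polyfun (End_coords \<sigma> S). \<forall>A\<in>End_D \<sigma> S. f A + g A = p A"
    by (intro bexI[OF _ polyfun.add[of p _ q]]) auto
qed

lemma polyE_sum: "(\<And>i. i \<in> I \<Longrightarrow> polyE (f i)) \<Longrightarrow> polyE (\<lambda>A. \<Sum>i\<in>I. f i A)"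
  by (induction I rule: infinite_finite_induct) (simp_all add: polyE_const polyE_add)

lemma polyE_cong: "polyE f \<Longrightarrow> (\<And>A. A \<in> End_D \<sigma> S \<Longrightarrow> g A = f A) \<Longrightarrow> polyE g"
  unfolding polyE_def by auto

lemma polyE_lift:
  assumes "(j, m) \<in> J" shows "polyE (\<lambda>A. coef (lift S A (mon j m)) i k)"
proof (cases "(i, k) \<in> J")
  case True
  then have "(\<lambda>A. coef (lift S A (mon j m)) i k) \<in> polyfun (End_coords \<sigma> S)"
    using assms by (intro polyfun.coord) (auto simp: End_coords_eq)
  then show ?thesis unfolding polyE_def by (rule bexI[rotated]) simp
next
  case False
  have "mon j m \<in> std_lattice \<sigma>" using assms by (intro mon_std) simp
  then have "coef (lift S A (mon j m)) i k = 0" if "A \<in> End_D \<sigma> S" for A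
    using lift_core[OF that] False unfolding core_iff by blast
  then show ?thesis by (intro polyE_cong[OF polyE_const[of 0]])
qed

lemma polyE_lift_pow:
  assumes m: "- \<sigma> j \<le> m" shows "polyE (\<lambda>A. coef ((lift S A ^^ q) (mon j m)) i k)"
proof (induction q arbitrary: i k)
  case 0
  then show ?case by (simp add: polyE_const)
next
  case (Suc q)
  have "coef ((lift S A ^^ Suc q) (mon j m)) i k =
      (\<Sum>p\<in>J. coef ((lift S A ^^ q) (mon j m)) (fst p) (snd p) * coef (lift S A (mon (fst p) (snd p))) i k)"
    if A: "A \<in> End_D \<sigma> S" for A
  proof -
    have "(lift S A ^^ Suc q) (mon j m) = lift S A ((lift S A ^^ q) (mon j m))" by simp
    also have "\<dots> = (\<Sum>p\<in>J. cmul (coef ((lift S A ^^ q) (mon j m)) (fst p) (snd p)) (lift S A (mon (fst p) (snd p))))"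
      using lift_expand[OF A lift_pow_std[OF A mon_std[OF m]], of q] by (simp add: case_prod_unfold)
    finally show ?thesis by simp
  qed
  then show ?case
  proof (rule polyE_cong[rotated])
    show "polyE (\<lambda>A. \<Sum>p\<in>J. coef ((lift S A ^^ q) (mon j m)) (fst p) (snd p) * coef (lift S A (mon (fst p) (snd p))) i k)"
      using Suc by (intro polyE_sum polyE_mult polyE_lift) auto
  qed
qed

lemma polyE_jet:
  assumes m: "- \<sigma> j \<le> m" shows "polyE (\<lambda>A. coef (jet A (mon j m)) i k)"
proof -
  have "coef (jet A (mon j m)) i k =
      (\<Sum>q<nil_bound. (if k + int q = S - 1 then 1 else 0) * coef ((lift S A ^^ q) (mon j m)) i (k + int q))" for A
    unfolding jet_def coef_sum by (intro sum.cong) auto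
  moreover have "polyE (\<lambda>A. \<Sum>q<nil_bound. (if k + int q = S - 1 then 1 else 0) * coef ((lift S A ^^ q) (mon j m)) i (k + int q))"
    by (intro polyE_sum polyE_mult polyE_const polyE_lift_pow[OF m])
  ultimately show ?thesis by simp
qed

section \<open>The jet map and its lattice\<close>

context
  fixes A assumes A: "A \<in> End_D \<sigma> S"
begin

lemma jet_add: "v \<in> std_lattice \<sigma> \<Longrightarrow> w \<in> std_lattice \<sigma> \<Longrightarrow> jet A (v + w) = jet A v + jet A w"
  by (simp add: jet_def lift_pow_add[OF A] filt_add zmul_add sum.distrib)

lemma jet_cmul: "v \<in> std_lattice \<sigma> \<Longrightarrow> jet A (cmul c v) = cmul c (jet A v)"
  by (simp add: jet_def lift_pow_cmul[OF A] filt_cmul zmul_cmul cv.scale_sum_right)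

lemma jet_z_lattice:
  assumes v: "v \<in> z_lattice S" shows "jet A v = 0"
proof -
  have "filt (\<lambda>_ k. k = S - 1) ((lift S A ^^ n) v) = 0" for n
  proof (cases n)
    case 0
    then show ?thesis using v by (intro lvec_eqI) (auto simp: z_lattice_iff)
  next
    case (Suc n')
    have "lift S A v = 0" using lift_cong[OF A, of v 0] v lift_0[OF A] by simp
    moreover have "(lift S A ^^ n') 0 = 0" by (induction n') (simp_all add: lift_0[OF A])
    ultimately have "(lift S A ^^ n) v = 0" unfolding Suc by (simp add: funpow_swap1)
    then show ?thesis by simp
  qed
  then show ?thesis by (simp add: jet_def)
qed

lemma jet_cong: "v \<in> std_lattice \<sigma> \<Longrightarrow> w \<in> std_lattice \<sigma> \<Longrightarrow> v - w \<in> z_lattice S \<Longrightarrow> jet A v = jet A w"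
  using jet_add[of w "v - w"] jet_z_lattice[of "v - w"] sub_std by auto

lemma jet_expand:
  assumes v: "v \<in> core"
  shows "jet A v = (\<Sum>p\<in>J. cmul (coef v (fst p) (snd p)) (jet A (mon (fst p) (snd p))))"
proof -
  have "finite K \<Longrightarrow> K \<subseteq> J \<Longrightarrow> jet A (\<Sum>p\<in>K. cmul (c p) (mon (fst p) (snd p)))
      = (\<Sum>p\<in>K. cmul (c p) (jet A (mon (fst p) (snd p))))" for K c
  proof (induction K rule: finite_induct)
    case empty
    then show ?case by (simp add: jet_z_lattice z_lattice_iff)
  next
    case (insert p K)
    have "mon (fst p) (snd p) \<in> std_lattice \<sigma>" using insert.prems mon_std[of "fst p" "snd p"]
      by (cases p) simp
    moreover have "(\<Sum>p\<in>K. cmul (c p) (mon (fst p) (snd p))) \<in> std_lattice \<sigma>"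
      using insert.prems by (intro cv.subspace_sum) (auto intro!: std_scale mon_std)
    ultimately show ?case
      using insert by (simp add: jet_add jet_cmul std_scale)
  qed
  note lin = this[OF finite_J order.refl]
  have "v = (\<Sum>p\<in>J. cmul (coef v (fst p) (snd p)) (mon (fst p) (snd p)))"
    using v finite_expansion[OF finite_J, of v] by (simp add: case_prod_unfold core_iff) blast
  then show ?thesis using lin by metis
qed

end

text \<open>For nilpotent \<open>A\<close> the kernel of \<open>jet A\<close> on \<open>\<D>\<close>
  is the largest \<open>A\<close>-stable subspace on which all coefficients at \<open>S - 1\<close>
  vanish, so injectivity can fail. Where it holds, \<open>(\<D>, A)\<close> embeds into
  \<open>U((z)) / z^S U[[z]]\<close>.\<close>

definition jet_inj :: "('m lvec set \<Rightarrow> 'm lvec set) \<Rightarrow> bool" where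
  "jet_inj A \<longleftrightarrow> (\<forall>v\<in>core. jet A v = 0 \<longrightarrow> v = 0)"

definition jet_lattice :: "('m lvec set \<Rightarrow> 'm lvec set) \<Rightarrow> 'm lvec set" where
  "jet_lattice A = {x. \<exists>v\<in>std_lattice \<sigma>. x - jet A v \<in> z_lattice S}"

text \<open>\<open>jet A\<close> loses everything from \<open>z^S\<close> on. Restoring that part of
  \<open>v\<close> gives a map that can be compared modulo \<open>z_lattice N\<close> for any
  \<open>N \<ge> S\<close>, as frames require.\<close>

definition jet_ext :: "('m lvec set \<Rightarrow> 'm lvec set) \<Rightarrow> 'm lvec \<Rightarrow> 'm lvec" where
  "jet_ext A v = jet A v + filt (\<lambda>_ n. S \<le> n) v"

context
  fixes A assumes nil: "A \<in> nilp_cone \<sigma> S"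
begin

lemma z_jet:
  assumes v: "v \<in> std_lattice \<sigma>" shows "zmul 1 (jet A v) - jet A (lift S A v) \<in> z_lattice S"
  unfolding z_lattice_iff
proof (intro allI impI)
  fix i n assume n: "n < S"
  \<comment> \<open>One exponent lower corresponds to one more power of \<open>A\<close>.\<close>
  then have "nat (S - 1 - (n - 1)) = Suc (nat (S - 1 - n))" by simp
  then show "coef (zmul 1 (jet A v) - jet A (lift S A v)) i n = 0"
    using n by (simp add: coef_jet[OF nil] v lift_std[OF nilp_End[OF nil]] funpow_swap1)
qed

lemma zsub_jet_lattice: "zsub (jet_lattice A)"
  unfolding zsub_def cv.subspace_def
proof (intro conjI ballI allI)
  note E = nilp_End[OF nil]
  show "0 \<in> jet_lattice A"
    unfolding jet_lattice_def using jet_z_lattice[OF E, of 0]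
    by (auto simp: z_lattice_iff std_lattice_iff intro!: bexI[of _ 0])
  fix x y c
  assume "x \<in> jet_lattice A"
  then obtain v where v: "v \<in> std_lattice \<sigma>" "x - jet A v \<in> z_lattice S" by (auto simp: jet_lattice_def)
  have "cmul c x - jet A (cmul c v) \<in> z_lattice S"
    using v by (simp add: jet_cmul[OF E] z_lattice_iff)
  then show "cmul c x \<in> jet_lattice A" unfolding jet_lattice_def using std_scale[OF v(1)] by blast
  have "zmul 1 x - jet A (lift S A v) = zmul 1 (x - jet A v) + (zmul 1 (jet A v) - jet A (lift S A v))"
    by (simp add: zmul_diff)
  also have "\<dots> \<in> z_lattice S"
    using z_jet[OF v(1)] v(2) by (intro cv.subspace_add[OF subspace_z_lattice] zmul_in_z_lattice[of _ S]) auto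
  finally show "zmul 1 x \<in> jet_lattice A" unfolding jet_lattice_def using lift_std[OF E v(1)] by blast
  assume "y \<in> jet_lattice A"
  then obtain w where w: "w \<in> std_lattice \<sigma>" "y - jet A w \<in> z_lattice S" by (auto simp: jet_lattice_def)
  have "(x + y) - jet A (v + w) \<in> z_lattice S"
    using v w by (simp add: jet_add[OF E] z_lattice_iff)
  then show "x + y \<in> jet_lattice A" unfolding jet_lattice_def using std_add[OF v(1) w(1)] by blast
qed

lemma z_lattice_subset_jet_lattice: "z_lattice S \<subseteq> jet_lattice A"
  unfolding jet_lattice_def using jet_z_lattice[OF nilp_End[OF nil], of 0]
  by (auto simp: z_lattice_iff std_lattice_iff intro!: bexI[of _ 0])

lemma jet_lattice_subset: "jet_lattice A \<subseteq> z_lattice (S - int nil_bound)"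
proof
  fix x assume "x \<in> jet_lattice A"
  then obtain v where v: "v \<in> std_lattice \<sigma>" "x - jet A v \<in> z_lattice S" by (auto simp: jet_lattice_def)
  have "coef x i n = 0" if n: "n < S - int nil_bound" for i n
  proof -
    have "coef x i n = coef (jet A v) i n" using v(2) n by (simp add: z_lattice_iff)
    also have "\<dots> = 0" using n nilp_lift_pow[OF nil v(1), of "nat (S - 1 - n)"] by (simp add: coef_jet[OF nil] v)
    finally show ?thesis .
  qed
  then show "x \<in> z_lattice (S - int nil_bound)" by (simp add: z_lattice_iff)
qed

text \<open>Below \<open>S\<close> the coefficients of \<open>jet_ext A v\<close> are those of
  \<open>jet A v\<close> and determine \<open>v\<close> modulo \<open>z^S\<close> by injectivity;
  from \<open>S\<close> on they are those of \<open>v\<close>.\<close>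

lemma jet_ext_basis:
  assumes inj: "jet_inj A" and N: "S \<le> N" and I: "finite I"
    and b: "basis_mod I b (z_lattice N) (std_lattice \<sigma>)"
  shows "basis_mod I (\<lambda>i. jet_ext A (b i)) (z_lattice N) (jet_lattice A)"
proof (rule basis_mod_transport[OF _ _ I _ _ _ _ _ _ b])
  note E = nilp_End[OF nil]
  show "jet_ext A v \<in> jet_lattice A" if "v \<in> std_lattice \<sigma>" for v
    unfolding jet_lattice_def using that by (auto simp: jet_ext_def z_lattice_iff intro!: bexI[of _ v])
  show "jet_ext A v \<in> z_lattice N \<longleftrightarrow> v \<in> z_lattice N" if v: "v \<in> std_lattice \<sigma>" for v
  proof
    assume T: "jet_ext A v \<in> z_lattice N"
    have "coef (jet A v) i n = 0" for i n
    proof (cases "n < S")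
      case True
      have "coef (jet_ext A v) i n = 0" using T True N by (simp add: z_lattice_iff)
      then show ?thesis using True by (simp add: jet_ext_def)
    qed (simp add: coef_jet[OF nil] v)
    then have G0: "jet A v = 0" by (intro lvec_eqI) simp
    moreover have "jet A (cut S v) = jet A v"
      using v core_subset[OF cut_core[OF v]] by (intro jet_cong[OF E]) auto
    ultimately have "cut S v = 0" using inj cut_core[OF v] by (simp add: jet_inj_def)
    then have "coef (cut S v) i n = 0" for i n by simp
    then have vz: "coef v i n = 0" if "n < S" for i n using that by (metis coef_filt)
    have "coef v i n = 0" if "n < N" for i n
    proof (cases "n < S")
      case False
      have "coef (jet_ext A v) i n = 0" using T that by (simp add: z_lattice_iff)
      then show ?thesis using False G0 by (simp add: jet_ext_def)
    qed (rule vz)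
    then show "v \<in> z_lattice N" by (simp add: z_lattice_iff)
  next
    assume vN: "v \<in> z_lattice N"
    then have "jet A v = 0" using z_lattice_mono[OF N] by (intro jet_z_lattice[OF E]) auto
    then show "jet_ext A v \<in> z_lattice N" using vN by (simp add: jet_ext_def z_lattice_iff)
  qed
  show "\<exists>v\<in>std_lattice \<sigma>. w - jet_ext A v \<in> z_lattice N" if wT: "w \<in> jet_lattice A" for w
  proof -
    obtain v where v: "v \<in> std_lattice \<sigma>" "w - jet A v \<in> z_lattice S" using wT by (auto simp: jet_lattice_def)
    let ?r = "filt (\<lambda>_ n. S \<le> n) w"
    have r: "?r \<in> z_lattice S" by (simp add: z_lattice_iff)
    have c: "cut S v \<in> std_lattice \<sigma>" by (rule core_subset[OF cut_core[OF v(1)]])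
    have x: "cut S v + ?r \<in> std_lattice \<sigma>" using c r sub_std by (intro std_add) auto
    have "jet A (cut S v + ?r) = jet A v"
      using x v(1) by (rule jet_cong[OF E]) (simp add: z_lattice_iff)
    then have "w = jet_ext A (cut S v + ?r)"
      using v(2) by (intro lvec_eqI) (auto simp: jet_ext_def z_lattice_iff coef_jet[OF nil v(1)])
    then have "w - jet_ext A (cut S v + ?r) \<in> z_lattice N" by (simp add: z_lattice_iff)
    then show ?thesis using x by blast
  qed
qed (auto simp: jet_ext_def jet_add[OF nilp_End[OF nil]] jet_cmul[OF nilp_End[OF nil]] filt_add filt_cmul cv.scale_right_distrib)

end

text \<open>One size of frames for all nilpotent operators: \<open>jet_lattice A\<close> lies
  between \<open>z_lattice S\<close> and \<open>z_lattice (S - int nil_bound)\<close>, and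
  \<open>|S| + nil_bound\<close> is at least both \<open>S\<close> and
  \<open>nil_bound - S\<close>.\<close>

definition frame_bound :: nat where "frame_bound = nat (\<bar>S\<bar> + int nil_bound)"

lemma frame_bound: "S \<le> int frame_bound" "- int frame_bound \<le> S - int nil_bound" "0 \<le> \<sigma> i + int frame_bound"
  using nonneg[of i] by (auto simp: frame_bound_def)

definition frame_index :: "('m \<times> int) set" where
  "frame_index = (SIGMA i:UNIV. {- \<sigma> i..<int frame_bound})"

lemma finite_frame_index [simp]: "finite frame_index"
  by (simp add: frame_index_def)

definition frame_dim :: nat where "frame_dim = card frame_index"

definition frame_enum :: "nat \<Rightarrow> 'm \<times> int" where
  "frame_enum = (SOME f. bij_betw f {..<frame_dim} frame_index)"

lemma frame_enum: "bij_betw frame_enum {..<frame_dim} frame_index"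
proof -
  have "\<exists>f. bij_betw f {..<frame_dim} frame_index"
    using ex_bij_betw_nat_finite[OF finite_frame_index] by (simp add: frame_dim_def atLeast0LessThan)
  then show ?thesis unfolding frame_enum_def by (rule someI_ex)
qed

definition jet_frame :: "('m lvec set \<Rightarrow> 'm lvec set) \<Rightarrow> nat \<Rightarrow> 'm lvec" where
  "jet_frame A a = jet_ext A (mon (fst (frame_enum a)) (snd (frame_enum a)))"

lemma jet_frame_frame:
  assumes nil: "A \<in> nilp_cone \<sigma> S" and inj: "jet_inj A" and Gr: "jet_lattice A \<in> loop_Gr"
  shows "jet_frame A \<in> Gr_frames frame_bound frame_dim \<and> frame_lattice frame_bound frame_dim (jet_frame A) = jet_lattice A"
proof -
  have "basis_mod frame_index (\<lambda>p. mon (fst p) (snd p)) (z_lattice (int frame_bound)) (std_lattice \<sigma>)"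
    unfolding frame_index_def by (rule std_lattice_monomial_basis) (use frame_bound(3) in \<open>smt (verit)\<close>)
  then have "basis_mod frame_index (\<lambda>p. jet_ext A (mon (fst p) (snd p))) (z_lattice (int frame_bound)) (jet_lattice A)"
    by (rule jet_ext_basis[OF nil inj frame_bound(1) finite_frame_index])
  then have b: "basis_mod {..<frame_dim} (jet_frame A) (z_lattice (int frame_bound)) (jet_lattice A)"
    unfolding jet_frame_def[abs_def] by (rule basis_mod_reindex[OF subspace_z_lattice finite_frame_index frame_enum])
  have zL: "z_lattice (int frame_bound) \<subseteq> jet_lattice A"
    using z_lattice_subset_jet_lattice[OF nil] z_lattice_mono[OF frame_bound(1)] by blast
  have "jet_lattice A \<in> Gr_piece frame_bound"
    using Gr zL jet_lattice_subset[OF nil] z_lattice_mono[OF frame_bound(2)] by (auto simp: Gr_piece_def)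
  then have "jet_frame A \<in> Gr_frames frame_bound frame_dim" using b by (auto simp: Gr_frames_def)
  moreover have "frame_lattice frame_bound frame_dim (jet_frame A) = jet_lattice A"
    using zsub_jet_lattice[OF nil] zL b by (intro frame_lattice_unique) (auto simp: zsub_def)
  ultimately show ?thesis by blast
qed

lemma jet_frame_poly:
  assumes "c \<in> frame_coords frame_bound frame_dim"
  shows "\<exists>p\<in>polyfun (End_coords \<sigma> S). \<forall>A\<in>End_D \<sigma> S. c (jet_frame A) = p A"
proof -
  obtain a i n where c: "c = (\<lambda>b. fls_nth (b a $ i) n)" "a < frame_dim"
    using assms by (auto simp: frame_coords_def)
  have "frame_enum a \<in> frame_index" using frame_enum c(2) by (auto simp: bij_betw_def)
  then have m: "- \<sigma> (fst (frame_enum a)) \<le> snd (frame_enum a)" by (auto simp: frame_index_def)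
  have "polyE (\<lambda>A. coef (jet A (mon (fst (frame_enum a)) (snd (frame_enum a)))) i n +
      coef (filt (\<lambda>_ n. S \<le> n) (mon (fst (frame_enum a)) (snd (frame_enum a)))) i n)"
    by (intro polyE_add polyE_jet[OF m] polyE_const)
  then show ?thesis
    unfolding polyE_def by (simp add: c(1) jet_frame_def jet_ext_def flip: coef_def)
qed

lemma slice_nilp_jet_lattice:
  assumes A: "A \<in> slice_nilp"
  shows "A \<in> nilp_cone \<sigma> S" "jet_inj A" "jet_lattice A = Psi0_S \<sigma> S A"
proof -
  show nil: "A \<in> nilp_cone \<sigma> S" by (rule slice_nilp_nilp_cone[OF A])
  show "jet_inj A"
    unfolding jet_inj_def
  proof (intro ballI impI)
    fix v assume v: "v \<in> core" "jet A v = 0"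
    note vs = core_subset[OF v(1)]
    have c0: "cut S (psi A v) = 0" using v(2) jet_eq_cut_psi[OF A vs] by simp
    show "v = 0"
    proof (rule lvec_eqI)
      fix i n
      show "coef v i n = coef 0 i n"
      proof (cases "(i, n) \<in> J")
        case True
        then have "coef v i n = coef (psi A v) i n" using psi_U_neg[OF A vs] by (simp add: U_neg_iff)
        also have "\<dots> = coef (cut S (psi A v)) i n" using True by simp
        finally show ?thesis using c0 by simp
      qed (use v(1) in \<open>simp add: core_iff\<close>)
    qed
  qed
  show "jet_lattice A = Psi0_S \<sigma> S A"
    unfolding Psi0_S_eq[OF A]
  proof (intro equalityI subsetI)
    fix x assume "x \<in> jet_lattice A"
    then obtain v where v: "v \<in> std_lattice \<sigma>" "x - jet A v \<in> z_lattice S" by (auto simp: jet_lattice_def)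
    define r where "r = x - psi A v"
    have r: "r \<in> z_lattice S"
      using v(2) unfolding jet_eq_cut_psi[OF A v(1)] by (simp add: r_def z_lattice_iff)
    then have "psi A (v + r) = x"
      using sub_std by (subst psi_add[OF A v(1)]) (auto simp: psi_z_lattice[OF A] r_def)
    then show "x \<in> psi A ` std_lattice \<sigma>" using std_add[OF v(1), of r] r sub_std by blast
  next
    fix x assume "x \<in> psi A ` std_lattice \<sigma>"
    then obtain v where v: "v \<in> std_lattice \<sigma>" "x = psi A v" by blast
    then have "x - jet A v \<in> z_lattice S" by (simp add: jet_eq_cut_psi[OF A])
    then show "x \<in> jet_lattice A" unfolding jet_lattice_def using v(1) by blast
  qed
qed

text \<open>At \<open>A0\<close> the coefficients of the jets of monomials at the exponents in
  \<open>J\<close> form the identity matrix, because \<open>psi A0\<close> changes \<open>v\<close>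
  by an element of \<open>U_neg \<sigma>\<close>. The \<open>\<delta>\<close> attached to this
  matrix is the required polynomial.\<close>

lemma jet_inj_open:
  assumes A0: "A0 \<in> slice_nilp"
  obtains \<delta> where "\<delta> \<in> polyfun (End_coords \<sigma> S)" "\<delta> A0 \<noteq> 0"
    "\<And>A. A \<in> End_D \<sigma> S \<Longrightarrow> \<delta> A \<noteq> 0 \<Longrightarrow> jet_inj A"
proof -
  have "\<exists>f. q \<in> J \<longrightarrow> f \<in> polyfun (End_coords \<sigma> S) \<and>
      (\<forall>A\<in>End_D \<sigma> S. coef (jet A (mon (fst q) (snd q))) (fst p) (snd p) = f A)" for p q
    using polyE_jet[of "fst q" "snd q" "fst p" "snd p"] unfolding polyE_def by (cases q) auto
  then have "\<exists>M. \<forall>p q. q \<in> J \<longrightarrow> M p q \<in> polyfun (End_coords \<sigma> S) \<and>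
      (\<forall>A\<in>End_D \<sigma> S. coef (jet A (mon (fst q) (snd q))) (fst p) (snd p) = M p q A)"
    by (intro choice allI)
  then obtain M where M: "\<And>p q. q \<in> J \<Longrightarrow> M p q \<in> polyfun (End_coords \<sigma> S)"
    "\<And>p q A. q \<in> J \<Longrightarrow> A \<in> End_D \<sigma> S \<Longrightarrow> coef (jet A (mon (fst q) (snd q))) (fst p) (snd p) = M p q A"
    by metis
  have id: "M p q A0 = (if p = q then 1 else 0)" if pq: "p \<in> J" "q \<in> J" for p q
  proof -
    have q: "mon (fst q) (snd q) \<in> std_lattice \<sigma>" using pq(2) by (cases q) (auto intro: mon_std)
    have "M p q A0 = coef (psi A0 (mon (fst q) (snd q))) (fst p) (snd p)"
      using M(2)[OF pq(2) slice_nilp_End[OF A0], of p] pq(1) by (cases p) (simp add: jet_eq_cut_psi[OF A0 q])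
    also have "\<dots> = coef (mon (fst q) (snd q)) (fst p) (snd p)"
      using psi_U_neg[OF A0 q] pq(1) by (cases p) (simp add: U_neg_iff)
    finally show ?thesis by (auto simp: coef_mon prod_eq_iff)
  qed
  have delta: "(\<Sum>k\<in>J. (if p = k then 1 else 0) * (if k = q then 1 else 0)) = (if p = q then 1 else (0 :: complex))"
    if "p \<in> J" "q \<in> J" for p q
    using that by (simp add: if_distrib[of "\<lambda>x. x * _"] cong: if_cong)
  have MR: "(\<Sum>k\<in>J. M p k A0 * (if k = q then 1 else 0)) = (if p = q then 1 else 0)" if "p \<in> J" "q \<in> J" for p q
    using delta[OF that] that by (simp add: id cong: sum.cong)
  have RM: "(\<Sum>k\<in>J. (if p = k then 1 else 0) * M k q A0) = (if p = q then 1 else 0)" if "p \<in> J" "q \<in> J" for p q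
    using delta[OF that] that by (simp add: id cong: sum.cong)
  obtain \<delta> Q where \<delta>: "\<delta> \<in> polyfun (End_coords \<sigma> S)" "\<delta> A0 \<noteq> 0"
    and QM: "\<And>A k l. k \<in> J \<Longrightarrow> l \<in> J \<Longrightarrow> (\<Sum>p\<in>J. Q k p A * M p l A) = (if k = l then \<delta> A else 0)"
    by (rule polyfun_matrix_inverse[OF finite_J finite_J, where M = M
          and R = "\<lambda>p q. if p = q then 1 else 0" and C = "End_coords \<sigma> S" and ?x0.0 = A0])
      (use M(1) MR RM in \<open>assumption | blast\<close>)+
  have "jet_inj A" if A: "A \<in> End_D \<sigma> S" and nz: "\<delta> A \<noteq> 0" for A
    unfolding jet_inj_def
  proof (intro ballI impI)
    fix v assume v: "v \<in> core" "jet A v = 0"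
    let ?c = "\<lambda>p. coef v (fst p) (snd p)"
    have "(\<Sum>q\<in>J. M p q A * ?c q) = coef (jet A v) (fst p) (snd p)" for p
      unfolding jet_expand[OF A v(1)] coef_sum coef_cmul
      by (intro sum.cong) (simp_all add: M(2)[OF _ A, symmetric] mult.commute)
    then have Mc: "(\<Sum>q\<in>J. M p q A * ?c q) = 0" for p using v(2) by simp
    have c: "?c l = 0" if l: "l \<in> J" for l
    proof -
      have "\<delta> A * ?c l = (\<Sum>k\<in>J. (if l = k then \<delta> A else 0) * ?c k)"
        using l by (simp add: if_distrib[of "\<lambda>x. x * _"] cong: if_cong)
      also have "\<dots> = (\<Sum>k\<in>J. (\<Sum>p\<in>J. Q l p A * M p k A) * ?c k)"
        using QM[OF l] by simp
      also have "\<dots> = (\<Sum>p\<in>J. Q l p A * (\<Sum>k\<in>J. M p k A * ?c k))"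
        unfolding sum_distrib_right sum_distrib_left by (subst sum.swap) (simp add: mult.assoc)
      also have "\<dots> = 0" using Mc by simp
      finally show ?thesis using nz by simp
    qed
    show "v = 0"
    proof (rule lvec_eqI)
      fix i n
      show "coef v i n = coef 0 i n"
        using c[of "(i, n)"] v(1) unfolding core_iff by (cases "(i, n) \<in> J") auto
    qed
  qed
  then show ?thesis using that \<delta> by blast
qed

section \<open>Morphisms in both directions\<close>

lemma Psi0_S_morphism:
  assumes "X' \<subseteq> slice_nilp" "Psi0_S \<sigma> S ` X' \<subseteq> Y'"
  shows "fspace_morphism (End_D_fspace \<sigma> S) X' loop_Gr_fspace Y' (Psi0_S \<sigma> S)"
  unfolding End_D_fspace_def
proof (rule fspace_morphism_to_loop_Gr[OF _ assms(2)])
  show "X' \<subseteq> End_D \<sigma> S" using assms(1) slice_nilp_End by blast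
  show "jet_frame A \<in> Gr_frames frame_bound frame_dim \<and> frame_lattice frame_bound frame_dim (jet_frame A) = Psi0_S \<sigma> S A" if "A \<in> X'" for A
  proof -
    have A: "A \<in> slice_nilp" using that assms(1) by blast
    have "Psi0_S \<sigma> S A \<in> loop_Gr"
      using Psi0_S_in_slice_lattices[OF A] slice_subset_loop_Gr by (auto simp: slice_lattices_def)
    then show ?thesis using jet_frame_frame slice_nilp_jet_lattice[OF A] by metis
  qed
qed (rule jet_frame_poly)

text \<open>The coordinates of \<open>Phi L\<close> are coefficients of lifted monomials at an
  exponent lowered by one. This holds on the whole chart, even for lattices that do not contain
  \<open>z_lattice S\<close>.\<close>

lemma Phi_coord_regular:
  assumes "c \<in> End_coords \<sigma> S"
  shows "regular_on (frame_coords N d) (frames_over N d (Gr_chart \<sigma>)) (\<lambda>b. c (Phi (frame_lattice N d b)))"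
proof -
  obtain i k j m where c: "c = (\<lambda>A. coef (lift S A (mon j m)) i k)" "(i, k) \<in> J" "(j, m) \<in> J"
    using assms unfolding End_coords_eq by blast
  have m: "mon j m \<in> std_lattice \<sigma>" using c(3) by (intro mon_std) simp
  have "cut S (mon j m) = mon j m" using c(3) by (intro lvec_eqI) (auto simp: coef_mon)
  then have "c (Phi L) = coef (hlift \<sigma> L (mon j m)) i (k - 1)" for L
    using m c(2) by (simp add: c(1) lift_def Phi_def)
  then show ?thesis using hlift_regular[of \<sigma> j m N d i "k - 1"] c(3) by simp
qed

lemma Phi_morphism:
  assumes "Y' \<subseteq> slice_lattices" "\<phi> ` Y' \<subseteq> X'" "X' \<subseteq> slice_nilp" "\<And>L. L \<in> Y' \<Longrightarrow> \<phi> L = Phi L"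
  shows "fspace_morphism loop_Gr_fspace Y' (End_D_fspace \<sigma> S) X' \<phi>"
  unfolding End_D_fspace_def
proof (rule fspace_morphism_from_loop_Gr[OF _ assms(2) Gr_open_chart[of \<sigma>],
      where \<kappa> = "\<lambda>c L. c (Phi L)"])
  show "X' \<subseteq> End_D \<sigma> S" using assms(3) slice_nilp_End by blast
  show "Y' \<subseteq> Gr_chart \<sigma>" using assms(1) slice_lattices_chart by blast
  show "c (Phi L) = c (\<phi> L)" if "L \<in> Y'" for c :: "_ \<Rightarrow> complex" and L using assms(4)[OF that] by simp
qed (rule Phi_coord_regular)

text \<open>Stated for arbitrary subsets, so that it serves for the nilpotent slice and for its
  intersections with orbit closures.\<close>

lemma Psi0_S_isomorphism:
  assumes X': "X' \<subseteq> slice_nilp" and img: "Psi0_S \<sigma> S ` X' = Y'"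
  shows "fspace_isomorphism (End_D_fspace \<sigma> S) X' loop_Gr_fspace Y' (Psi0_S \<sigma> S)"
proof -
  have inj: "inj_on (Psi0_S \<sigma> S) X'" using bij_Psi0_S X' by (auto simp: bij_betw_def intro: inj_on_subset)
  have inv: "inv_into X' (Psi0_S \<sigma> S) L = Phi L \<and> inv_into X' (Psi0_S \<sigma> S) L \<in> X'" if L: "L \<in> Y'" for L
  proof -
    obtain A where "A \<in> X'" "L = Psi0_S \<sigma> S A" using L img by blast
    then show ?thesis using inv_into_f_f[OF inj] Phi_Psi0_S X' by auto
  qed
  have "Y' \<subseteq> slice_lattices" using img X' Psi0_S_in_slice_lattices by blast
  then have "fspace_morphism loop_Gr_fspace Y' (End_D_fspace \<sigma> S) X' (inv_into X' (Psi0_S \<sigma> S))"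
  proof (rule Phi_morphism)
    show "inv_into X' (Psi0_S \<sigma> S) ` Y' \<subseteq> X'" using inv by blast
  qed (use inv X' in blast)+
  then show ?thesis
    unfolding fspace_isomorphism_def bij_betw_def using inj img Psi0_S_morphism[OF X', of Y'] by blast
qed

end

section \<open>Jordan types of lattices\<close>

lemma power_series_mult_nth_0:
  assumes "f \<in> power_series" "g \<in> power_series"
  shows "fls_nth (f * g) 0 = fls_nth f 0 * fls_nth g 0"
proof -
  obtain F jet where "f = fps_to_fls F" "g = fps_to_fls jet" using assms by (auto simp: power_series_def)
  then show ?thesis by (simp flip: fls_times_fps_to_fls)
qed

lemma power_series_prod:
  "(\<And>i. i \<in> I \<Longrightarrow> f i \<in> power_series) \<Longrightarrow>
    prod f I \<in> power_series \<and> fls_nth (prod f I) 0 = (\<Prod>i\<in>I. fls_nth (f i) 0)"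
  by (induction I rule: infinite_finite_induct)
     (simp_all add: power_series_mult power_series_mult_nth_0)

lemma power_series_det:
  fixes A :: "complex fls ^ 'm::finite ^ 'm"
  assumes A: "\<And>i j. A $ i $ j \<in> power_series"
  shows "Determinants.det A \<in> power_series"
    and "fls_nth (Determinants.det A) 0 = Determinants.det (\<chi> i j. fls_nth (A $ i $ j) 0)"
proof -
  have summand: "of_int (sign p) * (\<Prod>i\<in>UNIV. A $ i $ p i) \<in> power_series \<and>
      fls_nth (of_int (sign p) * (\<Prod>i\<in>UNIV. A $ i $ p i)) 0
        = of_int (sign p) * (\<Prod>i\<in>UNIV. fls_nth (A $ i $ p i) 0)" for p :: "'m \<Rightarrow> 'm"
    using power_series_prod[of UNIV "\<lambda>i. A $ i $ p i"] A
    by (cases "evenperm p") (simp_all add: sign_def power_series_minus)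
  then show "Determinants.det A \<in> power_series"
    unfolding Determinants.det_def by (intro power_series_sum) blast
  show "fls_nth (Determinants.det A) 0 = Determinants.det (\<chi> i j. fls_nth (A $ i $ j) 0)"
    unfolding Determinants.det_def fls_nth_sum using summand by (intro sum.cong) auto
qed

lemma power_series_inverse:
  assumes "f \<in> power_series" "fls_nth f 0 \<noteq> 0" shows "inverse f \<in> power_series"
proof -
  obtain F where F: "f = fps_to_fls F" using assms by (auto simp: power_series_def)
  then have "fps_nth F 0 \<noteq> 0" using assms by simp
  then have "inverse f = fps_to_fls (inverse F)"
    unfolding F by (intro fls_inverse_fps_to_fls) (simp add: subdegree_eq_0_iff)
  then show ?thesis by (simp add: power_series_def)
qed

text \<open>A matrix over power series is invertible once it is so at \<open>z = 0\<close>: its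
  determinant is a unit, and Cramer's rule gives the inverse.\<close>

lemma GL_over_power_seriesI:
  fixes A :: "complex fls ^ 'm::finite ^ 'm"
  assumes A: "\<And>i j. A $ i $ j \<in> power_series"
    and det: "Determinants.det (\<chi> i j. fls_nth (A $ i $ j) 0) \<noteq> 0"
  shows "A \<in> GL_over power_series"
proof -
  have d0: "fls_nth (Determinants.det A) 0 \<noteq> 0" using power_series_det(2)[OF A] det by simp
  then have d: "Determinants.det A \<noteq> 0" by auto
  define B :: "complex fls ^ 'm ^ 'm" where
    "B = (\<chi> k j. Determinants.det (\<chi> i l. if l = k then axis j 1 $ i else A $ i $ l) / Determinants.det A)"
  have "B $ k $ j \<in> power_series" for k j
  proof -
    have "Determinants.det (\<chi> i l. if l = k then axis j 1 $ i else A $ i $ l) \<in> power_series"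
      by (rule power_series_det(1)) (simp add: A axis_def)
    then show ?thesis
      using power_series_inverse[OF power_series_det(1)[OF A] d0]
      by (simp add: B_def divide_inverse power_series_mult)
  qed
  moreover have "A *v (\<chi> k. B $ k $ j) = axis j 1" for j
    unfolding cramer[OF d] by (simp add: B_def lvec_eq_iff)
  then have "(\<chi> k. (A ** B) $ k $ j) = axis j 1" for j
    unfolding mult_vec_axis .
  then have "(\<chi> k. (A ** B) $ k $ j) $ i = axis j 1 $ i" for i j by simp
  then have AB: "A ** B = Finite_Cartesian_Product.mat 1"
    by (simp add: lvec_eq_iff Finite_Cartesian_Product.mat_def axis_def)
  moreover have "B ** A = Finite_Cartesian_Product.mat 1"
    using matrix_left_right_inverse AB by blast
  ultimately show ?thesis using A unfolding GL_over_def by blast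
qed

lemma power_series_matrix_z_lattice:
  fixes A :: "complex fls ^ 'm::finite ^ 'm"
  assumes "\<And>i j. A $ i $ j \<in> power_series" "v \<in> z_lattice k"
  shows "A *v v \<in> z_lattice k"
proof -
  have "A *v axis j 1 \<in> z_lattice (- 0)" for j
    using assms(1) by (simp add: z_lattice_iff power_series_iff matrix_vector_mult_def axis_def coef_def
        if_distrib cong: if_cong)
  from matrix_z_lattice[OF this assms(2)] show ?thesis by simp
qed

text \<open>The vectors are completed to a basis, whose further members fill the columns not of the
  form \<open>e i\<close> with \<open>i < r\<close>.\<close>

lemma extend_independent_columns:
  fixes w :: "nat \<Rightarrow> complex ^ 'm::finite" and e :: "nat \<Rightarrow> 'm"
  assumes indep: "\<And>c i. (\<Sum>i<r. c i *s w i) = 0 \<Longrightarrow> i < r \<Longrightarrow> c i = 0"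
  shows "r \<le> CARD('m)"
    and "inj_on e {..<r} \<Longrightarrow> \<exists>W. (\<forall>i<r. W (e i) = w i) \<and> Determinants.det (\<chi> i j. W j $ i) \<noteq> 0"
proof -
  have inj: "inj_on w {..<r}"
  proof (rule inj_onI, rule ccontr)
    fix i j assume ij: "i \<in> {..<r}" "j \<in> {..<r}" "w i = w j" "i \<noteq> j"
    have "(\<Sum>k<r. ((if k = i then 1 else 0) - (if k = j then 1 else 0)) *s w k)
        = (\<Sum>k<r. if k = i then w i else 0) - (\<Sum>k<r. if k = j then w j else 0)"
      unfolding sum_subtractf[symmetric] by (intro sum.cong) auto
    also have "\<dots> = 0" using ij by simp
    finally have "(if i = i then 1 else 0) - (if i = j then 1 else 0) = (0 :: complex)"
      using ij(1) by (intro indep[of "\<lambda>k. (if k = i then 1 else 0) - (if k = j then 1 else 0)" i]) auto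
    then show False using ij(4) by simp
  qed
  let ?B = "w ` {..<r}"
  have ind: "vec.independent ?B"
  proof (rule vec.independent_if_scalars_zero)
    fix f x assume f: "(\<Sum>x\<in>?B. f x *s x) = 0" and x: "x \<in> ?B"
    then have "(\<Sum>i<r. f (w i) *s w i) = 0" by (simp add: sum.reindex[OF inj])
    then show "f x = 0" using indep[of "\<lambda>i. f (w i)"] x by auto
  qed simp
  then have "card ?B \<le> vec.dim (UNIV :: (complex ^ 'm) set)" by (intro vec.independent_card_le_dim) auto
  then show "r \<le> CARD('m)" 
    by (simp only: card_image[OF inj] vec_dim_card card_lessThan)
  define B where "B = vec.extend_basis ?B"
  have B: "?B \<subseteq> B" "vec.independent B" "vec.span B = UNIV"
    unfolding B_def using vec.extend_basis_superset[OF ind] vec.independent_extend_basis[OF ind]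
      vec.span_extend_basis[OF ind] by auto
  have finB: "finite B" using B(2) by (rule vec.finiteI_independent)
  have cardB: "card B = CARD('m)"
  proof -
    have "vec.dim (UNIV :: (complex ^ 'm) set) = card B" by (rule vec.dim_eq_card) (simp_all add: B)
    then show ?thesis by (simp only: vec_dim_card)
  qed
  assume e: "inj_on e {..<r}"
  have "card (UNIV - e ` {..<r}) = card (B - ?B)"
    using B(1) finB by (simp add: card_Diff_subset card_image[OF e] card_image[OF inj] cardB)
  then obtain h where h: "bij_betw h (UNIV - e ` {..<r}) (B - ?B)"
    using finite_same_card_bij[of "UNIV - e ` {..<r}" "B - ?B"] finB by auto
  define W where "W j = (if j \<in> e ` {..<r} then w (inv_into {..<r} e j) else h j)" for j
  have We: "W (e i) = w i" if "i < r" for i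
    using that by (simp add: W_def inv_into_f_f[OF e])
  have "bij_betw W (e ` {..<r} \<union> (UNIV - e ` {..<r})) (?B \<union> (B - ?B))"
  proof (rule bij_betw_combine)
    have "bij_betw (w \<circ> inv_into {..<r} e) (e ` {..<r}) ?B"
      using e inj by (intro bij_betw_trans[OF bij_betw_inv_into]) (auto simp: bij_betw_def)
    then show "bij_betw W (e ` {..<r}) ?B" by (rule bij_betw_cong[THEN iffD1, rotated]) (simp add: W_def)
    show "bij_betw W (UNIV - e ` {..<r}) (B - ?B)"
      using h by (rule bij_betw_cong[THEN iffD1, rotated]) (simp add: W_def)
  qed auto
  moreover have "e ` {..<r} \<union> (UNIV - e ` {..<r}) = UNIV" "?B \<union> (B - ?B) = B" using B(1) by auto
  ultimately have W: "bij_betw W UNIV B" by simp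
  let ?A = "(\<chi> i j. W j $ i) :: complex ^ 'm ^ 'm"
  have col: "column j ?A = W j" for j by (simp add: column_def lvec_eq_iff)
  have "c i = 0" if c: "(\<Sum>i\<in>UNIV. c i *s column i ?A) = 0" for c i
  proof -
    have "(\<Sum>b\<in>B. c (inv_into UNIV W b) *s b) = (\<Sum>i\<in>UNIV. c i *s W i)"
      using bij_betw_inv_into_left[OF W] by (subst sum.reindex_bij_betw[OF W, symmetric]) simp
    also have "\<dots> = 0" using c by (simp add: col)
    finally have "c (inv_into UNIV W (W i)) = 0"
      using W by (intro vec.independentD[OF B(2) finB order.refl, of "\<lambda>b. c (inv_into UNIV W b)"])
        (auto simp: bij_betw_def)
    then show ?thesis using bij_betw_inv_into_left[OF W] by simp
  qed
  then have "\<exists>C. C ** ?A = Finite_Cartesian_Product.mat 1"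
    unfolding matrix_left_invertible_independent_columns by blast
  then have "invertible ?A" by (simp add: invertible_left_inverse)
  then have "Determinants.det ?A \<noteq> 0" by (simp add: invertible_det_nz)
  then show "\<exists>W. (\<forall>i<r. W (e i) = w i) \<and> Determinants.det (\<chi> i j. W j $ i) \<noteq> 0"
    using We by blast
qed

section \<open>Jordan bases of \<open>z\<close> on lattices modulo \<open>z^S\<close>\<close>

definition jordan_index :: "nat list \<Rightarrow> (nat \<times> nat) set" where
  "jordan_index \<mu> = {(k, i). i < length \<mu> \<and> 1 \<le> k \<and> k \<le> \<mu> ! i}"

definition jordan :: "int \<Rightarrow> ('m::finite) lvec set \<Rightarrow> nat list \<Rightarrow> (nat \<times> nat \<Rightarrow> 'm lvec) \<Rightarrow> bool" where
  "jordan S L \<mu> b \<longleftrightarrow> basis_mod (jordan_index \<mu>) b (z_lattice S) L \<and>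
     (\<forall>(k, i)\<in>jordan_index \<mu>. zmul 1 (b (k, i)) - (if k = 1 then 0 else b (k - 1, i)) \<in> z_lattice S)"

text \<open>Components of \<open>\<eta>\<close> are indexed by an unordered type, parts of
  \<open>\<mu>\<close> by positions. The bijection \<open>e\<close> matches them, with missing parts
  counted as 0.\<close>

definition enumer :: "(nat \<Rightarrow> 'm::finite) \<Rightarrow> ('m \<Rightarrow> int) \<Rightarrow> nat list \<Rightarrow> int \<Rightarrow> bool" where
  "enumer e \<eta> \<mu> S \<longleftrightarrow> bij_betw e {..<CARD('m)} UNIV \<and> length \<mu> \<le> CARD('m) \<and>
     (\<forall>i<CARD('m). \<eta> (e i) = int (if i < length \<mu> then \<mu> ! i else 0) - S)"

lemma finite_jordan_index: "finite (jordan_index \<mu>)"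
proof (rule finite_subset)
  show "jordan_index \<mu> \<subseteq> {..sum_list \<mu>} \<times> {..<length \<mu>}"
    by (auto simp: jordan_index_def intro: order_trans[OF _ elem_le_sum_list])
qed simp

lemma enumer_exists:
  fixes \<eta> :: "'m::finite \<Rightarrow> int"
  assumes len: "length \<mu> \<le> CARD('m)"
    and eq: "image_mset \<eta> (mset_set UNIV) = mset (map (\<lambda>p. int p - S) (pad CARD('m) \<mu>))"
  shows "\<exists>e. enumer e \<eta> \<mu> S"
proof -
  obtain ys :: "'m list" where ys: "set ys = UNIV" "distinct ys"
    using finite_distinct_list[of "UNIV :: 'm set"] by auto
  have "mset ys = mset_set UNIV" using mset_set_set[OF ys(2)] by (simp add: ys(1))
  then have "mset (map (\<lambda>p. int p - S) (pad CARD('m) \<mu>)) = mset (map \<eta> ys)" using eq by simp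
  then obtain p where p: "p permutes {..<length (map \<eta> ys)}"
    "permute_list p (map \<eta> ys) = map (\<lambda>p. int p - S) (pad CARD('m) \<mu>)"
    by (rule mset_eq_permutation)
  have lys: "length ys = CARD('m)" using distinct_card[OF ys(2)] by (simp add: ys(1))
  have bn: "bij_betw (\<lambda>i. ys ! i) {..<CARD('m)} UNIV" by (rule bij_betw_nth[OF ys(2)]) (simp_all add: lys ys(1))
  have bp: "bij_betw p {..<CARD('m)} {..<CARD('m)}" using p(1) lys by (simp add: permutes_imp_bij)
  have "bij_betw (\<lambda>i. ys ! p i) {..<CARD('m)} UNIV"
    using bij_betw_trans[OF bp bn] by (simp only: comp_def)
  moreover have "\<eta> (ys ! p i) = int (if i < length \<mu> then \<mu> ! i else 0) - S" if i: "i < CARD('m)" for i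
  proof -
    have "p i < length ys" using permutes_in_image[OF p(1), of i] i lys by simp
    then have "\<eta> (ys ! p i) = map \<eta> ys ! p i" by simp
    also have "\<dots> = permute_list p (map \<eta> ys) ! i" using permute_list_nth[OF p(1)] i lys by simp
    also have "\<dots> = int (pad CARD('m) \<mu> ! i) - S"
      unfolding p(2) by (rule nth_map) (use i len in \<open>simp add: pad_def\<close>)
    finally show ?thesis using i len by (simp add: pad_def nth_append)
  qed
  ultimately have "enumer (\<lambda>i. ys ! p i) \<eta> \<mu> S" using len by (simp add: enumer_def)
  then show ?thesis by blast
qed

lemma jordan_index_monomial_basis:
  assumes e: "enumer e \<eta> \<mu> S"
  shows "basis_mod (jordan_index \<mu>) (\<lambda>(k, i). mon (e i) (S - int k)) (z_lattice S) (std_lattice \<eta>)"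
    and "z_lattice S \<subseteq> std_lattice \<eta>"
proof -
  have bij: "bij_betw e {..<CARD('a)} UNIV" and len: "length \<mu> \<le> CARD('a)"
    and \<eta>: "\<And>i. i < CARD('a) \<Longrightarrow> \<eta> (e i) = int (if i < length \<mu> then \<mu> ! i else 0) - S"
    using e by (auto simp: enumer_def)
  have surj: "\<exists>i<CARD('a). j = e i" for j using bij unfolding bij_betw_def by blast
  have ge: "- \<eta> j \<le> S" for j using surj[of j] \<eta> by auto
  then show "z_lattice S \<subseteq> std_lattice \<eta>"
    unfolding z_lattice_iff std_lattice_iff subset_iff by (meson less_le_trans)
  let ?f = "\<lambda>(k, i). (e i, S - int k)"
  have "bij_betw ?f (jordan_index \<mu>) (SIGMA j:UNIV. {- \<eta> j..<S})"
  proof (rule bij_betw_imageI)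
    have "inj_on e {..<CARD('a)}" using bij by (rule bij_betw_imp_inj_on)
    then have "e i = e i' \<Longrightarrow> i < length \<mu> \<Longrightarrow> i' < length \<mu> \<Longrightarrow> i = i'" for i i'
      using len by (auto dest: inj_onD)
    then show "inj_on ?f (jordan_index \<mu>)" by (auto simp: inj_on_def jordan_index_def)
    show "?f ` jordan_index \<mu> = (SIGMA j:UNIV. {- \<eta> j..<S})"
    proof (intro equalityI subsetI)
      fix x assume "x \<in> ?f ` jordan_index \<mu>"
      then obtain k i where *: "x = (e i, S - int k)" "i < length \<mu>" "1 \<le> k" "k \<le> \<mu> ! i"
        by (auto simp: jordan_index_def)
      then show "x \<in> (SIGMA j:UNIV. {- \<eta> j..<S})" using \<eta>[of i] len by auto
    next
      fix x assume "x \<in> (SIGMA j:UNIV. {- \<eta> j..<S})"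
      then obtain j n where x: "x = (j, n)" "- \<eta> j \<le> n" "n < S" by auto
      obtain i where i: "i < CARD('a)" "j = e i" using surj by blast
      have "i < length \<mu>" using x \<eta>[OF i(1)] i(2) by (cases "i < length \<mu>") auto
      then have "(nat (S - n), i) \<in> jordan_index \<mu>" using x \<eta>[OF i(1)] i(2) by (auto simp: jordan_index_def)
      moreover have "x = ?f (nat (S - n), i)" using x i by simp
      ultimately show "x \<in> ?f ` jordan_index \<mu>" by blast
    qed
  qed
  then have "basis_mod (jordan_index \<mu>) (\<lambda>p. mon (fst (?f p)) (snd (?f p))) (z_lattice S) (std_lattice \<eta>)"
    by (rule basis_mod_reindex[OF subspace_z_lattice _ _ std_lattice_monomial_basis[OF ge], rotated]) simp
  then show "basis_mod (jordan_index \<mu>) (\<lambda>(k, i). mon (e i) (S - int k)) (z_lattice S) (std_lattice \<eta>)"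
    by (simp add: case_prod_unfold)
qed

text \<open>Matrices in \<open>GL(\<complex>[[z]])\<close> preserve \<open>z_lattice S\<close>, so
  the monomial Jordan basis of \<open>L_\<eta>\<close> is carried to one of
  \<open>L\<close>.\<close>

lemma Gr_orbit_jordan:
  assumes e: "enumer e \<eta> \<mu> S" and L: "L \<in> Gr_orbit \<eta>"
  shows "z_lattice S \<subseteq> L" and "\<exists>b. jordan S L \<mu> b"
proof -
  obtain A where A: "A \<in> GL_over power_series" "L = (\<lambda>v. A *v v) ` std_lattice \<eta>"
    using L by (auto simp: Gr_orbit_def)
  obtain B where ps: "\<And>i j. A $ i $ j \<in> power_series" "\<And>i j. B $ i $ j \<in> power_series"
    and AB: "A ** B = Finite_Cartesian_Product.mat 1" "B ** A = Finite_Cartesian_Product.mat 1"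
    using A(1) by (auto simp: GL_over_def)
  have inv: "A *v (B *v v) = v" "B *v (A *v v) = v" for v
    by (simp_all add: matrix_vector_mul_assoc AB)
  note z_phi = power_series_matrix_z_lattice[OF ps(1)] and Bz = power_series_matrix_z_lattice[OF ps(2)]
  note mb = jordan_index_monomial_basis[OF e]
  show zL: "z_lattice S \<subseteq> L"
  proof
    fix v :: "'a lvec" assume "v \<in> z_lattice S"
    then have "B *v v \<in> std_lattice \<eta>" using Bz mb(2) by blast
    moreover have "v = A *v (B *v v)" by (simp add: inv)
    ultimately show "v \<in> L" unfolding A(2) by blast
  qed
  let ?b = "\<lambda>p. A *v (case p of (k, i) \<Rightarrow> mon (e i) (S - int k))"
  have "basis_mod (jordan_index \<mu>) ?b (z_lattice S) L"
  proof (rule basis_mod_transport[OF subspace_z_lattice subspace_z_lattice finite_jordan_index subspace_std_lattice _ _ _ _ _ mb(1)])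
    show "A *v v \<in> L" if "v \<in> std_lattice \<eta>" for v using that A(2) by blast
    show "A *v v \<in> z_lattice S \<longleftrightarrow> v \<in> z_lattice S" for v
      using z_phi[of v S] Bz[of "A *v v" S] by (auto simp: inv)
    show "\<exists>v\<in>std_lattice \<eta>. w - A *v v \<in> z_lattice S" if "w \<in> L" for w
      using that unfolding A(2) by (auto simp: z_lattice_iff)
  qed (simp_all add: matrix_vector_mul_add matrix_vector_mul_cmul)
  moreover have "zmul 1 (?b (k, i)) - (if k = 1 then 0 else ?b (k - 1, i)) \<in> z_lattice S"
    if k: "(k, i) \<in> jordan_index \<mu>" for k i
  proof (cases "k = 1")
    case True
    have "mon (e i) S \<in> z_lattice S" by (auto simp: z_lattice_iff coef_mon)
    then have "A *v mon (e i) S \<in> z_lattice S" by (rule z_phi)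
    moreover have "zmul 1 (?b (k, i)) = A *v mon (e i) S"
      using True by (simp flip: matrix_vector_mul_zmul)
    ultimately show ?thesis using True by simp
  next
    case False
    then have "zmul 1 (?b (k, i)) = ?b (k - 1, i)"
      using k by (simp add: jordan_index_def of_nat_diff flip: matrix_vector_mul_zmul)
        (simp add: algebra_simps)
    then show ?thesis using False by (simp add: z_lattice_iff)
  qed
  ultimately show "\<exists>b. jordan S L \<mu> b" unfolding jordan_def by blast
qed

text \<open>The tops of the chains, rescaled to order 0, are power series vectors whose values at
  \<open>z = 0\<close> are the coefficients at \<open>S - 1\<close> of the chain bottoms. These are
  independent, which bounds the number of chains. Completed by constant vectors, the rescaled tops
  form a matrix \<open>A\<close> invertible over power series with
  \<open>L = A L_\<eta>\<close>.\<close>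

lemma jordan_Gr_orbit:
  fixes L :: "('m::finite) lvec set"
  assumes L: "zsub L" and zL: "z_lattice S \<subseteq> L" and b: "jordan S L \<mu> b" and \<mu>: "0 \<notin> set \<mu>"
  shows "length \<mu> \<le> CARD('m)" and "enumer e \<eta> \<mu> S \<Longrightarrow> L \<in> Gr_orbit \<eta>"
proof -
  have bm: "basis_mod (jordan_index \<mu>) b (z_lattice S) L"
    and ch: "\<And>k i. (k, i) \<in> jordan_index \<mu> \<Longrightarrow> zmul 1 (b (k, i)) - (if k = 1 then 0 else b (k - 1, i)) \<in> z_lattice S"
    using b by (auto simp: jordan_def)
  have sub: "cv.subspace L" using L by (simp add: zsub_def)
  have bL: "b p \<in> L" if "p \<in> jordan_index \<mu>" for p using bm that by (rule basis_mod_subset)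
  have pos: "1 \<le> \<mu> ! i" if "i < length \<mu>" for i
    using \<mu> that nth_mem[OF that] by (metis less_one not_less)
  then have one: "(1, i) \<in> jordan_index \<mu>" if "i < length \<mu>" for i using that by (simp add: jordan_index_def)
  \<comment> \<open>Chain bottoms are killed by \<open>z\<close> modulo \<open>z^S\<close>, so
    modulo \<open>z^S\<close> they have a coefficient at \<open>S - 1\<close> only.\<close>
  have b1: "b (1, i) \<in> z_lattice (S - 1)" if "i < length \<mu>" for i
  proof -
    have "zmul 1 (b (1, i)) \<in> z_lattice S" using ch[OF one[OF that]] by simp
    then have "zmul (- 1) (zmul 1 (b (1, i))) \<in> z_lattice (S - 1)" by (rule zmul_in_z_lattice) simp
    then show ?thesis by simp
  qed
  define w where "w i = (\<chi> j. coef (b (1, i)) j (S - 1))" for i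
  have indep: "c i = 0" if c: "(\<Sum>i<length \<mu>. c i *s w i) = 0" and i: "i < length \<mu>" for c i
  proof -
    \<comment> \<open>A relation among these coefficients is a relation modulo \<open>z^S\<close>
      among the basis vectors with \<open>k = 1\<close>.\<close>
    let ?d = "\<lambda>(k, i). if k = 1 then c i else 0"
    have inj: "inj_on (\<lambda>i. (1 :: nat, i)) {..<length \<mu>}" by (simp add: inj_on_def)
    have "(\<Sum>p\<in>jordan_index \<mu>. cmul (?d p) (b p)) = (\<Sum>p\<in>(\<lambda>i. (1, i)) ` {..<length \<mu>}. cmul (?d p) (b p))"
      using one by (intro sum.mono_neutral_right finite_jordan_index) (auto simp: jordan_index_def image_iff)
    also have "\<dots> = (\<Sum>i<length \<mu>. cmul (c i) (b (1, i)))"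
      unfolding sum.reindex[OF inj] by simp
    also have "\<dots> \<in> z_lattice S"
      unfolding z_lattice_iff
    proof (intro allI impI)
      fix j n assume n: "n < S"
      show "coef (\<Sum>i<length \<mu>. cmul (c i) (b (1, i))) j n = 0"
      proof (cases "n = S - 1")
        case True
        have "(\<Sum>i<length \<mu>. c i *s w i) $ j = 0" using c by simp
        then show ?thesis using True by (simp add: w_def)
      next
        case False
        then show ?thesis using b1 n by (simp add: z_lattice_iff)
      qed
    qed
    finally have z: "(\<Sum>p\<in>jordan_index \<mu>. cmul (?d p) (b p)) \<in> z_lattice S" .
    have ne: "L \<noteq> {}" using cv.subspace_0[OF sub] by blast
    show ?thesis
      using basis_mod_indep[OF bm subspace_z_lattice finite_jordan_index ne z one[OF i]] by simp
  qed
  show "length \<mu> \<le> CARD('m)"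
    by (rule extend_independent_columns(1)[where r = "length \<mu>" and w = w]) (rule indep)
  assume e: "enumer e \<eta> \<mu> S"
  then have bij: "bij_betw e {..<CARD('m)} UNIV" and len: "length \<mu> \<le> CARD('m)"
    and \<eta>: "\<And>i. i < CARD('m) \<Longrightarrow> \<eta> (e i) = int (if i < length \<mu> then \<mu> ! i else 0) - S"
    by (auto simp: enumer_def)
  have inje: "inj_on e {..<length \<mu>}"
    using bij_betw_imp_inj_on[OF bij] by (rule inj_on_subset) (use len in auto)
  have "\<exists>W. (\<forall>i<length \<mu>. W (e i) = w i) \<and> Determinants.det (\<chi> i j. W j $ i) \<noteq> 0"
    by (rule extend_independent_columns(2)[OF _ inje]) (rule indep)
  then obtain W where W: "\<And>i. i < length \<mu> \<Longrightarrow> W (e i) = w i"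
    "Determinants.det (\<chi> i j. W j $ i) \<noteq> 0" by blast
  have surj: "\<exists>i<CARD('m). j = e i" for j using bij unfolding bij_betw_def by blast
  have chain: "zmul (int q) (b (\<mu> ! i, i)) - b (\<mu> ! i - q, i) \<in> z_lattice S" if "i < length \<mu>" "q < \<mu> ! i" for i q
    using that(2)
  proof (induction q)
    case (Suc q)
    let ?k = "\<mu> ! i - q"
    have k: "(?k, i) \<in> jordan_index \<mu>" "?k \<noteq> 1" using Suc.prems that(1) by (auto simp: jordan_index_def)
    have IH: "zmul (int q) (b (\<mu> ! i, i)) - b (?k, i) \<in> z_lattice S" using Suc by simp
    have "zmul (int (Suc q)) (b (\<mu> ! i, i)) - b (\<mu> ! i - Suc q, i) =
        zmul 1 (zmul (int q) (b (\<mu> ! i, i)) - b (?k, i)) + (zmul 1 (b (?k, i)) - b (?k - 1, i))"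
      by (simp add: zmul_diff add.commute)
    also have "\<dots> \<in> z_lattice S"
      using ch[OF k(1)] k(2) IH
      by (intro cv.subspace_add[OF subspace_z_lattice] zmul_in_z_lattice[of _ S]) auto
    finally show ?case .
  qed (simp add: z_lattice_iff)
  \<comment> \<open>Column \<open>j\<close> of the matrix: a rescaled chain top or, for a padded
    part, the constant vector \<open>W j\<close>.\<close>
  define u where "u j = (let i = inv_into {..<CARD('m)} e j in
      if i < length \<mu> then zmul (int (\<mu> ! i) - S) (b (\<mu> ! i, i)) else (\<chi> l. fls_const (W j $ l)))" for j
  have inv_e: "inv_into {..<CARD('m)} e (e i) = i" if "i < CARD('m)" for i
    using bij_betw_inv_into_left[OF bij] that by simp
  have u1: "u (e i) = zmul (int (\<mu> ! i) - S) (b (\<mu> ! i, i))" if "i < length \<mu>" for i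
    using that len by (simp add: u_def inv_e)
  have u2: "u (e i) = (\<chi> l. fls_const (W (e i) $ l))" if "i < CARD('m)" "\<not> i < length \<mu>" for i
    using that by (simp add: u_def inv_e)
  \<comment> \<open>The power \<open>\<mu> ! i - 1\<close> of \<open>z\<close> takes a top to its
    bottom, whose order is at least \<open>S - 1\<close>; together the shifts give
    \<open>\<mu> ! i - S\<close>.\<close>
  have u0: "u j \<in> z_lattice 0 \<and> (\<forall>l. coef (u j) l 0 = W j $ l)" for j
  proof -
    obtain i where i: "i < CARD('m)" "j = e i" using surj by blast
    show ?thesis
    proof (cases "i < length \<mu>")
      case True
      let ?m = "\<mu> ! i"
      have m: "1 \<le> ?m" using pos[OF True] .
      have d: "zmul (int (?m - 1)) (b (?m, i)) - b (1, i) \<in> z_lattice S"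
        using chain[OF True, of "?m - 1"] m by simp
      have co1: "coef (u j) l n = coef (zmul (int (?m - 1)) (b (?m, i))) l (n + S - 1)" for l n
        using m by (simp add: i(2) u1[OF True] of_nat_diff algebra_simps)
      have co2: "coef (u j) l n = coef (b (1, i)) l (n + S - 1)" if "n < 1" for l n
      proof -
        have "coef (zmul (int (?m - 1)) (b (?m, i)) - b (1, i)) l (n + S - 1) = 0"
          using d that unfolding z_lattice_iff by simp
        then show ?thesis unfolding co1 by simp
      qed
      show ?thesis
        using b1[OF True] by (auto simp: z_lattice_iff co2 i(2)[symmetric] W(1)[OF True, folded i(2)] w_def)
    next
      case False
      then show ?thesis by (simp add: i(2) u2[OF i(1)] z_lattice_iff coef_def)
    qed
  qed
  define A :: "complex fls ^ 'm ^ 'm" where "A = (\<chi> l j. u j $ l)"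
  have Aps: "A $ l $ j \<in> power_series" for l j
    using u0[of j] by (simp add: A_def power_series_iff z_lattice_iff coef_def)
  have "fls_nth (A $ l $ j) 0 = W j $ l" for l j
    using u0[of j] by (simp add: A_def coef_def)
  then have AGL: "A \<in> GL_over power_series" using W(2) by (intro GL_over_power_seriesI Aps) simp
  have Aax: "A *v axis j 1 = u j" for j
    by (simp add: lvec_eq_iff matrix_vector_mult_def axis_def A_def if_distrib cong: if_cong)
  have mb: "z_lattice S \<subseteq> std_lattice \<eta>" by (rule jordan_index_monomial_basis(2)[OF e])
  \<comment> \<open>Padded columns times \<open>z^S\<close> lie in \<open>z_lattice S\<close>, hence
    in \<open>L\<close>; the others give back the chain tops.\<close>
  have uL: "zmul (- \<eta> j) (u j) \<in> L" for j
  proof -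
    obtain i where i: "i < CARD('m)" "j = e i" using surj by blast
    show ?thesis
    proof (cases "i < length \<mu>")
      case True
      have "zmul (- \<eta> j) (u j) = b (\<mu> ! i, i)" using True i by (simp add: u1 \<eta>)
      then show ?thesis using bL[of "(\<mu> ! i, i)"] True pos[OF True] by (simp add: jordan_index_def)
    next
      case False
      have "zmul S (u j) \<in> z_lattice S" using u0[of j] by (intro zmul_in_z_lattice[of _ 0]) auto
      then show ?thesis using False i zL by (auto simp: \<eta>)
    qed
  qed
  have AstdL: "A *v v \<in> L" if v: "v \<in> std_lattice \<eta>" for v
  proof -
    have "v $ j *s (A *v axis j 1) \<in> L" for j
    proof -
      have "fls_shift (- \<eta> j) (v $ j) \<in> power_series"
        using v by (simp add: power_series_iff std_lattice_iff coef_def)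
      then have "fls_shift (- \<eta> j) (v $ j) *s zmul (- \<eta> j) (u j) \<in> L"
        using uL by (rule zsub_power_series_smult[OF L zL])
      moreover have "v $ j *s (A *v axis j 1) = fls_shift (- \<eta> j) (v $ j) *s zmul (- \<eta> j) (u j)"
        unfolding Aax by (simp add: zmul_def fls_shifted_times_simps)
      ultimately show ?thesis by simp
    qed
    then show ?thesis
      unfolding matrix_vector_sum_columns[of A v] by (intro cv.subspace_sum[OF sub]) auto
  qed
  let ?L2 = "(\<lambda>v. A *v v) ` std_lattice \<eta>"
  have zs2: "zsub ?L2" by (intro zsub_image zsub_std_lattice)
  then have sub2: "cv.subspace ?L2" by (simp add: zsub_def)
  have L2orb: "?L2 \<in> Gr_orbit \<eta>" using AGL by (auto simp: Gr_orbit_def)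
  have z2: "z_lattice S \<subseteq> ?L2" by (rule Gr_orbit_jordan(1)[OF e L2orb])
  have top: "b (\<mu> ! i, i) \<in> ?L2" if i: "i < length \<mu>" for i
  proof -
    have m: "mon (e i) (- \<eta> (e i)) \<in> std_lattice \<eta>" by (auto simp: std_lattice_iff coef_mon)
    have "A *v mon (e i) (- \<eta> (e i)) = zmul (- \<eta> (e i)) (u (e i))"
      by (simp add: mon_eq_axis matrix_vector_mul_zmul Aax)
    also have "\<dots> = b (\<mu> ! i, i)" using i len by (simp add: u1 \<eta>)
    finally show ?thesis using m by (metis imageI)
  qed
  \<comment> \<open>Lower members of a chain are powers of \<open>z\<close> times its top, up to
    elements of \<open>z_lattice S \<subseteq> ?L2\<close>.\<close>
  have b2: "b p \<in> ?L2" if pJ: "p \<in> jordan_index \<mu>" for p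
  proof -
    obtain k i where p: "p = (k, i)" "i < length \<mu>" "1 \<le> k" "k \<le> \<mu> ! i"
      using pJ by (auto simp: jordan_index_def)
    let ?q = "\<mu> ! i - k"
    let ?d = "zmul (int ?q) (b (\<mu> ! i, i)) - b (k, i)"
    have "?d \<in> z_lattice S" using chain[OF p(2), of ?q] p by simp
    then have d: "?d \<in> ?L2" using z2 by blast
    have "zmul (int ?q) (b (\<mu> ! i, i)) \<in> ?L2" by (rule zsub_zmul_nat[OF zs2 top[OF p(2)]])
    then have "zmul (int ?q) (b (\<mu> ! i, i)) - ?d \<in> ?L2" using d by (rule cv.subspace_diff[OF sub2])
    then show ?thesis by (simp add: p(1))
  qed
  have "L = ?L2"
  proof (intro equalityI subsetI)
    fix v assume "v \<in> L"
    then obtain c where c: "v - (\<Sum>p\<in>jordan_index \<mu>. cmul (c p) (b p)) \<in> z_lattice S" using bm by (elim basis_mod_span)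
    have "(\<Sum>p\<in>jordan_index \<mu>. cmul (c p) (b p)) \<in> ?L2"
      by (intro cv.subspace_sum[OF sub2] cv.subspace_scale[OF sub2] b2)
    then have "(v - (\<Sum>p\<in>jordan_index \<mu>. cmul (c p) (b p))) + (\<Sum>p\<in>jordan_index \<mu>. cmul (c p) (b p)) \<in> ?L2"
      by (intro cv.subspace_add[OF sub2] subsetD[OF z2 c])
    then show "v \<in> ?L2" by simp
  qed (use AstdL in blast)
  then show "L \<in> Gr_orbit \<eta>" using L2orb by simp
qed

section \<open>Closures of orbits\<close>

context slice_setup
begin

lemma nilp_orbit_iff:
  "A \<in> nilp_orbit \<sigma> S \<mu> \<longleftrightarrow> A \<in> End_D \<sigma> S \<and>
    (\<exists>b. basis_mod (jordan_index \<mu>) b (z_lattice S) (std_lattice \<sigma>) \<and>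
      (\<forall>(k, i)\<in>jordan_index \<mu>. lift S A (b (k, i)) - (if k = 1 then 0 else b (k - 1, i)) \<in> z_lattice S))"
proof -
  have "(\<forall>i<length \<mu>. \<forall>k. 1 \<le> k \<and> k \<le> \<mu> ! i \<longrightarrow>
        A (cls S (b (k, i))) = (if k = 1 then cls S 0 else cls S (b (k - 1, i)))) \<longleftrightarrow>
      (\<forall>(k, i)\<in>jordan_index \<mu>. lift S A (b (k, i)) - (if k = 1 then 0 else b (k - 1, i)) \<in> z_lattice S)"
    if A: "A \<in> End_D \<sigma> S" and b: "basis_mod (jordan_index \<mu>) b (z_lattice S) (std_lattice \<sigma>)" for b
  proof -
    have "A (cls S (b (k, i))) = (if k = 1 then cls S 0 else cls S (b (k - 1, i))) \<longleftrightarrow>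
        lift S A (b (k, i)) - (if k = 1 then 0 else b (k - 1, i)) \<in> z_lattice S" if "(k, i) \<in> jordan_index \<mu>" for k i
      using cls_lift[OF A basis_mod_subset[OF b that]] by (auto simp flip: cls_eq_iff)
    then show ?thesis by (auto simp: jordan_index_def)
  qed
  then show ?thesis unfolding nilp_orbit_def jordan_index_def[symmetric] by blast
qed

text \<open>The \<open>k\<close>-th vector of a chain is killed by the \<open>k\<close>-th power
  modulo \<open>z^S\<close>, and the sum of the parts bounds every \<open>k\<close>.\<close>

lemma nilp_orbit_subset: "nilp_orbit \<sigma> S \<mu> \<subseteq> nilp_cone \<sigma> S"
proof
  fix A assume "A \<in> nilp_orbit \<sigma> S \<mu>"
  then obtain b where A: "A \<in> End_D \<sigma> S"
    and b: "basis_mod (jordan_index \<mu>) b (z_lattice S) (std_lattice \<sigma>)"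
    and ch: "\<And>k i. (k, i) \<in> jordan_index \<mu> \<Longrightarrow> lift S A (b (k, i)) - (if k = 1 then 0 else b (k - 1, i)) \<in> z_lattice S"
    unfolding nilp_orbit_iff by blast
  define K where "K n = {v \<in> std_lattice \<sigma>. (lift S A ^^ n) v \<in> z_lattice S}" for n
  have z0: "0 \<in> std_lattice \<sigma>" "0 \<in> z_lattice S" by (auto simp: std_lattice_iff z_lattice_iff)
  have pow0: "(lift S A ^^ n) 0 = 0" for n by (induction n) (simp_all add: lift_0[OF A])
  have subK: "cv.subspace (K n)" for n
    unfolding K_def cv.subspace_def
    using z0 by (auto simp: pow0 lift_pow_add[OF A] lift_pow_cmul[OF A] std_add std_scale
        intro: cv.subspace_add[OF subspace_z_lattice] cv.subspace_scale[OF subspace_z_lattice])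
  have zK: "z_lattice S \<subseteq> K n" for n
  proof
    fix v :: "'m lvec" assume v: "v \<in> z_lattice S"
    have "(lift S A ^^ n) v \<in> z_lattice S"
    proof (cases n)
      case (Suc n')
      have "lift S A v = 0" using lift_cong[OF A, of v 0] v lift_0[OF A] by simp
      then show ?thesis using z0 by (simp add: Suc funpow_Suc_right pow0 del: funpow.simps)
    qed (use v in simp)
    then show "v \<in> K n" using v sub_std by (auto simp: K_def)
  qed
  have K_step: "v \<in> K (Suc n)" if "v \<in> std_lattice \<sigma>" "lift S A v \<in> K n" for v n
    using that by (simp add: K_def funpow_Suc_right del: funpow.simps)
  have bK: "(k, i) \<in> jordan_index \<mu> \<Longrightarrow> b (k, i) \<in> K k" for k i
  proof (induction k)
    case 0
    then show ?case by (simp add: jordan_index_def)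
  next
    case (Suc k)
    have bs: "b (Suc k, i) \<in> std_lattice \<sigma>" using b Suc.prems by (rule basis_mod_subset)
    let ?w = "if Suc k = 1 then 0 else b (k, i)"
    have "?w \<in> K k"
    proof (cases "k = 0")
      case True
      then show ?thesis using cv.subspace_0[OF subK] by simp
    next
      case False
      then show ?thesis using Suc by (simp add: jordan_index_def)
    qed
    moreover have "lift S A (b (Suc k, i)) - ?w \<in> z_lattice S"
      using ch[OF Suc.prems] by (cases "k = 0") simp_all
    then have "lift S A (b (Suc k, i)) - ?w \<in> K k" by (rule subsetD[OF zK])
    ultimately have "?w + (lift S A (b (Suc k, i)) - ?w) \<in> K k" by (rule cv.subspace_add[OF subK])
    then have "lift S A (b (Suc k, i)) \<in> K k" by (simp only: add_diff_eq add_diff_cancel_left')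
    then show ?case using bs by (rule K_step[rotated])
  qed
  have Kmono: "v \<in> K n \<Longrightarrow> v \<in> K (Suc n)" for v n
  proof -
    assume v: "v \<in> K n"
    have "lift S A ((lift S A ^^ n) v) = lift S A 0" using v by (intro lift_cong[OF A]) (simp add: K_def)
    then show "v \<in> K (Suc n)" using v z0 by (simp add: K_def lift_0[OF A])
  qed
  then have Kmono': "K n \<subseteq> K m" if "n \<le> m" for n m using that lift_Suc_mono_le[of K] by blast
  let ?n = "sum_list \<mu>"
  have "b p \<in> K ?n" if pJ: "p \<in> jordan_index \<mu>" for p
  proof -
    obtain k i where p: "p = (k, i)" "i < length \<mu>" "k \<le> \<mu> ! i"
      using pJ by (auto simp: jordan_index_def)
    have "k \<le> ?n" using p elem_le_sum_list[of i \<mu>] by simp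
    then show ?thesis using bK[of k i] pJ p(1) Kmono' by blast
  qed
  then have span: "(\<Sum>p\<in>jordan_index \<mu>. cmul (c p) (b p)) \<in> K ?n" for c
    by (intro cv.subspace_sum[OF subK] cv.subspace_scale[OF subK])
  have "v \<in> K ?n" if "v \<in> std_lattice \<sigma>" for v
  proof -
    obtain c where "v - (\<Sum>p\<in>jordan_index \<mu>. cmul (c p) (b p)) \<in> z_lattice S"
      using b \<open>v \<in> std_lattice \<sigma>\<close> by (rule basis_mod_span)
    then have "(v - (\<Sum>p\<in>jordan_index \<mu>. cmul (c p) (b p))) + (\<Sum>p\<in>jordan_index \<mu>. cmul (c p) (b p)) \<in> K ?n"
      using zK by (intro cv.subspace_add[OF subK] span) blast
    then show ?thesis by simp
  qed
  then show "A \<in> nilp_cone \<sigma> S" using nilp_cone_iff[OF A] by (auto simp: K_def)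
qed

abbreviation cl_orbit :: "nat list \<Rightarrow> ('m lvec set \<Rightarrow> 'm lvec set) set" where
  "cl_orbit \<mu> \<equiv> ztop (End_D_fspace \<sigma> S) closure_of nilp_orbit \<sigma> S \<mu>"

lemma cl_orbit_iff:
  "A \<in> cl_orbit \<mu> \<longleftrightarrow> A \<in> End_D \<sigma> S \<and>
    (\<forall>p\<in>polyfun (End_coords \<sigma> S). p A \<noteq> 0 \<longrightarrow> (\<exists>A'\<in>nilp_orbit \<sigma> S \<mu>. p A' \<noteq> 0))"
proof -
  have E: "nilp_orbit \<sigma> S \<mu> \<subseteq> End_D \<sigma> S" by (auto simp: nilp_orbit_def)
  have top: "ztop (End_D_fspace \<sigma> S) = zariski (End_coords \<sigma> S) (End_D \<sigma> S)"
    by (simp add: End_D_fspace_def affine_fspace_def)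
  show ?thesis
    unfolding top in_closure_of topspace_zariski
  proof (intro conj_cong refl iffI ballI impI allI)
    fix p
    assume A: "A \<in> End_D \<sigma> S"
      and cl: "\<forall>T. A \<in> T \<and> openin (zariski (End_coords \<sigma> S) (End_D \<sigma> S)) T \<longrightarrow> (\<exists>y. y \<in> nilp_orbit \<sigma> S \<mu> \<and> y \<in> T)"
      and p: "p \<in> polyfun (End_coords \<sigma> S)" "p A \<noteq> 0"
    have "openin (zariski (End_coords \<sigma> S) (End_D \<sigma> S)) {B \<in> End_D \<sigma> S. p B \<noteq> 0}"
      unfolding openin_zariski using p(1) by blast
    then have "\<exists>y. y \<in> nilp_orbit \<sigma> S \<mu> \<and> y \<in> {B \<in> End_D \<sigma> S. p B \<noteq> 0}"
      using A p(2) by (intro cl[rule_format]) simp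
    then show "\<exists>A'\<in>nilp_orbit \<sigma> S \<mu>. p A' \<noteq> 0" by blast
  next
    fix T
    assume A: "A \<in> End_D \<sigma> S"
      and cl: "\<forall>p\<in>polyfun (End_coords \<sigma> S). p A \<noteq> 0 \<longrightarrow> (\<exists>A'\<in>nilp_orbit \<sigma> S \<mu>. p A' \<noteq> 0)"
      and T: "A \<in> T \<and> openin (zariski (End_coords \<sigma> S) (End_D \<sigma> S)) T"
    then obtain p where "p \<in> polyfun (End_coords \<sigma> S)" "p A \<noteq> 0" "{B \<in> End_D \<sigma> S. p B \<noteq> 0} \<subseteq> T"
      unfolding openin_zariski by blast
    moreover from this cl obtain A' where "A' \<in> nilp_orbit \<sigma> S \<mu>" "p A' \<noteq> 0" by blast
    ultimately show "\<exists>y. y \<in> nilp_orbit \<sigma> S \<mu> \<and> y \<in> T" using E by blast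
  qed
qed

text \<open>The entries of the power with exponent \<open>nil_bound\<close> are polynomials
  vanishing on the orbit, hence on its closure.\<close>

lemma cl_orbit_nilp: "cl_orbit \<mu> \<subseteq> nilp_cone \<sigma> S"
proof
  fix A assume A: "A \<in> cl_orbit \<mu>"
  then have AE: "A \<in> End_D \<sigma> S" by (simp add: cl_orbit_iff)
  have "coef ((lift S A ^^ nil_bound) (mon j n)) i k = 0" if jn: "(j, n) \<in> J" for j n i k
  proof (rule ccontr)
    assume ne: "coef ((lift S A ^^ nil_bound) (mon j n)) i k \<noteq> 0"
    have n: "- \<sigma> j \<le> n" using jn by simp
    obtain p where p: "p \<in> polyfun (End_coords \<sigma> S)"
      "\<And>A. A \<in> End_D \<sigma> S \<Longrightarrow> coef ((lift S A ^^ nil_bound) (mon j n)) i k = p A"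
      using polyE_lift_pow[OF n, of nil_bound i k] unfolding polyE_def by blast
    have "p A \<noteq> 0" using ne p(2)[OF AE] by simp
    then obtain A' where A': "A' \<in> nilp_orbit \<sigma> S \<mu>" "p A' \<noteq> 0"
      using A p(1) unfolding cl_orbit_iff by blast
    have nil: "A' \<in> nilp_cone \<sigma> S" using A'(1) nilp_orbit_subset by blast
    have "p A' = coef ((lift S A' ^^ nil_bound) (mon j n)) i k" using p(2)[OF nilp_End[OF nil]] by simp
    also have "\<dots> = 0" using nilp_lift_pow[OF nil mon_std[OF n] order.refl] by simp
    finally show False using A'(2) by simp
  qed
  then have "(lift S A ^^ nil_bound) (mon j n) = 0" if "(j, n) \<in> J" for j n
    using that by (intro lvec_eqI) simp
  then show "A \<in> nilp_cone \<sigma> S" by (rule nilp_coneI[OF AE])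
qed

text \<open>Modulo \<open>z^S\<close> the jets intertwine \<open>A\<close> with \<open>z\<close>, so
  they carry a Jordan basis of \<open>A\<close> to one of \<open>z\<close> on the lattice.\<close>

lemma nilp_orbit_jet_lattice_jordan:
  assumes A: "A \<in> nilp_orbit \<sigma> S \<mu>" and inj: "jet_inj A"
  shows "\<exists>b. jordan S (jet_lattice A) \<mu> b"
proof -
  have nil: "A \<in> nilp_cone \<sigma> S" using A nilp_orbit_subset by blast
  note E = nilp_End[OF nil]
  obtain b where b: "basis_mod (jordan_index \<mu>) b (z_lattice S) (std_lattice \<sigma>)"
    and ch: "\<And>k i. (k, i) \<in> jordan_index \<mu> \<Longrightarrow> lift S A (b (k, i)) - (if k = 1 then 0 else b (k - 1, i)) \<in> z_lattice S"
    using A unfolding nilp_orbit_iff by blast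
  have bs: "b p \<in> std_lattice \<sigma>" if "p \<in> jordan_index \<mu>" for p using b that by (rule basis_mod_subset)
  have "basis_mod (jordan_index \<mu>) (\<lambda>p. jet_ext A (b p)) (z_lattice S) (jet_lattice A)"
    by (rule jet_ext_basis[OF nil inj order.refl finite_jordan_index b])
  moreover have "zmul 1 (jet_ext A (b (k, i))) - (if k = 1 then 0 else jet_ext A (b (k - 1, i))) \<in> z_lattice S"
    if k: "(k, i) \<in> jordan_index \<mu>" for k i
  proof -
    let ?w = "if k = 1 then 0 else b (k - 1, i)"
    have "k \<noteq> 1 \<Longrightarrow> (k - 1, i) \<in> jordan_index \<mu>" using k by (auto simp: jordan_index_def)
    then have w: "?w \<in> std_lattice \<sigma>" using bs by (auto simp: std_lattice_iff)
    have Tw: "jet_ext A ?w = (if k = 1 then 0 else jet_ext A (b (k - 1, i)))"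
      using jet_z_lattice[OF E, of 0] by (simp add: jet_ext_def z_lattice_iff)
    have jet: "jet A (lift S A (b (k, i))) = jet A ?w"
      by (rule jet_cong[OF E lift_std[OF E bs[OF k]] w ch[OF k]])
    have "zmul 1 (jet_ext A (b (k, i))) - jet_ext A ?w =
        (zmul 1 (jet A (b (k, i))) - jet A (lift S A (b (k, i)))) +
        (zmul 1 (filt (\<lambda>_ n. S \<le> n) (b (k, i))) - filt (\<lambda>_ n. S \<le> n) ?w)"
      unfolding jet_ext_def jet zmul_add by simp
    also have "\<dots> \<in> z_lattice S"
      by (rule cv.subspace_add[OF subspace_z_lattice z_jet[OF nil bs[OF k]]]) (simp add: z_lattice_iff)
    finally show ?thesis unfolding Tw .
  qed
  ultimately show ?thesis unfolding jordan_def by blast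
qed

lemma nilp_orbit_jet_lattice_in_Gr_orbit:
  assumes A: "A \<in> nilp_orbit \<sigma> S \<mu>" and inj: "jet_inj A" and \<mu>: "is_partition \<mu>"
  shows "length \<mu> \<le> CARD('m)" and "enumer e \<eta> \<mu> S \<Longrightarrow> jet_lattice A \<in> Gr_orbit \<eta>"
proof -
  have nil: "A \<in> nilp_cone \<sigma> S" using A nilp_orbit_subset by blast
  obtain b where b: "jordan S (jet_lattice A) \<mu> b" using nilp_orbit_jet_lattice_jordan[OF A inj] by blast
  have "0 \<notin> set \<mu>" using \<mu> by (simp add: is_partition_def)
  note * = jordan_Gr_orbit[OF zsub_jet_lattice[OF nil] z_lattice_subset_jet_lattice[OF nil] b this]
  show "length \<mu> \<le> CARD('m)" "enumer e \<eta> \<mu> S \<Longrightarrow> jet_lattice A \<in> Gr_orbit \<eta>" by (rule *, assumption?)+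
qed

text \<open>\<open>pr\<close> conjugates \<open>z\<close> on \<open>L / z^S\<close> to
  \<open>Phi L\<close>. Only the chart is assumed, as lattices of the orbit near a slice lattice may
  lie outside the slice.\<close>

lemma Phi_in_nilp_orbit:
  assumes chart: "L \<in> Gr_chart \<sigma>" and L: "L \<in> Gr_orbit \<eta>" and e: "enumer e \<eta> \<mu> S"
  shows "Phi L \<in> nilp_orbit \<sigma> S \<mu>"
proof -
  have zL: "z_lattice S \<subseteq> L" by (rule Gr_orbit_jordan(1)[OF e L])
  obtain b where b: "basis_mod (jordan_index \<mu>) b (z_lattice S) L"
    and ch: "\<And>k i. (k, i) \<in> jordan_index \<mu> \<Longrightarrow> zmul 1 (b (k, i)) - (if k = 1 then 0 else b (k - 1, i)) \<in> z_lattice S"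
    using Gr_orbit_jordan(2)[OF e L] by (auto simp: jordan_def)
  have bL: "b p \<in> L" if "p \<in> jordan_index \<mu>" for p using b that by (rule basis_mod_subset)
  have prz: "pr v \<in> z_lattice S" if "v \<in> z_lattice S" for v using that by (simp add: z_lattice_iff)
  have "basis_mod (jordan_index \<mu>) (\<lambda>p. pr (b p)) (z_lattice S) (std_lattice \<sigma>)"
  proof (rule basis_mod_transport[OF subspace_z_lattice subspace_z_lattice finite_jordan_index
        chart_subspace[OF chart] _ _ _ _ _ b])
    show "pr v \<in> z_lattice S \<longleftrightarrow> v \<in> z_lattice S" if v: "v \<in> L" for v
    proof
      assume "pr v \<in> z_lattice S"
      then have "hlift \<sigma> L (pr v) = pr v" by (rule hlift_z_lattice[OF chart zL])
      then show "v \<in> z_lattice S" using hlift_pr[OF chart zL v] \<open>pr v \<in> z_lattice S\<close> by simp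
    qed (rule prz)
    show "\<exists>v\<in>L. w - pr v \<in> z_lattice S" if w: "w \<in> std_lattice \<sigma>" for w
    proof (rule bexI[OF _ hlift_in[OF chart]])
      have "pr (hlift \<sigma> L w) = w"
        using w by (intro lvec_eqI) (auto simp: coef_hlift[OF chart] std_lattice_iff)
      then show "w - pr (hlift \<sigma> L w) \<in> z_lattice S" by (simp add: z_lattice_iff)
    qed
  qed (simp_all add: pr_std filt_add filt_cmul)
  moreover have "lift S (Phi L) (pr (b (k, i))) - (if k = 1 then 0 else pr (b (k - 1, i))) \<in> z_lattice S"
    if k: "(k, i) \<in> jordan_index \<mu>" for k i
  proof -
    have "lift S (Phi L) (pr (b (k, i))) = cut S (pr (zmul 1 (b (k, i))))"
      using lift_Phi[OF chart zL pr_std] hlift_pr[OF chart zL bL[OF k]] by simp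
    moreover have "pr (zmul 1 (b (k, i)) - w) = pr (zmul 1 (b (k, i))) - pr w" for w
      by (rule lvec_eqI) simp
    then have "pr (zmul 1 (b (k, i))) - pr (if k = 1 then 0 else b (k - 1, i)) \<in> z_lattice S"
      using prz[OF ch[OF k]] by simp
    ultimately show ?thesis by (auto simp: z_lattice_iff)
  qed
  ultimately show ?thesis
    unfolding nilp_orbit_iff using Phi_End[OF chart zL] by blast
qed

text \<open>The lattices \<^term>\<open>jet_lattice A'\<close> for \<open>A'\<close> in the orbit near \<open>A\<close> approach \<^term>\<open>Psi0_S \<sigma> S A\<close>, although
  \<open>A'\<close> need not lie in the slice.\<close>

lemma orbit_near:
  assumes A: "A \<in> slice_nilp" "A \<in> cl_orbit \<mu>"
    and p: "p \<in> polyfun (End_coords \<sigma> S)" "p A \<noteq> 0"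
  obtains A' where "A' \<in> nilp_orbit \<sigma> S \<mu>" "jet_inj A'" "p A' \<noteq> 0"
proof -
  obtain \<delta> where \<delta>: "\<delta> \<in> polyfun (End_coords \<sigma> S)" "\<delta> A \<noteq> 0"
    "\<And>A. A \<in> End_D \<sigma> S \<Longrightarrow> \<delta> A \<noteq> 0 \<Longrightarrow> jet_inj A"
    by (rule jet_inj_open[OF A(1)]) (rule that)
  have "(\<lambda>B. p B * \<delta> B) \<in> polyfun (End_coords \<sigma> S)" using p(1) \<delta>(1) by (rule polyfun.mult)
  moreover have "p A * \<delta> A \<noteq> 0" using p(2) \<delta>(2) by simp
  ultimately obtain A' where A': "A' \<in> nilp_orbit \<sigma> S \<mu>" "p A' * \<delta> A' \<noteq> 0"
    using A(2) unfolding cl_orbit_iff by (elim conjE) (drule (1) bspec, blast)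
  moreover have "A' \<in> End_D \<sigma> S" using A'(1) by (simp add: nilp_orbit_def)
  ultimately show ?thesis using that \<delta>(3) by force
qed

text \<open>A neighbourhood of the lattice is pulled back along \<open>jet_frame\<close> to the
  nonvanishing of a polynomial in the operator. An operator of the orbit where it is nonzero gives a
  lattice of \<open>Gr_orbit \<eta>\<close> in the neighbourhood.\<close>

lemma Psi0_S_in_closure:
  assumes A: "A \<in> slice_nilp" "A \<in> cl_orbit \<mu>" and \<mu>: "is_partition \<mu>" and e: "enumer e \<eta> \<mu> S"
  shows "Psi0_S \<sigma> S A \<in> ztop loop_Gr_fspace closure_of Gr_orbit \<eta>"
  unfolding in_closure_of
proof (intro conjI allI impI)
  have chart: "Psi0_S \<sigma> S A \<in> Gr_chart \<sigma>" by (rule slice_lattices_chart[OF Psi0_S_in_slice_lattices[OF A(1)]])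
  then show "Psi0_S \<sigma> S A \<in> topspace (ztop loop_Gr_fspace)"
    using Gr_open_chart[of \<sigma>] unfolding topspace_def openin_loop_Gr_fspace by blast
  fix V
  assume "Psi0_S \<sigma> S A \<in> V \<and> openin (ztop loop_Gr_fspace) V"
  then have V: "Gr_open V" "Psi0_S \<sigma> S A \<in> V" by (auto simp: openin_loop_Gr_fspace)
  have "jet_lattice A \<in> loop_Gr" using chart slice_nilp_jet_lattice(3)[OF A(1)] by (simp add: Gr_chart_def)
  then have "jet_frame A \<in> Gr_frames frame_bound frame_dim \<and> frame_lattice frame_bound frame_dim (jet_frame A) = jet_lattice A"
    by (rule jet_frame_frame[OF slice_nilp_jet_lattice(1,2)[OF A(1)]])
  then have "jet_frame A \<in> frames_over frame_bound frame_dim V"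
    using V(2) slice_nilp_jet_lattice(3)[OF A(1)] by (simp add: frames_over_def)
  then obtain p where p: "p \<in> polyfun (frame_coords frame_bound frame_dim)" "p (jet_frame A) \<noteq> 0"
    "{b \<in> Gr_frames frame_bound frame_dim. p b \<noteq> 0} \<subseteq> frames_over frame_bound frame_dim V"
    using V(1) unfolding Gr_open_def openin_zariski by blast
  have "\<exists>q\<in>polyfun (End_coords \<sigma> S). \<forall>A\<in>End_D \<sigma> S. p (jet_frame A) = q A"
    using p(1) by (rule polyfun_pullback) (rule jet_frame_poly)
  then obtain q where q: "q \<in> polyfun (End_coords \<sigma> S)" "\<And>A. A \<in> End_D \<sigma> S \<Longrightarrow> p (jet_frame A) = q A"
    by blast
  have "q A \<noteq> 0" using p(2) q(2)[OF slice_nilp_End[OF A(1)]] by simp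
  then obtain A' where A': "A' \<in> nilp_orbit \<sigma> S \<mu>" "jet_inj A'" "q A' \<noteq> 0"
    using orbit_near[OF A q(1)] by blast
  have nil: "A' \<in> nilp_cone \<sigma> S" using A'(1) nilp_orbit_subset by blast
  have orb: "jet_lattice A' \<in> Gr_orbit \<eta>" by (rule nilp_orbit_jet_lattice_in_Gr_orbit(2)[OF A'(1,2) \<mu> e])
  then have "jet_lattice A' \<in> loop_Gr" using Gr_orbit_subset_loop_Gr by blast
  then have jet_frame: "jet_frame A' \<in> Gr_frames frame_bound frame_dim \<and> frame_lattice frame_bound frame_dim (jet_frame A') = jet_lattice A'"
    by (rule jet_frame_frame[OF nil A'(2)])
  moreover have "p (jet_frame A') \<noteq> 0" using A'(3) q(2)[OF nilp_End[OF nil]] by simp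
  ultimately have "jet_frame A' \<in> frames_over frame_bound frame_dim V" using p(3) by blast
  then have "jet_lattice A' \<in> V" using jet_frame by (simp add: frames_over_def)
  then show "\<exists>y. y \<in> Gr_orbit \<eta> \<and> y \<in> V" using orb by blast
qed

text \<open>As the image of \<open>L_0\<close> under an invertible matrix, \<open>L\<close> contains
  some \<open>z_lattice M\<close> and so is stable under power series; hence generators
  suffice.\<close>

lemma z_lattice_subsetI:
  fixes L :: "'m lvec set"
  assumes L: "L \<in> loop_Gr" and m: "\<And>j. mon j S \<in> L"
  shows "z_lattice S \<subseteq> L"
proof -
  have zs: "zsub L" by (rule loop_Gr_zsub[OF L])
  obtain A :: "complex fls ^ 'm ^ 'm" where A: "A \<in> GL_over UNIV" "L = (\<lambda>v. A *v v) ` std_lattice (\<lambda>_. 0)"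
    using L by (auto simp: loop_Gr_def)
  obtain B where "A ** B = Finite_Cartesian_Product.mat 1" using A(1) by (auto simp: GL_over_def)
  then have AB: "A *v (B *v v) = v" for v by (simp add: matrix_vector_mul_assoc)
  obtain M where M: "\<And>k v. v \<in> z_lattice k \<Longrightarrow> B *v v \<in> z_lattice (k - M)"
    using matrix_z_lattice_bound by blast
  have N: "z_lattice M \<subseteq> L"
  proof
    fix v :: "'m lvec" assume "v \<in> z_lattice M"
    then have "B *v v \<in> z_lattice 0" using M[of v M] by simp
    then have "B *v v \<in> std_lattice (\<lambda>_. 0)" unfolding z_lattice_eq_std by simp
    then have "A *v (B *v v) \<in> L" unfolding A(2) by (rule imageI)
    then show "v \<in> L" by (simp add: AB)
  qed
  show ?thesis
  proof
    fix v :: "'m lvec" assume v: "v \<in> z_lattice S"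
    have "v $ j *s axis j 1 \<in> L" for j
    proof -
      have "fls_shift S (v $ j) \<in> power_series"
        using v by (simp add: power_series_iff z_lattice_iff coef_def)
      then have "fls_shift S (v $ j) *s mon j S \<in> L"
        using m by (rule zsub_power_series_smult[OF zs N])
      then show ?thesis by (simp add: mon_eq_axis zmul_def fls_shifted_times_simps)
    qed
    moreover have "v = (\<Sum>j\<in>UNIV. v $ j *s axis j 1)"
      using matrix_vector_sum_columns[of "Finite_Cartesian_Product.mat 1" v]
      by (simp only: matrix_vector_mul_lid)
    moreover have "cv.subspace L" using zs by (simp add: zsub_def)
    ultimately show "v \<in> L" using cv.subspace_sum[of L UNIV "\<lambda>j. v $ j *s axis j 1"] by simp
  qed
qed

lemma closure_meets:
  assumes "L \<in> ztop loop_Gr_fspace closure_of Z" and chart: "L \<in> Gr_chart \<sigma>" and nz: "f L \<noteq> 0"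
    and reg: "\<And>N d. regular_on (frame_coords N d) (frames_over N d (Gr_chart \<sigma>)) (\<lambda>b. f (frame_lattice N d b))"
  obtains L' where "L' \<in> Z" "L' \<in> Gr_chart \<sigma>" "f L' \<noteq> 0"
proof -
  have "openin (ztop loop_Gr_fspace) {L \<in> Gr_chart \<sigma>. f L \<noteq> 0}"
    unfolding openin_loop_Gr_fspace by (rule Gr_open_nonzero[OF Gr_open_chart reg])
  moreover have "L \<in> {L \<in> Gr_chart \<sigma>. f L \<noteq> 0}" using chart nz by simp
  moreover have "\<forall>T. L \<in> T \<and> openin (ztop loop_Gr_fspace) T \<longrightarrow> (\<exists>y. y \<in> Z \<and> y \<in> T)"
    using assms(1) unfolding in_closure_of by (rule conjunct2)
  ultimately have "\<exists>y. y \<in> Z \<and> y \<in> {L \<in> Gr_chart \<sigma>. f L \<noteq> 0}" by (elim allE) (erule mp, rule conjI)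
  then show ?thesis using that by auto
qed

text \<open>On the chart, \<open>z_lattice S \<subseteq> L\<close> means that every
  \<open>mon j S\<close> equals its lift. This is a closed condition, and it holds for the chart
  lattices in \<open>Gr_orbit \<eta>\<close>.\<close>

lemma closure_in_slice_lattices:
  assumes L: "L \<in> slice \<sigma>" "L \<in> ztop loop_Gr_fspace closure_of Gr_orbit \<eta>" and e: "enumer e \<eta> \<mu> S"
  shows "L \<in> slice_lattices"
proof -
  have chart: "L \<in> Gr_chart \<sigma>" using L(1) slice_subset_Gr_chart by blast
  have nn: "- \<sigma> j \<le> S" for j using nonneg[of j] by simp
  have "hlift \<sigma> L (mon j S) = mon j S" for j
  proof (rule ccontr)
    assume "hlift \<sigma> L (mon j S) \<noteq> mon j S"
    then obtain i k where "coef (hlift \<sigma> L (mon j S)) i k \<noteq> coef (mon j S) i k" using lvec_eqI by blast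
    then have nz: "coef (hlift \<sigma> L (mon j S)) i k + - coef (mon j S) i k \<noteq> 0" by simp
    have reg: "regular_on (frame_coords N d) (frames_over N d (Gr_chart \<sigma>))
        (\<lambda>b. coef (hlift \<sigma> (frame_lattice N d b) (mon j S)) i k + - coef (mon j S) i k)" for N d
      by (intro regular_on_add hlift_regular nn regular_on_polyfun polyfun.const)
    obtain L' where L': "L' \<in> Gr_orbit \<eta>" "L' \<in> Gr_chart \<sigma>"
      "coef (hlift \<sigma> L' (mon j S)) i k + - coef (mon j S) i k \<noteq> 0"
      by (rule closure_meets[OF L(2) chart, of "\<lambda>L. coef (hlift \<sigma> L (mon j S)) i k + - coef (mon j S) i k"])
        (use nz reg in auto)
    have "mon j S \<in> L'"
      using Gr_orbit_jordan(1)[OF e L'(1)] by (auto simp: z_lattice_iff coef_mon)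
    then show False using L'(3) hlift_id[OF L'(2)] by simp
  qed
  then have "mon j S \<in> L" for j using hlift_in[OF chart] by metis
  moreover have "L \<in> loop_Gr" using chart by (simp add: Gr_chart_def)
  ultimately have "z_lattice S \<subseteq> L" by (intro z_lattice_subsetI)
  then show ?thesis using L(1) by (simp add: slice_lattices_def)
qed

text \<open>A polynomial composed with \<open>Phi\<close> is regular on the chart; if it is nonzero
  at \<open>L\<close>, it is nonzero at some chart lattice of the orbit.\<close>

lemma Phi_in_closure:
  assumes L: "L \<in> slice \<sigma>" "L \<in> ztop loop_Gr_fspace closure_of Gr_orbit \<eta>" and e: "enumer e \<eta> \<mu> S"
  shows "Phi L \<in> cl_orbit \<mu>"
proof -
  have LY: "L \<in> slice_lattices" by (rule closure_in_slice_lattices[OF L e])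
  have "\<exists>A'\<in>nilp_orbit \<sigma> S \<mu>. p A' \<noteq> 0"
    if p: "p \<in> polyfun (End_coords \<sigma> S)" "p (Phi L) \<noteq> 0" for p
  proof -
    have "regular_on (frame_coords N d) (frames_over N d (Gr_chart \<sigma>)) (\<lambda>b. p (Phi (frame_lattice N d b)))" for N d
      using p(1) by (rule regular_on_polyfun_comp) (rule Phi_coord_regular)
    then obtain L' where L': "L' \<in> Gr_orbit \<eta>" "L' \<in> Gr_chart \<sigma>" "p (Phi L') \<noteq> 0"
      using closure_meets[OF L(2) slice_lattices_chart[OF LY], of "\<lambda>L. p (Phi L)"] p(2) by blast
    then show ?thesis using Phi_in_nilp_orbit[OF L'(2,1) e] by blast
  qed
  then show ?thesis unfolding cl_orbit_iff using slice_nilp_End[OF Phi_in_slice_nilp[OF LY]] by blast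
qed

lemma Psi0_S_image_closure:
  assumes \<mu>: "is_partition \<mu>" and e: "enumer e \<eta> \<mu> S"
  shows "Psi0_S \<sigma> S ` (T_zbar \<sigma> S \<inter> cl_orbit \<mu>) = slice \<sigma> \<inter> ztop loop_Gr_fspace closure_of Gr_orbit \<eta>"
proof (intro equalityI subsetI)
  fix L assume "L \<in> Psi0_S \<sigma> S ` (T_zbar \<sigma> S \<inter> cl_orbit \<mu>)"
  then obtain A where A: "A \<in> T_zbar \<sigma> S" "A \<in> cl_orbit \<mu>" "L = Psi0_S \<sigma> S A" by blast
  have AX: "A \<in> slice_nilp" using A(1,2) cl_orbit_nilp by (auto simp: slice_nilp_def)
  show "L \<in> slice \<sigma> \<inter> ztop loop_Gr_fspace closure_of Gr_orbit \<eta>"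
    using Psi0_S_in_closure[OF AX A(2) \<mu> e] Psi0_S_in_slice_lattices[OF AX] A(3) by (simp add: slice_lattices_def)
next
  fix L assume "L \<in> slice \<sigma> \<inter> ztop loop_Gr_fspace closure_of Gr_orbit \<eta>"
  then have L: "L \<in> slice \<sigma>" "L \<in> ztop loop_Gr_fspace closure_of Gr_orbit \<eta>" by auto
  have LY: "L \<in> slice_lattices" by (rule closure_in_slice_lattices[OF L e])
  have "Phi L \<in> T_zbar \<sigma> S \<inter> cl_orbit \<mu>"
    using Phi_in_closure[OF L e] Phi_in_slice_nilp[OF LY] by (simp add: slice_nilp_def)
  moreover have "L = Psi0_S \<sigma> S (Phi L)" by (simp add: Psi0_S_Phi[OF LY])
  ultimately show "L \<in> Psi0_S \<sigma> S ` (T_zbar \<sigma> S \<inter> cl_orbit \<mu>)" by blast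
qed

section \<open>The base point of the slice and the number of parts\<close>

lemma z_bar_in_End: "z_bar \<sigma> S \<in> End_D \<sigma> S"
  using z_bar_cls
proof (rule End_D_I)
  show "z_bar \<sigma> S \<in> extensional (D_space \<sigma> S)" by (simp add: z_bar_def)
qed (auto simp: std_z zmul_add zmul_cmul z_lattice_iff)

lemma z_bar_in_T_zbar: "z_bar \<sigma> S \<in> T_zbar \<sigma> S"
proof -
  have "phi (z_bar \<sigma> S) v = 0" if "v \<in> std_lattice \<sigma>" for v
    using that by (simp add: phi_def lift_def z_bar_cls)
  then show ?thesis
    unfolding T_zbar_iff slice_op_def using z_bar_in_End mon_std
    by (auto simp: U_top_iff)
qed

lemma z_bar_in_nilp_orbit: "z_bar \<sigma> S \<in> nilp_orbit \<sigma> S (lambda_partition \<sigma> S)"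
proof -
  let ?l = "lambda_partition \<sigma> S"
  have ms: "mset ?l = image_mset (block \<sigma> S) (mset_set UNIV)"
    by (simp add: lambda_partition_def)
  have "size (mset ?l) = CARD('m)" unfolding ms by simp
  then have len: "length ?l = CARD('m)" by simp
  have "image_mset \<sigma> (mset_set UNIV) = image_mset (\<lambda>p. int p - S) (mset ?l)"
    unfolding ms multiset.map_comp comp_def block_eq by simp
  then have "image_mset \<sigma> (mset_set UNIV) = mset (map (\<lambda>p. int p - S) (pad CARD('m) ?l))"
    by (simp add: pad_def len)
  then obtain e where e: "enumer e \<sigma> ?l S" using enumer_exists[of ?l \<sigma> S] len by auto
  let ?b = "\<lambda>(k, i). mon (e i) (S - int k)"
  have "lift S (z_bar \<sigma> S) (?b (k, i)) - (if k = 1 then 0 else ?b (k - 1, i)) \<in> z_lattice S"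
    if k: "(k, i) \<in> jordan_index ?l" for k i
  proof -
    have "?b (k, i) \<in> std_lattice \<sigma>" using jordan_index_monomial_basis(1)[OF e] k by (rule basis_mod_subset)
    then have "lift S (z_bar \<sigma> S) (?b (k, i)) = cut S (mon (e i) (S - int k + 1))"
      by (simp add: lift_def z_bar_cls)
    then show ?thesis using k by (auto simp: z_lattice_iff coef_mon jordan_index_def of_nat_diff)
  qed
  then show ?thesis
    unfolding nilp_orbit_iff using z_bar_in_End jordan_index_monomial_basis(1)[OF e] by blast
qed

text \<open>Near \<open>z_bar\<close> the orbit contains an operator with injective jets, whose
  lattice has Jordan type \<open>\<mu>\<close> for \<open>z\<close>. The kernel of \<open>z\<close>
  on \<open>U((z)) / z^S U[[z]]\<close> has dimension \<open>m\<close>, which leaves room for at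
  most \<open>m\<close> chains.\<close>

lemma partition_length:
  assumes \<mu>: "is_partition \<mu>" and cl: "nilp_orbit \<sigma> S (lambda_partition \<sigma> S) \<subseteq> cl_orbit \<mu>"
  shows "length \<mu> \<le> CARD('m)"
proof -
  have z: "z_bar \<sigma> S \<in> nilp_orbit \<sigma> S (lambda_partition \<sigma> S)" by (rule z_bar_in_nilp_orbit)
  then have "z_bar \<sigma> S \<in> slice_nilp" using z_bar_in_T_zbar nilp_orbit_subset by (auto simp: slice_nilp_def)
  moreover have "z_bar \<sigma> S \<in> cl_orbit \<mu>" using z cl by blast
  ultimately show ?thesis
    using polyfun.const[of 1] one_neq_zero
  proof (rule orbit_near)
    fix A' assume "A' \<in> nilp_orbit \<sigma> S \<mu>" "jet_inj A'"
    then show "length \<mu> \<le> CARD('m)" using \<mu> by (rule nilp_orbit_jet_lattice_in_Gr_orbit(1))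
  qed
qed

end

theorem mainTheorem5:
  fixes \<sigma> :: "'m::finite \<Rightarrow> int" and S :: int
  assumes "z_lattice S \<subseteq> std_lattice \<sigma>"
  shows
    "(slice_embed \<sigma> S ` (T_zbar \<sigma> S \<inter> nilp_cone \<sigma> S) \<subseteq> T_z \<sigma> \<inter> N_z \<sigma> \<and>
      {L \<in> slice \<sigma>. z_lattice S \<subseteq> L} \<subseteq> Gr_chart \<sigma> \<and>
      fspace_isomorphism
        (End_D_fspace \<sigma> S) (T_zbar \<sigma> S \<inter> nilp_cone \<sigma> S)
        loop_Gr_fspace {L \<in> slice \<sigma>. z_lattice S \<subseteq> L}
        (Psi0_S \<sigma> S)) \<and>
     (\<forall>\<mu>. is_partition \<mu> \<and>
        nilp_orbit \<sigma> S (lambda_partition \<sigma> S)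
          \<subseteq> ztop (End_D_fspace \<sigma> S) closure_of nilp_orbit \<sigma> S \<mu> \<longrightarrow>
        length \<mu> \<le> CARD('m) \<and>
        (\<forall>\<eta> :: 'm \<Rightarrow> int.
           image_mset \<eta> (mset_set UNIV) = mset (map (\<lambda>p. int p - S) (pad CARD('m) \<mu>)) \<longrightarrow>
           fspace_isomorphism
             (End_D_fspace \<sigma> S)
             (T_zbar \<sigma> S \<inter> ztop (End_D_fspace \<sigma> S) closure_of nilp_orbit \<sigma> S \<mu>)
             loop_Gr_fspace
             (slice \<sigma> \<inter> ztop loop_Gr_fspace closure_of Gr_orbit \<eta>)
             (Psi0_S \<sigma> S)))"
proof -
  interpret slice_setup \<sigma> S using assms by unfold_locales
  show ?thesis
  proof (intro conjI allI impI; (elim conjE)?)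
    show "slice_embed \<sigma> S ` (T_zbar \<sigma> S \<inter> nilp_cone \<sigma> S) \<subseteq> T_z \<sigma> \<inter> N_z \<sigma>"
      using slice_embed_in unfolding slice_nilp_def by blast
    show "{L \<in> slice \<sigma>. z_lattice S \<subseteq> L} \<subseteq> Gr_chart \<sigma>"
      using slice_subset_Gr_chart by blast
    show "fspace_isomorphism (End_D_fspace \<sigma> S) (T_zbar \<sigma> S \<inter> nilp_cone \<sigma> S)
        loop_Gr_fspace {L \<in> slice \<sigma>. z_lattice S \<subseteq> L} (Psi0_S \<sigma> S)"
      using Psi0_S_isomorphism[of slice_nilp slice_lattices] bij_Psi0_S unfolding bij_betw_def slice_nilp_def slice_lattices_def by blast
  next
    fix \<mu>
    assume \<mu>: "is_partition \<mu>"
      and cl: "nilp_orbit \<sigma> S (lambda_partition \<sigma> S) \<subseteq> cl_orbit \<mu>"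
    show len: "length \<mu> \<le> CARD('m)" by (rule partition_length[OF \<mu> cl])
    fix \<eta> :: "'m \<Rightarrow> int"
    assume "image_mset \<eta> (mset_set UNIV) = mset (map (\<lambda>p. int p - S) (pad CARD('m) \<mu>))"
    then obtain e where e: "enumer e \<eta> \<mu> S" using enumer_exists[OF len] by blast
    show "fspace_isomorphism (End_D_fspace \<sigma> S) (T_zbar \<sigma> S \<inter> cl_orbit \<mu>)
        loop_Gr_fspace (slice \<sigma> \<inter> ztop loop_Gr_fspace closure_of Gr_orbit \<eta>) (Psi0_S \<sigma> S)"
      using cl_orbit_nilp by (intro Psi0_S_isomorphism Psi0_S_image_closure[OF \<mu> e]) (auto simp: slice_nilp_def)
  qed
qed

end
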